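(* Let $p\in[1,\infty)$, let $K$, $\beta$, $(\rho_t)_{t\in I}$ be as in the context, and assume that $|\cdot|^pK\in L^1(\mathbb R^N)$ and $\lim_{t\to0^+}\beta(t)=\infty$. If $(t_k)_{k\in\mathbb N}\subset I$ is infinitesimal and $(u_k)_{k\in\mathbb N}\subset L^p(\mathbb R^N)$ satisfies $$\sup_{k\in\mathbb N}\big(\|u_k\|_{L^p}+\mathcal F_{t_k,p}(u_k)\big)<\infty,$$ then $(u_k)$ is locally precompact in $L^p(\mathbb R^N)$ and any of its $L^p_{\rm loc}(\mathbb R^N)$ limits belongs to $X^p(\mathbb R^N)$.
   Context: $I=(0,1)$. $K\colon\mathbb R^N\to[0,\infty]$ is measurable, $K\not\equiv0$, with $|\cdot|^pK\in L^1_{\rm loc}(\mathbb R^N)$; $\beta\colon I\to(0,\infty)$ is Borel. Set $K_t(x)=\beta(t)^NK(\beta(t)x)$, $m_{K,p}(R)=\int_{B_R}|x|^pK(x)\,dx$, $\phi(t)=m_{K,p}(\beta(t))/\beta(t)^p$, and $\rho_t(x)=|x|^pK_t(x)/\phi(t)$; as a standing convention of the paper, $\phi(t)>0$ for all $t\in I$ (so $\rho_t$ is defined). For $u\in L^p(\mathbb R^N)$, $\mathcal F_{t,p}(u)=\int\int\frac{|u(x)-u(y)|^p}{|x-y|^p}\rho_t(x-y)\,dx\,dy=\frac1{\phi(t)}\int\int|u(x)-u(y)|^pK_t(x-y)\,dx\,dy$. $X^p(\mathbb R^N)=W^{1,p}(\mathbb R^N)$ if $p>1$, $BV(\mathbb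 R^N)$ if $p=1$. A set $\mathcal X\subset L^p(\mathbb R^N)$ is locally precompact in $L^p(\mathbb R^N)$ if it is precompact in $L^p(E)$ for every compact $E\subset\mathbb R^N$. *)

theory Defs
  imports "HOL-Analysis.Analysis"
begin

text \<open>Functions on R^N are modelled on an arbitrary Euclidean space 'a, N = DIM('a),
  with Lebesgue measure.\<close>

definition Lp_mem :: "real \<Rightarrow> ('a::euclidean_space \<Rightarrow> real) \<Rightarrow> bool" where
  "Lp_mem p u \<longleftrightarrow> u \<in> borel_measurable lebesgue \<and>
     (\<integral>\<^sup>+x. ennreal (\<bar>u x\<bar> powr p) \<partial>lebesgue) < \<infinity>"

definition Lp_norm :: "real \<Rightarrow> ('a::euclidean_space \<Rightarrow> real) \<Rightarrow> real" where
  "Lp_norm p u = enn2real (\<integral>\<^sup>+x. ennreal (\<bar>u x\<bar> powr p) \<partial>lebesgue) powr (1 / p)"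

definition Lp_dist_on :: "real \<Rightarrow> 'a::euclidean_space set \<Rightarrow> ('a \<Rightarrow> real) \<Rightarrow> ('a \<Rightarrow> real) \<Rightarrow> ennreal" where
  "Lp_dist_on p E u v = (\<integral>\<^sup>+x\<in>E. ennreal (\<bar>u x - v x\<bar> powr p) \<partial>lebesgue)"

definition Lp_mem_on :: "real \<Rightarrow> 'a::euclidean_space set \<Rightarrow> ('a \<Rightarrow> real) \<Rightarrow> bool" where
  "Lp_mem_on p E u \<longleftrightarrow> u \<in> borel_measurable (restrict_space lebesgue E) \<and>
     (\<integral>\<^sup>+x\<in>E. ennreal (\<bar>u x\<bar> powr p) \<partial>lebesgue) < \<infinity>"

definition Lp_loc :: "real \<Rightarrow> ('a::euclidean_space \<Rightarrow> real) \<Rightarrow> bool" where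
  "Lp_loc p u \<longleftrightarrow> u \<in> borel_measurable lebesgue \<and> (\<forall>E. compact E \<longrightarrow> Lp_mem_on p E u)"

text \<open>A sequence (u k) is locally precompact in L^p: for every compact E the set
  {u k} is precompact in L^p(E), i.e. every sequence in it has a subsequence converging in L^p(E).\<close>
definition locally_precompact_Lp :: "real \<Rightarrow> (nat \<Rightarrow> 'a::euclidean_space \<Rightarrow> real) \<Rightarrow> bool" where
  "locally_precompact_Lp p u \<longleftrightarrow>
     (\<forall>E. compact E \<longrightarrow> (\<forall>\<sigma>::nat \<Rightarrow> nat. \<exists>r g. strict_mono r \<and> Lp_mem_on p E g \<and>
        (\<lambda>j. Lp_dist_on p E (u (\<sigma> (r j))) g) \<longlonglongrightarrow> 0))"

definition partial :: "'a::euclidean_space \<Rightarrow> ('a \<Rightarrow> real) \<Rightarrow> 'a \<Rightarrow> real" where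
  "partial i f x = frechet_derivative f (at x) i"

coinductive smooth :: "('a::euclidean_space \<Rightarrow> real) \<Rightarrow> bool" where
  "(\<forall>x. f differentiable (at x)) \<Longrightarrow> (\<forall>i\<in>Basis. smooth (partial i f)) \<Longrightarrow> smooth f"

definition test_fun :: "('a::euclidean_space \<Rightarrow> real) \<Rightarrow> bool" where
  "test_fun \<phi> \<longleftrightarrow> smooth \<phi> \<and> compact (closure {x. \<phi> x \<noteq> 0})"

definition W1p :: "real \<Rightarrow> ('a::euclidean_space \<Rightarrow> real) \<Rightarrow> bool" where
  "W1p p u \<longleftrightarrow> Lp_mem p u \<and>
     (\<forall>i\<in>Basis. \<exists>g. Lp_mem p g \<and> (\<forall>\<phi>. test_fun \<phi> \<longrightarrow>
        (\<integral>x. u x * partial i \<phi> x \<partial>lebesgue) = - (\<integral>x. g x * \<phi> x \<partial>lebesgue)))"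

definition divergence :: "('a::euclidean_space \<Rightarrow> 'a) \<Rightarrow> 'a \<Rightarrow> real" where
  "divergence \<Phi> x = (\<Sum>i\<in>Basis. partial i (\<lambda>y. \<Phi> y \<bullet> i) x)"

definition BV :: "('a::euclidean_space \<Rightarrow> real) \<Rightarrow> bool" where
  "BV u \<longleftrightarrow> Lp_mem 1 u \<and>
     (\<exists>C. \<forall>\<Phi>::'a \<Rightarrow> 'a. (\<forall>i\<in>Basis. test_fun (\<lambda>y. \<Phi> y \<bullet> i)) \<and> (\<forall>x. norm (\<Phi> x) \<le> 1) \<longrightarrow>
        (\<integral>x. u x * divergence \<Phi> x \<partial>lebesgue) \<le> C)"

definition Xp :: "real \<Rightarrow> ('a::euclidean_space \<Rightarrow> real) \<Rightarrow> bool" where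
  "Xp p u \<longleftrightarrow> (if p > 1 then W1p p u else BV u)"

definition Kt :: "('a::euclidean_space \<Rightarrow> ennreal) \<Rightarrow> (real \<Rightarrow> real) \<Rightarrow> real \<Rightarrow> 'a \<Rightarrow> ennreal" where
  "Kt K \<beta> t x = ennreal (\<beta> t ^ DIM('a)) * K (\<beta> t *\<^sub>R x)"

definition mKp :: "('a::euclidean_space \<Rightarrow> ennreal) \<Rightarrow> real \<Rightarrow> real \<Rightarrow> real" where
  "mKp K p R = enn2real (\<integral>\<^sup>+x\<in>ball 0 R. ennreal (norm x powr p) * K x \<partial>lebesgue)"

definition phiK :: "('a::euclidean_space \<Rightarrow> ennreal) \<Rightarrow> (real \<Rightarrow> real) \<Rightarrow> real \<Rightarrow> real \<Rightarrow> real" where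
  "phiK K \<beta> p t = mKp K p (\<beta> t) / \<beta> t powr p"

definition Fnl :: "('a::euclidean_space \<Rightarrow> ennreal) \<Rightarrow> (real \<Rightarrow> real) \<Rightarrow> real \<Rightarrow> real \<Rightarrow> ('a \<Rightarrow> real) \<Rightarrow> ennreal" where
  "Fnl K \<beta> p t u = ennreal (1 / phiK K \<beta> p t) *
     (\<integral>\<^sup>+x. \<integral>\<^sup>+y. ennreal (\<bar>u x - u y\<bar> powr p) * Kt K \<beta> t (x - y) \<partial>lebesgue \<partial>lebesgue)"

end

theory Submission
  imports Defs "HOL-Complex_Analysis.Great_Picard" "HOL-Library.Diagonal_Subsequence"
begin

text \<open>Let the shift energy of u at h be the p-th power of the L^p norm of the increment
  of u by h. By Tonelli the nonlocal energy is the average of the shift energy against the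
  rescaled kernel. The kernel is bounded below on a compact set S of positive measure, and
  S overlaps its small translates in at least half of its measure (Steinhaus); writing a small
  shift as a difference of two elements of S bounds its energy, and doubling extends the bound to
  all shifts: the energy of u_k at h is at most C (|h| + 1/b_k)^p, where b_k tends to infinity.
  Local precompactness is then the Frechet-Kolmogorov criterion, and every limit v has shift energy
  at most C |h|^p, so its difference quotients are bounded in L^p. For p = 1 this bounds the
  variation directly; for p > 1 uniform convexity yields midpoint combinations of the quotients
  that converge strongly to the weak derivative.\<close>

section \<open>Convexity of powers\<close>

text \<open>The hypotheses on the kernel are integral ones, without symmetry or a radial profile, so
  positivity is available only on some compact \<open>S\<close> that may lie far from 0. A short
  shift is therefore reached as a difference of two points of \<open>S\<close>, not as a point where
  \<open>K\<close> is large. Integrability of |x|^p K gives phi(t) <= m / beta(t)^p, with m its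
  total integral. The bound on the functional thus becomes an unnormalised energy of order b_k^(-p),
  and shifts of length at most d / b_k have shift energy of that order. A longer shift h needs about
  log2(|h| b_k) doublings, each costing the factor 2^p; altogether (|h| b_k)^p, so b_k cancels. The
  term 1 / b_k records that nothing finer is known below that scale. Smallness is hence uniform only
  in the tail of the sequence, which dictates the form of the compactness criterion. Minkowski and
  Hoelder inequalities are replaced by pointwise convexity inequalities; the constants they lose are
  harmless because the homogeneity in |h| is kept. Lebesgue measurable data are replaced by Borel
  representatives, because Tonelli needs joint measurability of compositions with x - y.\<close>

lemma powr_gt_tangent_at_1:
  fixes p s :: real
  assumes p: "1 < p" and s: "0 \<le> s" "s \<noteq> 1"
  shows "1 + p * (s - 1) < s powr p"
proof (cases "s = 0")
  case True
  then show ?thesis using p by simp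
next
  case False
  then have s0: "0 < s" using s by simp
  have der: "((\<lambda>x. x powr p) has_real_derivative p * x powr (p - 1)) (at x)" if "0 < x" for x :: real
    using that by (auto intro!: derivative_eq_intros)
  consider "s < 1" | "1 < s" using s by linarith
  then show ?thesis
  proof cases
    case 1
    obtain z where z: "s < z" "z < 1" "1 powr p - s powr p = (1 - s) * (p * z powr (p - 1))"
      using MVT2[OF 1, of "\<lambda>x. x powr p" "\<lambda>x. p * x powr (p - 1)"] der s0 by force
    have "z powr (p - 1) < 1"
      using powr_less_mono2[of "p - 1" z 1] z s0 p by simp
    then have "(1 - s) * (p * z powr (p - 1)) < (1 - s) * (p * 1)"
      using 1 p by (intro mult_strict_left_mono) auto
    then show ?thesis using z(3) by (simp add: algebra_simps)
  next
    case 2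
    obtain z where z: "1 < z" "z < s" "s powr p - 1 powr p = (s - 1) * (p * z powr (p - 1))"
      using MVT2[OF 2, of "\<lambda>x. x powr p" "\<lambda>x. p * x powr (p - 1)"] der by force
    have "1 < z powr (p - 1)"
      using powr_less_mono2[of "p - 1" 1 z] z p by simp
    then have "(s - 1) * (p * 1) < (s - 1) * (p * z powr (p - 1))"
      using 2 p by (intro mult_strict_left_mono) auto
    then show ?thesis using z(3) by (simp add: algebra_simps)
  qed
qed

lemma powr_gt_tangent:
  fixes p m s :: real
  assumes p: "1 < p" and m: "0 < m" and s: "0 \<le> s" "s \<noteq> m"
  shows "m powr p + p * m powr (p - 1) * (s - m) < s powr p"
proof -
  have "m powr p * (1 + p * (s / m - 1)) < m powr p * (s / m) powr p"
    using powr_gt_tangent_at_1[of p "s / m"] assms by (intro mult_strict_left_mono) auto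
  also have "\<dots> = s powr p"
    using m s by (simp add: powr_divide)
  finally show ?thesis
    using m by (simp add: powr_diff field_simps)
qed

lemma powr_ge_tangent:
  fixes p m s :: real
  assumes p: "1 \<le> p" and m: "0 \<le> m" and s: "0 \<le> s"
  shows "m powr p + p * m powr (p - 1) * (s - m) \<le> s powr p"
proof -
  \<comment> \<open>At \<open>m = 0\<close> the tangent is the constant 0, even for
    \<open>p = 1\<close>, because \<open>0 powr 0 = 0\<close>.\<close>
  consider "m = 0" | "p = 1" "0 < m" | "s = m" | "1 < p" "0 < m" "s \<noteq> m" using p m by linarith
  then show ?thesis
  proof cases
    case 4
    then show ?thesis using powr_gt_tangent[of p m s] s by simp
  qed (use s in auto)
qed

text \<open>Add the tangent inequalities at the mean \<open>m\<close> of \<bar>a\<bar> and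
  \<bar>b\<bar>: the linear terms cancel.\<close>

lemma abs_midpoint_powr_le:
  fixes a b p :: real
  assumes p: "1 \<le> p"
  shows "\<bar>(a + b) / 2\<bar> powr p \<le> (\<bar>a\<bar> powr p + \<bar>b\<bar> powr p) / 2"
proof -
  define m where "m = (\<bar>a\<bar> + \<bar>b\<bar>) / 2"
  have m: "0 \<le> m" by (simp add: m_def)
  have "\<bar>(a + b) / 2\<bar> powr p \<le> m powr p"
    using p by (intro powr_mono2) (auto simp: m_def)
  moreover have "p * m powr (p - 1) * (\<bar>a\<bar> - m) + p * m powr (p - 1) * (\<bar>b\<bar> - m) = 0"
    unfolding distrib_left[symmetric] by (simp add: m_def)
  ultimately show ?thesis
    using powr_ge_tangent[OF p m, of "\<bar>a\<bar>"] powr_ge_tangent[OF p m, of "\<bar>b\<bar>"] by simp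
qed

text \<open>Strictness has two sources. If the absolute values agree then \<open>b = - a\<close>,
  and the midpoint is 0; otherwise neither of them equals their mean, and the tangent inequalities
  there are strict.\<close>

lemma abs_midpoint_powr_less:
  fixes a b p :: real
  assumes p: "1 < p" and ne: "a \<noteq> b"
  shows "\<bar>(a + b) / 2\<bar> powr p < (\<bar>a\<bar> powr p + \<bar>b\<bar> powr p) / 2"
proof -
  define m where "m = (\<bar>a\<bar> + \<bar>b\<bar>) / 2"
  have m: "0 < m" using ne by (auto simp: m_def)
  have le: "\<bar>(a + b) / 2\<bar> powr p \<le> m powr p"
    using p by (intro powr_mono2) (auto simp: m_def)
  show ?thesis
  proof (cases "\<bar>a\<bar> = \<bar>b\<bar>")
    case True
    then have "b = - a" "a \<noteq> 0" using ne by (auto simp: abs_if split: if_splits)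
    then show ?thesis by simp
  next
    case False
    have "p * m powr (p - 1) * (\<bar>a\<bar> - m) + p * m powr (p - 1) * (\<bar>b\<bar> - m) = 0"
      unfolding distrib_left[symmetric] by (simp add: m_def)
    moreover have "\<bar>a\<bar> \<noteq> m" "\<bar>b\<bar> \<noteq> m" using False by (auto simp: m_def)
    ultimately show ?thesis
      using powr_gt_tangent[OF p m, of "\<bar>a\<bar>"] powr_gt_tangent[OF p m, of "\<bar>b\<bar>"] le by simp
  qed
qed

lemma abs_add_powr_le:
  fixes a b p :: real
  assumes p: "1 \<le> p"
  shows "\<bar>a + b\<bar> powr p \<le> 2 powr (p - 1) * (\<bar>a\<bar> powr p + \<bar>b\<bar> powr p)"
proof -
  have "\<bar>a + b\<bar> powr p = 2 powr p * \<bar>(a + b) / 2\<bar> powr p"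
    by (subst powr_mult[symmetric]) auto
  also have "\<dots> \<le> 2 powr p * ((\<bar>a\<bar> powr p + \<bar>b\<bar> powr p) / 2)"
    by (intro mult_left_mono abs_midpoint_powr_le p) auto
  finally show ?thesis by (simp add: powr_diff)
qed

lemma abs_diff_powr_le:
  fixes a b p :: real
  assumes p: "1 \<le> p"
  shows "\<bar>a - b\<bar> powr p \<le> 2 powr (p - 1) * (\<bar>a\<bar> powr p + \<bar>b\<bar> powr p)"
  using abs_add_powr_le[OF p, of a "- b"] by simp

text \<open>A pointwise form of uniform convexity that can be integrated as it stands. Both sides
  are homogeneous of degree \<open>p\<close>, so pairs with maximum norm 1 suffice, and there
  compactness turns strict convexity into a quantitative gap.\<close>

lemma abs_powr_uniformly_convex:
  fixes p e :: real
  assumes p: "1 < p" and e: "0 < e"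
  obtains C where "0 \<le> C"
    "\<And>a b. \<bar>a - b\<bar> powr p \<le> e * (\<bar>a\<bar> powr p + \<bar>b\<bar> powr p)
        + C * ((\<bar>a\<bar> powr p + \<bar>b\<bar> powr p) / 2 - \<bar>(a + b) / 2\<bar> powr p)"
proof -
  define D where "D = (\<lambda>a b :: real. (\<bar>a\<bar> powr p + \<bar>b\<bar> powr p) / 2 - \<bar>(a + b) / 2\<bar> powr p)"
  \<comment> \<open>The normalised pairs for which the \<open>e\<close> term alone might not
    suffice. The inequality is not strict, so that \<open>S\<close> is closed.\<close>
  define S where "S = {z :: real \<times> real. max \<bar>fst z\<bar> \<bar>snd z\<bar> = 1 \<and>
      e * (\<bar>fst z\<bar> powr p + \<bar>snd z\<bar> powr p) \<le> \<bar>fst z - snd z\<bar> powr p}"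
  have D0: "0 \<le> D a b" for a b
    using abs_midpoint_powr_le[of p a b] p by (simp add: D_def)
  have scale: "\<bar>r * x\<bar> powr p = r powr p * \<bar>x\<bar> powr p" if "0 \<le> r" for r x :: real
    using that by (simp add: abs_mult powr_mult)
  have "closed S"
    unfolding S_def using p
    by (intro closed_Collect_conj closed_Collect_eq closed_Collect_le continuous_intros
        continuous_on_powr') auto
  moreover have "S \<subseteq> {-1..1} \<times> {-1..1}"
  proof
    fix z assume "z \<in> S"
    then have "max \<bar>fst z\<bar> \<bar>snd z\<bar> = 1" by (simp add: S_def)
    then have "\<bar>fst z\<bar> \<le> 1" "\<bar>snd z\<bar> \<le> 1" by linarith+
    then show "z \<in> {-1..1} \<times> {-1..1}" by (simp add: mem_Times_iff abs_le_iff)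
  qed
  then have "bounded S"
    using bounded_subset bounded_Times bounded_closed_interval by metis
  ultimately have cS: "compact S" by (simp add: compact_eq_bounded_closed)
  have contD: "continuous_on S (\<lambda>z. D (fst z) (snd z))"
    unfolding D_def using p by (intro continuous_intros continuous_on_powr') auto
  obtain \<delta> where \<delta>: "0 < \<delta>" "\<And>z. z \<in> S \<Longrightarrow> \<delta> \<le> D (fst z) (snd z)"
  proof (cases "S = {}")
    case True
    then show ?thesis using that[of 1] by auto
  next
    case False
    obtain z where z: "z \<in> S" "\<forall>y\<in>S. D (fst z) (snd z) \<le> D (fst y) (snd y)"
      using continuous_attains_inf[OF cS False contD] by auto
    \<comment> \<open>On the diagonal the left side of the condition defining \<open>S\<close> is 2
      e > 0 and the right side is 0, so \<open>S\<close> avoids it and the convexity gap is positive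
      on \<open>S\<close>.\<close>
    have "fst z \<noteq> snd z"
    proof
      assume eq: "fst z = snd z"
      then have "e * (2 * \<bar>snd z\<bar> powr p) \<le> 0" "\<bar>snd z\<bar> = 1" using z(1) by (auto simp: S_def)
      then show False using e by simp
    qed
    then have "0 < D (fst z) (snd z)"
      using abs_midpoint_powr_less[OF p] by (simp add: D_def)
    then show ?thesis using that z by auto
  qed
  \<comment> \<open>Normalised entries differ by at most 2, so \<open>C * \<delta>\<close> already
    dominates the left side on \<open>S\<close>.\<close>
  define C where "C = 2 powr p / \<delta>"
  have C: "0 \<le> C" using \<delta> by (simp add: C_def)
  have "\<bar>a - b\<bar> powr p \<le> e * (\<bar>a\<bar> powr p + \<bar>b\<bar> powr p) + C * D a b" for a b
  proof -
    define r where "r = max \<bar>a\<bar> \<bar>b\<bar>"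
    show ?thesis
    proof (cases "r = 0")
      case True
      then have "a = 0" "b = 0" unfolding r_def by linarith+
      then show ?thesis by (simp add: D_def)
    next
      case False
      then have r: "0 < r" unfolding r_def by linarith
      define x where "x = a / r"
      define y where "y = b / r"
      have ab: "a = r * x" "b = r * y" using r by (auto simp: x_def y_def)
      have m: "max \<bar>x\<bar> \<bar>y\<bar> = 1"
        using r max_divide_distrib_right[of "\<bar>a\<bar>" "\<bar>b\<bar>" r] by (simp add: x_def y_def r_def[symmetric])
      have "\<bar>x - y\<bar> powr p \<le> e * (\<bar>x\<bar> powr p + \<bar>y\<bar> powr p) + C * D x y"
      proof (cases "(x, y) \<in> S")
        case True
        have "\<bar>x - y\<bar> powr p \<le> 2 powr p"
          using m p by (intro powr_mono2) auto
        also have "\<dots> = C * \<delta>" using \<delta> by (simp add: C_def)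
        also have "\<dots> \<le> C * D x y" using \<delta>(2)[OF True] C by (intro mult_left_mono) auto
        finally show ?thesis using e by (simp add: add_increasing)
      next
        case False
        then have "\<bar>x - y\<bar> powr p \<le> e * (\<bar>x\<bar> powr p + \<bar>y\<bar> powr p)" using m by (simp add: S_def)
        then show ?thesis using C D0[of x y] by (simp add: add_increasing2)
      qed
      then have "r powr p * \<bar>x - y\<bar> powr p
          \<le> r powr p * (e * (\<bar>x\<bar> powr p + \<bar>y\<bar> powr p) + C * D x y)"
        by (intro mult_left_mono) auto
      moreover have "D a b = r powr p * D x y"
      proof -
        have "(a + b) / 2 = r * ((x + y) / 2)" by (simp add: ab algebra_simps)
        then show ?thesis unfolding D_def
          using scale[of r x] scale[of r y] scale[of r "(x + y) / 2"] r ab by (simp add: algebra_simps)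
      qed
      moreover have "\<bar>a - b\<bar> powr p = r powr p * \<bar>x - y\<bar> powr p"
        using scale[of r "x - y"] r ab by (simp add: algebra_simps)
      ultimately show ?thesis
        using scale[of r x] scale[of r y] r ab by (simp add: algebra_simps)
    qed
  qed
  then show ?thesis using that[OF C] by (simp add: D_def)
qed

section \<open>Shift energy and nonlocal energy\<close>

lemma nn_integral_lborel_translate:
  fixes f :: "'a::euclidean_space \<Rightarrow> ennreal"
  assumes [measurable]: "f \<in> borel_measurable borel"
  shows "(\<integral>\<^sup>+x. f (x + a) \<partial>lborel) = (\<integral>\<^sup>+x. f x \<partial>lborel)"
proof -
  have "(\<integral>\<^sup>+x. f x \<partial>lborel) = (\<integral>\<^sup>+x. f x \<partial>distr lborel borel ((+) a))"
    by (simp add: lborel_distr_plus)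
  also have "\<dots> = (\<integral>\<^sup>+x. f (x + a) \<partial>lborel)"
    by (subst nn_integral_distr) (auto simp: add.commute)
  finally show ?thesis by simp
qed

lemma nn_integral_lborel_scale:
  fixes f :: "'a::euclidean_space \<Rightarrow> ennreal"
  assumes [measurable]: "f \<in> borel_measurable borel" and c: "c \<noteq> 0"
  shows "(\<integral>\<^sup>+x. ennreal (\<bar>c\<bar> ^ DIM('a)) * f (c *\<^sub>R x) \<partial>lborel) = (\<integral>\<^sup>+x. f x \<partial>lborel)"
proof -
  have "(\<integral>\<^sup>+x. f x \<partial>lborel) =
      (\<integral>\<^sup>+x. f x \<partial>density (distr lborel borel (\<lambda>x. 0 + c *\<^sub>R x)) (\<lambda>_. ennreal (\<bar>c\<bar> ^ DIM('a))))"
    by (simp only: lborel_affine[OF c, of 0, symmetric])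
  also have "\<dots> = (\<integral>\<^sup>+x. ennreal (\<bar>c\<bar> ^ DIM('a)) * f (c *\<^sub>R x) \<partial>lborel)"
    by (subst nn_integral_density, measurable, subst nn_integral_distr) auto
  finally show ?thesis by simp
qed

lemma nn_integral_lborel_reflect:
  fixes f :: "'a::euclidean_space \<Rightarrow> ennreal"
  assumes "f \<in> borel_measurable borel"
  shows "(\<integral>\<^sup>+x. f (- x) \<partial>lborel) = (\<integral>\<^sup>+x. f x \<partial>lborel)"
  using nn_integral_lborel_scale[OF assms, of "-1"] by simp

definition shift_energy :: "real \<Rightarrow> ('a::euclidean_space \<Rightarrow> real) \<Rightarrow> 'a \<Rightarrow> ennreal" where
  "shift_energy p u h = (\<integral>\<^sup>+x. ennreal (\<bar>u (x + h) - u x\<bar> powr p) \<partial>lborel)"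

lemma shift_energy_measurable [measurable]:
  fixes u :: "'a::euclidean_space \<Rightarrow> real"
  assumes [measurable]: "u \<in> borel_measurable borel"
  shows "shift_energy p u \<in> borel_measurable borel"
  unfolding shift_energy_def[abs_def] by measurable

lemma shift_energy_minus:
  fixes u :: "'a::euclidean_space \<Rightarrow> real"
  assumes [measurable]: "u \<in> borel_measurable borel"
  shows "shift_energy p u (- h) = shift_energy p u h"
  using nn_integral_lborel_translate[of "\<lambda>x. ennreal (\<bar>u (x + - h) - u x\<bar> powr p)" h]
  by (simp add: shift_energy_def abs_minus_commute)

text \<open>The increment by \<open>g + h\<close> is the increment by \<open>h\<close> taken at
  \<open>x + g\<close> plus the increment by \<open>g\<close>; translation invariance removes the
  base point.\<close>

lemma shift_energy_add_le:
  fixes u :: "'a::euclidean_space \<Rightarrow> real"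
  assumes [measurable]: "u \<in> borel_measurable borel" and p: "1 \<le> p"
  shows "shift_energy p u (g + h)
    \<le> ennreal (2 powr (p - 1)) * (shift_energy p u g + shift_energy p u h)"
proof -
  let ?f = "\<lambda>x. ennreal (\<bar>u (x + h) - u x\<bar> powr p)"
  let ?g = "\<lambda>x. ennreal (\<bar>u (x + g) - u x\<bar> powr p)"
  have "shift_energy p u (g + h) \<le> (\<integral>\<^sup>+x. ennreal (2 powr (p - 1)) * (?f (x + g) + ?g x) \<partial>lborel)"
    unfolding shift_energy_def
  proof (intro nn_integral_mono)
    fix x
    have "\<bar>u (x + (g + h)) - u x\<bar> powr p
        \<le> 2 powr (p - 1) * (\<bar>u (x + g + h) - u (x + g)\<bar> powr p + \<bar>u (x + g) - u x\<bar> powr p)"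
      using abs_add_powr_le[OF p, of "u (x + g + h) - u (x + g)" "u (x + g) - u x"]
      by (simp add: add.assoc)
    then show "ennreal (\<bar>u (x + (g + h)) - u x\<bar> powr p)
        \<le> ennreal (2 powr (p - 1)) * (?f (x + g) + ?g x)"
      by (simp add: ennreal_plus[symmetric] ennreal_mult[symmetric] del: ennreal_plus)
  qed
  also have "\<dots> = ennreal (2 powr (p - 1)) * ((\<integral>\<^sup>+x. ?f (x + g) \<partial>lborel) + (\<integral>\<^sup>+x. ?g x \<partial>lborel))"
    by (simp add: nn_integral_cmult nn_integral_add)
  also have "(\<integral>\<^sup>+x. ?f (x + g) \<partial>lborel) = (\<integral>\<^sup>+x. ?f x \<partial>lborel)"
    by (rule nn_integral_lborel_translate) measurable
  finally show ?thesis by (simp add: shift_energy_def add.commute)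
qed

text \<open>For equal shifts the constant is 2 * 2^(p-1) = 2^p, exactly the homogeneity of |h|^p, so
  iterated doubling loses nothing.\<close>

lemma shift_energy_double:
  fixes u :: "'a::euclidean_space \<Rightarrow> real"
  assumes u: "u \<in> borel_measurable borel" and p: "1 \<le> p"
  shows "shift_energy p u (2 ^ n *\<^sub>R h) \<le> ennreal (2 powr (real n * p)) * shift_energy p u h"
proof (induction n)
  case 0
  then show ?case by simp
next
  case (Suc n)
  let ?h = "2 ^ n *\<^sub>R h"
  have "shift_energy p u (2 ^ Suc n *\<^sub>R h) = shift_energy p u (?h + ?h)"
    by (simp add: scaleR_2[symmetric])
  also have "\<dots> \<le> ennreal (2 powr (p - 1)) * (shift_energy p u ?h + shift_energy p u ?h)"
    by (rule shift_energy_add_le[OF u p])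
  also have "\<dots> = ennreal (2 powr p) * shift_energy p u ?h"
  proof -
    have "ennreal (2 powr p) = ennreal (2 powr (p - 1)) * 2"
      by (simp add: powr_diff ennreal_mult''[symmetric] ennreal_numeral[symmetric] del: ennreal_numeral)
    then show ?thesis by (simp add: mult.assoc mult_2)
  qed
  also have "\<dots> \<le> ennreal (2 powr p) * (ennreal (2 powr (real n * p)) * shift_energy p u h)"
    by (intro mult_left_mono Suc.IH) auto
  also have "\<dots> = ennreal (2 powr (real (Suc n) * p)) * shift_energy p u h"
    unfolding mult.assoc[symmetric]
    by (simp add: ennreal_mult[symmetric] powr_add[symmetric] distrib_right)
  finally show ?case .
qed

text \<open>Substitute w = x - y and exchange the integrals. The increment that appears is by - w;
  evenness of the shift energy, not of \<open>G\<close>, removes the sign.\<close>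

lemma nonlocal_energy_eq_shift_energy:
  fixes u :: "'a::euclidean_space \<Rightarrow> real" and G :: "'a \<Rightarrow> ennreal"
  assumes [measurable]: "u \<in> borel_measurable borel" "G \<in> borel_measurable borel"
  shows "(\<integral>\<^sup>+x. \<integral>\<^sup>+y. ennreal (\<bar>u x - u y\<bar> powr p) * G (x - y) \<partial>lborel \<partial>lborel)
    = (\<integral>\<^sup>+w. G w * shift_energy p u w \<partial>lborel)"
proof -
  have inner: "(\<integral>\<^sup>+y. ennreal (\<bar>u x - u y\<bar> powr p) * G (x - y) \<partial>lborel)
      = (\<integral>\<^sup>+w. ennreal (\<bar>u (x + - w) - u x\<bar> powr p) * G w \<partial>lborel)" for x
  proof -
    let ?f = "\<lambda>y. ennreal (\<bar>u x - u y\<bar> powr p) * G (x - y)"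
    have "(\<integral>\<^sup>+y. ?f y \<partial>lborel) = (\<integral>\<^sup>+y. ?f (y + x) \<partial>lborel)"
      by (rule nn_integral_lborel_translate[symmetric]) measurable
    also have "\<dots> = (\<integral>\<^sup>+w. ?f (- w + x) \<partial>lborel)"
      by (rule nn_integral_lborel_reflect[symmetric]) measurable
    finally show ?thesis by (simp add: abs_minus_commute)
  qed
  have "(\<integral>\<^sup>+x. \<integral>\<^sup>+y. ennreal (\<bar>u x - u y\<bar> powr p) * G (x - y) \<partial>lborel \<partial>lborel)
      = (\<integral>\<^sup>+x. \<integral>\<^sup>+w. ennreal (\<bar>u (x + - w) - u x\<bar> powr p) * G w \<partial>lborel \<partial>lborel)"
    by (simp only: inner)
  also have "\<dots> = (\<integral>\<^sup>+w. \<integral>\<^sup>+x. ennreal (\<bar>u (x + - w) - u x\<bar> powr p) * G w \<partial>lborel \<partial>lborel)"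
    by (rule lborel_pair.Fubini'[symmetric]) measurable
  also have "\<dots> = (\<integral>\<^sup>+w. G w * shift_energy p u (- w) \<partial>lborel)"
    unfolding shift_energy_def
    by (subst mult.commute, intro nn_integral_cong nn_integral_cmult) measurable
  finally show ?thesis by (simp add: shift_energy_minus)
qed

section \<open>From a positive set of the kernel to a bound on all shifts\<close>

text \<open>Outer regularity gives an open \<open>U\<close> around \<open>S\<close> with excess less
  than half the measure of \<open>S\<close>. A translate of \<open>S\<close> by at most the distance
  to the complement of \<open>U\<close> stays in \<open>U\<close>, so at least half of it must fall
  in \<open>S\<close>.\<close>

lemma Steinhaus_overlap:
  fixes S :: "'a::euclidean_space set"
  assumes S: "compact S" and pos: "0 < emeasure lborel S"
  obtains d where "0 < d"
    "\<And>w. norm w \<le> d \<Longrightarrow> emeasure lborel S \<le> 2 * emeasure lborel (S \<inter> {z. z - w \<in> S})"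
proof -
  define m where "m = measure lborel S"
  have em: "emeasure lborel S = ennreal m"
    using emeasure_compact_finite[OF S] by (simp add: m_def emeasure_eq_ennreal_measure)
  then have m: "0 < m" using pos by simp
  have [measurable]: "S \<in> sets borel" using S by (simp add: borel_compact)
  obtain U where U: "open U" "S \<subseteq> U" "emeasure lborel (U - S) < ennreal (m / 2)"
    using outer_regular_lborel[of S "m / 2"] m by auto
  have [measurable]: "U \<in> sets borel" using U(1) by simp
  obtain d where d: "0 < d" "(\<Union>x\<in>S. cball x d) \<subseteq> U"
    using compact_subset_open_imp_cball_epsilon_subset[OF S U(1,2)] by auto
  have "emeasure lborel S \<le> 2 * emeasure lborel (S \<inter> {z. z - w \<in> S})" if w: "norm w \<le> d" for w
  proof -
    define T where "T = {z. z - w \<in> S}"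
    have [measurable]: "T \<in> sets borel" unfolding T_def by measurable
    have "emeasure lborel T = emeasure lborel S"
    proof -
      have "emeasure lborel T = (\<integral>\<^sup>+x. indicator S (x + - w) \<partial>lborel)"
        by (subst nn_integral_indicator[symmetric])
          (auto simp: T_def indicator_def simp del: nn_integral_indicator intro!: nn_integral_cong)
      also have "\<dots> = (\<integral>\<^sup>+x. indicator S x \<partial>lborel)"
        by (rule nn_integral_lborel_translate) measurable
      finally show ?thesis by simp
    qed
    have "T \<subseteq> U"
    proof
      fix z assume "z \<in> T"
      then have "z - w \<in> S" "z \<in> cball (z - w) d" using w by (auto simp: T_def dist_norm)
      then show "z \<in> U" using d(2) by blast
    qed
    then have "T \<subseteq> (S \<inter> T) \<union> (U - S)" by auto
    then have "emeasure lborel T \<le> emeasure lborel ((S \<inter> T) \<union> (U - S))"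
      by (intro emeasure_mono) auto
    also have "\<dots> \<le> emeasure lborel (S \<inter> T) + emeasure lborel (U - S)"
      by (intro emeasure_subadditive) auto
    also have "\<dots> \<le> emeasure lborel (S \<inter> T) + ennreal (m / 2)"
      using U(3) by (intro add_left_mono) auto
    finally have le: "ennreal m \<le> emeasure lborel (S \<inter> T) + ennreal (m / 2)"
      by (simp add: \<open>emeasure lborel T = emeasure lborel S\<close> em)
    have "emeasure lborel (S \<inter> T) \<le> emeasure lborel S"
      by (intro emeasure_mono) auto
    then have fin: "emeasure lborel (S \<inter> T) < \<infinity>" using em by (auto simp: le_less_trans)
    then obtain q where q: "emeasure lborel (S \<inter> T) = ennreal q" "0 \<le> q"
      by (metis ennreal_cases infinity_ennreal_def order_less_irrefl)
    have "m \<le> q + m / 2"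
      using le q m by (simp add: ennreal_plus[symmetric] del: ennreal_plus)
    then have "ennreal m \<le> ennreal (2 * q)" using q by (intro ennreal_leI) simp
    then show ?thesis using q em by (simp add: T_def[symmetric] ennreal_mult)
  qed
  then show ?thesis using that d by auto
qed

text \<open>The set where \<open>K\<close> is positive is the countable union of the bounded sets
  \<open>A n\<close>, so one of these is not null; inner regularity then makes it compact.\<close>

lemma kernel_bounded_below_on_compact:
  fixes K :: "'a::euclidean_space \<Rightarrow> ennreal"
  assumes [measurable]: "K \<in> borel_measurable borel" and nz: "\<not> (AE x in lborel. K x = 0)"
  obtains S c where "compact S" "0 < emeasure lborel S" "0 < (c::real)"
    "\<And>x. x \<in> S \<Longrightarrow> ennreal c \<le> K x"
proof -
  define A where "A = (\<lambda>n. {x. ennreal (1 / Suc n) \<le> K x} \<inter> cball 0 (real n))"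
  have [measurable]: "A n \<in> sets borel" for n unfolding A_def by measurable
  have "\<exists>n. 0 < emeasure lborel (A n)"
  proof (rule ccontr)
    assume "\<nexists>n. 0 < emeasure lborel (A n)"
    then have "A n \<in> null_sets lborel" for n by (auto simp: null_sets_def not_gr_zero)
    then have N: "(\<Union>n. A n) \<in> null_sets lborel" by auto
    have "AE x in lborel. K x = 0"
    proof (rule AE_I'[OF N])
      show "{x \<in> space lborel. K x \<noteq> 0} \<subseteq> (\<Union>n. A n)"
      proof
        fix x assume "x \<in> {x \<in> space lborel. K x \<noteq> 0}"
        then have "0 < K x" by (simp add: zero_less_iff_neq_zero)
        then obtain e where e: "0 < e" "ennreal e < K x"
          using ennreal_rat_dense[of 0 "K x"] by (metis ennreal_eq_0_iff leI less_numeral_extra(3) not_gr_zero)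
        obtain n where n: "1 / Suc n < e" using e(1) nat_approx_posE by blast
        obtain k where k: "norm x \<le> real k" using real_arch_simple by blast
        define j where "j = max n k"
        have "1 / Suc j \<le> 1 / Suc n" by (simp add: j_def frac_le)
        then have "ennreal (1 / Suc j) \<le> ennreal e" using n by (intro ennreal_leI) linarith
        then have "ennreal (1 / Suc j) \<le> K x" using e(2) by order
        then have "x \<in> A j" using e(2) k by (auto simp: A_def j_def)
        then show "x \<in> (\<Union>n. A n)" by blast
      qed
    qed
    then show False using nz by simp
  qed
  then obtain n where n: "0 < emeasure lborel (A n)" by auto
  have "emeasure lborel (A n) \<le> emeasure lborel (cball (0::'a) (real n))"
    by (intro emeasure_mono) (auto simp: A_def)
  then have "emeasure lborel (A n) < \<infinity>"
    using emeasure_compact_finite[of "cball (0::'a) (real n)"] by (auto simp: le_less_trans)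
  then obtain q where q: "emeasure lborel (A n) = ennreal q" "0 < q"
    using n by (metis ennreal_cases ennreal_less_zero_iff infinity_ennreal_def order_less_irrefl)
  have Ale: "A n \<in> sets lebesgue" by simp
  \<comment> \<open>The tolerance \<open>q\<close> is the whole measure of \<open>A n\<close>:
    removing \<open>T\<close> then loses mass, so \<open>T\<close> is not null.\<close>
  obtain T where T: "closed T" "T \<subseteq> A n" "emeasure lebesgue (A n - T) < ennreal q"
    using sets_lebesgue_inner_closed[OF Ale q(2)] by metis
  have "bounded (A n)" by (rule bounded_subset[of "cball 0 (real n)"]) (auto simp: A_def)
  then have cT: "compact T" using T by (simp add: compact_eq_bounded_closed bounded_subset)
  have [measurable]: "T \<in> sets borel" using T(1) by simp
  have "emeasure lborel (A n - T) < emeasure lborel (A n)"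
    using T(3) q by simp
  then have "emeasure lborel T \<noteq> 0"
  proof (rule contrapos_pn)
    assume "emeasure lborel T = 0"
    then have "T \<in> null_sets lborel" by (simp add: null_sets_def)
    then have "emeasure lborel (A n - T) = emeasure lborel (A n)"
      by (intro emeasure_Diff_null_set) auto
    then show "\<not> emeasure lborel (A n - T) < emeasure lborel (A n)" by simp
  qed
  then show ?thesis
    using that[OF cT, of "1 / Suc n"] T(2) by (auto simp: A_def zero_less_iff_neq_zero)
qed

text \<open>For z in the overlap of \<open>S\<close> and its translate, w = z - (z - w) has both
  terms in \<open>S\<close>. Averaging the resulting inequality over z replaces the two unknown
  shift energies by their integral over \<open>S\<close>, where \<open>K\<close> is at least
  \<open>c\<close>. Neither \<open>d\<close> nor \<open>A\<close> depends on \<open>u\<close>,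
  \<open>b\<close> or \<open>h\<close>.\<close>

lemma shift_energy_le_kernel_average:
  fixes K :: "'a::euclidean_space \<Rightarrow> ennreal"
  assumes [measurable]: "K \<in> borel_measurable borel"
    and nz: "\<not> (AE x in lborel. K x = 0)" and p: "1 \<le> p"
  obtains d A where "0 < d" "0 \<le> A"
    "\<And>u b h. u \<in> borel_measurable borel \<Longrightarrow> 0 < b \<Longrightarrow> norm h \<le> d / b \<Longrightarrow>
      shift_energy p u h \<le> ennreal A * (\<integral>\<^sup>+z. K z * shift_energy p u (z /\<^sub>R b) \<partial>lborel)"
proof -
  obtain S c where S: "compact S" "0 < emeasure lborel S" "0 < (c::real)"
    "\<And>x. x \<in> S \<Longrightarrow> ennreal c \<le> K x"
    using kernel_bounded_below_on_compact[OF assms(1) nz] by blast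
  obtain d where d: "0 < d"
    "\<And>w. norm w \<le> d \<Longrightarrow> emeasure lborel S \<le> 2 * emeasure lborel (S \<inter> {z. z - w \<in> S})"
    using Steinhaus_overlap[OF S(1,2)] by blast
  have [measurable]: "S \<in> sets borel" using S(1) by (simp add: borel_compact)
  define m where "m = measure lborel S"
  have em: "emeasure lborel S = ennreal m"
    using emeasure_compact_finite[OF S(1)] by (simp add: m_def emeasure_eq_ennreal_measure)
  then have m: "0 < m" using S(2) by simp
  define q where "q = 2 powr (p - 1)"
  have q: "0 < q" by (simp add: q_def)
  \<comment> \<open>One factor 2 comes from the half overlap and one from the two terms,
    \<open>q\<close> from the inequality for sums, 1 / c from the lower bound on \<open>K\<close>,
    and 1 / m from averaging.\<close>
  define A where "A = 4 * q / (c * m)"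
  have A: "0 \<le> A" using q S(3) m by (simp add: A_def)
  have "shift_energy p u h \<le> ennreal A * (\<integral>\<^sup>+z. K z * shift_energy p u (z /\<^sub>R b) \<partial>lborel)"
    if [measurable]: "u \<in> borel_measurable borel" and b: "0 < b" and h: "norm h \<le> d / b" for u b h
  proof -
    \<comment> \<open>In the rescaled variable the kernel is \<open>K\<close> itself, and the
      admissible radius is the fixed \<open>d\<close>.\<close>
    define w where "w = b *\<^sub>R h"
    have w: "norm w \<le> d" using h b by (simp add: w_def field_simps)
    define V where "V = (\<lambda>z. shift_energy p u (z /\<^sub>R b))"
    have [measurable]: "V \<in> borel_measurable borel"
      unfolding V_def by measurable
    define J where "J = (\<integral>\<^sup>+z. indicator S z * V z \<partial>lborel)"
    define E where "E = S \<inter> {z. z - w \<in> S}"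
    have [measurable]: "E \<in> sets borel" unfolding E_def by measurable
    have split: "V w \<le> ennreal q * (V z + V (z - w))" for z
    proof -
      have "V w = shift_energy p u (z /\<^sub>R b + - ((z - w) /\<^sub>R b))"
        by (simp add: V_def scaleR_diff_right)
      also have "\<dots> \<le> ennreal q * (shift_energy p u (z /\<^sub>R b) + shift_energy p u (- ((z - w) /\<^sub>R b)))"
        unfolding q_def by (rule shift_energy_add_le[OF that(1) p])
      finally show ?thesis by (simp only: shift_energy_minus[OF that(1)] V_def)
    qed
    have "V w * emeasure lborel E = (\<integral>\<^sup>+z. V w * indicator E z \<partial>lborel)"
      by (simp add: nn_integral_cmult)
    also have "\<dots> \<le> (\<integral>\<^sup>+z. ennreal q * (indicator S z * V z + indicator S (z + - w) * V (z + - w)) \<partial>lborel)"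
      using split by (intro nn_integral_mono) (auto simp: E_def indicator_def)
    also have "\<dots> = ennreal q * (J + (\<integral>\<^sup>+z. indicator S (z + - w) * V (z + - w) \<partial>lborel))"
      unfolding J_def by (subst nn_integral_cmult, measurable, subst nn_integral_add) auto
    also have "(\<integral>\<^sup>+z. indicator S (z + - w) * V (z + - w) \<partial>lborel) = J"
      unfolding J_def by (rule nn_integral_lborel_translate) measurable
    finally have 1: "V w * emeasure lborel E \<le> ennreal q * (J + J)" .
    have "V w * ennreal m \<le> V w * (2 * emeasure lborel E)"
      using d(2)[OF w] by (intro mult_left_mono) (auto simp: em E_def)
    also have "\<dots> = 2 * (V w * emeasure lborel E)" by (simp add: ac_simps)
    also have "\<dots> \<le> 2 * (ennreal q * (J + J))" by (intro mult_left_mono 1) auto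
    also have "\<dots> = ennreal (4 * q) * J"
      using q by (simp add: ennreal_mult mult_2[symmetric] ac_simps)
    finally have 2: "V w * ennreal m \<le> ennreal (4 * q) * J" .
    have 3: "J \<le> ennreal (1 / c) * (\<integral>\<^sup>+z. K z * V z \<partial>lborel)"
    proof -
      have "J \<le> (\<integral>\<^sup>+z. ennreal (1 / c) * (K z * V z) \<partial>lborel)"
        unfolding J_def
      proof (intro nn_integral_mono)
        fix z
        have "indicator S z \<le> ennreal (1 / c) * K z"
        proof (cases "z \<in> S")
          case True
          have "1 = ennreal (1 / c) * ennreal c" using S(3) by (simp add: ennreal_mult[symmetric])
          also have "\<dots> \<le> ennreal (1 / c) * K z" using S(4)[OF True] by (intro mult_left_mono) auto
          finally show ?thesis using True by simp
        qed simp
        then show "indicator S z * V z \<le> ennreal (1 / c) * (K z * V z)"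
          unfolding mult.assoc[symmetric] by (intro mult_right_mono) auto
      qed
      then show ?thesis by (simp add: nn_integral_cmult)
    qed
    have "V w = (V w * ennreal m) * ennreal (1 / m)"
      using m by (simp add: mult.assoc ennreal_mult[symmetric])
    also have "\<dots> \<le> (ennreal (4 * q) * (ennreal (1 / c) * (\<integral>\<^sup>+z. K z * V z \<partial>lborel))) * ennreal (1 / m)"
      using 2 3 by (intro mult_right_mono order_trans[OF 2] mult_left_mono) auto
    also have "\<dots> = ennreal (4 * q) * ennreal (1 / c) * ennreal (1 / m) * (\<integral>\<^sup>+z. K z * V z \<partial>lborel)"
      by (simp only: ac_simps)
    also have "ennreal (4 * q) * ennreal (1 / c) * ennreal (1 / m) = ennreal A"
      using q m S(3) by (simp add: A_def ennreal_mult[symmetric] del: ennreal_mult')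
    finally have "V w \<le> ennreal A * (\<integral>\<^sup>+z. K z * V z \<partial>lborel)" .
    moreover have "V w = shift_energy p u h" using b by (simp add: V_def w_def)
    ultimately show ?thesis by (simp add: V_def)
  qed
  then show ?thesis using that[OF d(1) A] by blast
qed

text \<open>Halve \<open>h\<close> until it enters the ball of radius \<open>d / b\<close>, bound
  its energy there by a multiple of b^(-p), and double back. Choosing the least number of halvings
  makes the doubling cost comparable to (|h| b)^p.\<close>

lemma shift_energy_growth:
  fixes K :: "'a::euclidean_space \<Rightarrow> ennreal"
  assumes K: "K \<in> borel_measurable borel"
    and nz: "\<not> (AE x in lborel. K x = 0)" and p: "1 \<le> p" and M: "0 \<le> M"
  obtains C where "0 \<le> C"
    "\<And>u b h. u \<in> borel_measurable borel \<Longrightarrow> 0 < b \<Longrightarrow>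
      (\<integral>\<^sup>+z. K z * shift_energy p u (z /\<^sub>R b) \<partial>lborel) \<le> ennreal (M / b powr p) \<Longrightarrow>
      shift_energy p u h \<le> ennreal (C * (norm h + 1 / b) powr p)"
proof -
  obtain d A where d: "0 < d" "0 \<le> A" and dA:
    "\<And>u b h. u \<in> borel_measurable borel \<Longrightarrow> 0 < b \<Longrightarrow> norm h \<le> d / b \<Longrightarrow>
      shift_energy p u h \<le> ennreal A * (\<integral>\<^sup>+z. K z * shift_energy p u (z /\<^sub>R b) \<partial>lborel)"
    using shift_energy_le_kernel_average[OF K nz p] by blast
  \<comment> \<open>The summand 1 serves shifts inside the ball of radius \<open>d / b\<close>, the
    other one the shifts that need halving.\<close>
  define C where "C = A * M * ((2 / d) powr p + 1)"
  have C: "0 \<le> C" using d M by (simp add: C_def)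
  have "shift_energy p u h \<le> ennreal (C * (norm h + 1 / b) powr p)"
    if u: "u \<in> borel_measurable borel" and b: "0 < b"
      and en: "(\<integral>\<^sup>+z. K z * shift_energy p u (z /\<^sub>R b) \<partial>lborel) \<le> ennreal (M / b powr p)" for u b h
  proof -
    have small: "shift_energy p u g \<le> ennreal (A * M * (1 / b) powr p)" if "norm g \<le> d / b" for g
    proof -
      have "shift_energy p u g \<le> ennreal A * ennreal (M / b powr p)"
        using dA[OF u b that] en by (meson mult_left_mono order_trans zero_le)
      also have "\<dots> = ennreal (A * M * (1 / b) powr p)"
        using d M b by (simp add: ennreal_mult[symmetric] powr_divide del: ennreal_mult')
      finally show ?thesis .
    qed
    show ?thesis
    proof (cases "norm h \<le> d / b")
      case True
      have "A * M * (1 / b) powr p \<le> A * M * (norm h + 1 / b) powr p"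
        using d M b p by (intro mult_left_mono powr_mono2) auto
      also have "\<dots> \<le> C * (norm h + 1 / b) powr p"
        using d M by (intro mult_right_mono) (auto simp: C_def algebra_simps)
      finally show ?thesis using small[OF True] by (meson ennreal_leI order_trans)
    next
      case False
      define P where "P = (\<lambda>n. norm h \<le> 2 ^ n * (d / b))"
      obtain k where "norm h / (d / b) < 2 ^ k" using real_arch_pow[of 2 "norm h / (d / b)"] by auto
      then have "P k" using d b by (simp add: P_def field_simps)
      define n where "n = (LEAST n. P n)"
      have Pn: "P n" unfolding n_def using \<open>P k\<close> by (rule LeastI)
      have "\<not> P 0" using False by (simp add: P_def)
      then obtain j where j: "n = Suc j" using Pn by (cases n) auto
      \<comment> \<open>One halving fewer would not have been enough, which bounds 2^n from
        above.\<close>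
      have "\<not> P j" using not_less_Least[of j P] j unfolding n_def by auto
      then have lt: "2 ^ n < (2 / d) * norm h * b"
        using d b by (simp add: P_def j field_simps)
      have "norm ((1 / 2 ^ n) *\<^sub>R h) \<le> d / b"
        using Pn by (simp add: P_def field_simps)
      then have le: "shift_energy p u ((1 / 2 ^ n) *\<^sub>R h) \<le> ennreal (A * M * (1 / b) powr p)"
        by (rule small)
      have "2 powr (real n * p) = (2 ^ n) powr p"
        by (simp add: powr_powr[symmetric] powr_realpow)
      also have "\<dots> \<le> ((2 / d) * norm h * b) powr p"
        using lt p by (intro powr_mono2) auto
      also have "\<dots> = (2 / d) powr p * norm h powr p * b powr p"
        by (simp only: powr_mult)
      finally have pw: "2 powr (real n * p) \<le> (2 / d) powr p * norm h powr p * b powr p" .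
      have "shift_energy p u h = shift_energy p u (2 ^ n *\<^sub>R ((1 / 2 ^ n) *\<^sub>R h))" by simp
      also have "\<dots> \<le> ennreal (2 powr (real n * p)) * shift_energy p u ((1 / 2 ^ n) *\<^sub>R h)"
        by (rule shift_energy_double[OF u p])
      also have "\<dots> \<le> ennreal (2 powr (real n * p)) * ennreal (A * M * (1 / b) powr p)"
        by (intro mult_left_mono le) auto
      also have "\<dots> = ennreal (2 powr (real n * p) * (A * M * (1 / b) powr p))"
        using d M by (simp add: ennreal_mult)
      also have "\<dots> \<le> ennreal (((2 / d) powr p * norm h powr p * b powr p) * (A * M * (1 / b) powr p))"
        using d M by (intro ennreal_leI mult_right_mono pw) auto
      \<comment> \<open>Here \<open>b\<close> cancels: the number of doublings compensates the
        smallness of the energy.\<close>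
      also have "((2 / d) powr p * norm h powr p * b powr p) * (A * M * (1 / b) powr p)
          = A * M * (2 / d) powr p * norm h powr p"
        using b by (simp add: powr_divide)
      also have "\<dots> \<le> C * (norm h + 1 / b) powr p"
        using d M b p by (intro mult_mono powr_mono2) (auto simp: C_def algebra_simps)
      finally show ?thesis by (simp add: ennreal_leI)
    qed
  qed
  then show ?thesis using that[OF C] by blast
qed

section \<open>Compactness in L^p\<close>

lemma tendsto_abs_diff_powr:
  fixes f :: "'b \<Rightarrow> real"
  assumes "(f \<longlongrightarrow> l) F" and "0 < p"
  shows "((\<lambda>k. ennreal (\<bar>a - f k\<bar> powr p)) \<longlongrightarrow> ennreal (\<bar>a - l\<bar> powr p)) F"
  using assms by (intro tendsto_ennrealI tendsto_powr' tendsto_intros) auto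

text \<open>Takes the place of the Hoelder inequality wherever only local integrability or a crude
  uniform bound matters.\<close>

lemma abs_le_1_plus_powr:
  fixes x p :: real
  assumes "1 \<le> p"
  shows "\<bar>x\<bar> \<le> 1 + \<bar>x\<bar> powr p"
proof (cases "\<bar>x\<bar> \<le> 1")
  case True
  then show ?thesis by (simp add: add_increasing2)
next
  case False
  then have "\<bar>x\<bar> powr 1 \<le> \<bar>x\<bar> powr p" using assms by (intro powr_mono) auto
  then show ?thesis by simp
qed

text \<open>Riesz-Fischer without the triangle inequality in L^p: the increments of a fast
  subsequence carry weights 2^k inside the power, so that one integrable series forces geometric
  decay almost everywhere. Fatou returns to the full sequence.\<close>

lemma Lp_Cauchy_imp_convergent:
  fixes w :: "nat \<Rightarrow> 'b \<Rightarrow> real"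
  assumes p: "1 \<le> p" and [measurable]: "\<And>j. w j \<in> borel_measurable M"
    and Cauchy: "\<And>e. 0 < e \<Longrightarrow>
      \<exists>N. \<forall>i\<ge>N. \<forall>j\<ge>N. (\<integral>\<^sup>+x. ennreal (\<bar>w i x - w j x\<bar> powr p) \<partial>M) \<le> ennreal e"
  obtains g where "g \<in> borel_measurable M"
    "(\<lambda>j. \<integral>\<^sup>+x. ennreal (\<bar>w j x - g x\<bar> powr p) \<partial>M) \<longlonglongrightarrow> 0"
proof -
  have "\<exists>N. \<forall>i\<ge>N. \<forall>j\<ge>N. (\<integral>\<^sup>+x. ennreal (\<bar>w i x - w j x\<bar> powr p) \<partial>M) \<le> ennreal ((1 / 4 ^ k) powr p)" for k :: nat
    by (rule Cauchy) simp
  then obtain N where N: "\<And>k i j. N k \<le> i \<Longrightarrow> N k \<le> j \<Longrightarrow>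
      (\<integral>\<^sup>+x. ennreal (\<bar>w i x - w j x\<bar> powr p) \<partial>M) \<le> ennreal ((1 / 4 ^ k) powr p)"
    by metis
  \<comment> \<open>Summing the thresholds gives an increasing index that exceeds both
    \<open>k\<close> and \<open>N k\<close>.\<close>
  define r where "r = (\<lambda>k. k + (\<Sum>i\<le>k. N i))"
  have rN: "N k \<le> r k" for k
    using member_le_sum[of k "{..k}" N] by (simp add: r_def)
  have rmono: "r k \<le> r (Suc k)" for k by (simp add: r_def)
  have rk: "k \<le> r k" for k by (simp add: r_def)
  \<comment> \<open>With tolerance 4^(-k p), the weight 2^k still leaves integrals of size 2^(-k p),
    which are summable.\<close>
  define f where "f = (\<lambda>k x. ennreal ((2 ^ k * \<bar>w (r (Suc k)) x - w (r k) x\<bar>) powr p))"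
  have [measurable]: "f k \<in> borel_measurable M" for k unfolding f_def by measurable
  have "(\<integral>\<^sup>+x. (\<Sum>k. f k x) \<partial>M) = (\<Sum>k. \<integral>\<^sup>+x. f k x \<partial>M)"
    by (rule nn_integral_suminf) measurable
  also have "\<dots> \<le> (\<Sum>k. ennreal ((1 / 2) ^ k))"
  proof (intro suminf_le summableI)
    fix k
    have "(\<integral>\<^sup>+x. f k x \<partial>M) = ennreal ((2 ^ k) powr p) * (\<integral>\<^sup>+x. ennreal (\<bar>w (r (Suc k)) x - w (r k) x\<bar> powr p) \<partial>M)"
      by (simp add: f_def powr_mult ennreal_mult nn_integral_cmult)
    also have "\<dots> \<le> ennreal ((2 ^ k) powr p) * ennreal ((1 / 4 ^ k) powr p)"
      using rN[of k] rmono[of k] by (intro mult_left_mono N) auto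
    also have "\<dots> = ennreal ((1 / 2 ^ k) powr p)"
    proof -
      have "(2::real) ^ k * (1 / 4 ^ k) = 1 / 2 ^ k"
        using power_mult_distrib[of "2::real" 2 k] by (simp add: field_simps)
      then show ?thesis by (simp add: ennreal_mult[symmetric] powr_mult[symmetric])
    qed
    also have "\<dots> \<le> ennreal ((1 / 2) ^ k)"
    proof (intro ennreal_leI)
      have "(1 / 2 ^ k) powr p \<le> (1 / 2 ^ k) powr (1::real)"
        using p by (intro powr_mono') auto
      then show "(1 / 2 ^ k) powr p \<le> (1 / 2 :: real) ^ k" by (simp add: power_one_over)
    qed
    finally show "(\<integral>\<^sup>+x. f k x \<partial>M) \<le> ennreal ((1 / 2) ^ k)" .
  qed
  also have "\<dots> < \<infinity>"
    by (subst suminf_ennreal2) (auto intro!: summable_geometric)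
  finally have fin: "(\<integral>\<^sup>+x. (\<Sum>k. f k x) \<partial>M) \<noteq> \<infinity>" by simp
  have AEfin: "AE x in M. (\<Sum>k. f k x) \<noteq> \<infinity>"
    by (rule nn_integral_PInf_AE[OF _ fin]) measurable
  define g where "g = (\<lambda>x. lim (\<lambda>k. w (r k) x))"
  have [measurable]: "g \<in> borel_measurable M" unfolding g_def by measurable
  have conv: "AE x in M. (\<lambda>k. w (r k) x) \<longlonglongrightarrow> g x"
    using AEfin
  proof eventually_elim
    fix x assume x: "(\<Sum>k. f k x) \<noteq> \<infinity>"
    then obtain s where s: "0 \<le> s" "(\<Sum>k. f k x) = ennreal s"
      by (metis ennreal_cases infinity_ennreal_def)
    define a where "a = (\<lambda>k. w (r (Suc k)) x - w (r k) x)"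
    have bd: "\<bar>a k\<bar> \<le> (1 + s) * (1 / 2) ^ k" for k
    proof -
      have "f k x \<le> (\<Sum>k. f k x)"
        using sum_le_suminf[of "\<lambda>k. f k x" "{k}"] by simp
      then have "(2 ^ k * \<bar>a k\<bar>) powr p \<le> s" using s by (simp add: f_def a_def)
      \<comment> \<open>This removes the exponent, so that the weight 2^k yields a geometric
        majorant for the increments themselves.\<close>
      moreover have "2 ^ k * \<bar>a k\<bar> \<le> 1 + (2 ^ k * \<bar>a k\<bar>) powr p"
        using abs_le_1_plus_powr[OF p, of "2 ^ k * \<bar>a k\<bar>"] by (simp add: abs_mult)
      ultimately have "2 ^ k * \<bar>a k\<bar> \<le> 1 + s" by linarith
      then show ?thesis by (simp add: field_simps)
    qed
    have "summable a"
      by (rule summable_comparison_test'[where g = "\<lambda>k. (1 + s) * (1 / 2) ^ k" and N = 0])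
        (use bd in \<open>auto intro!: summable_mult summable_geometric\<close>)
    then have "(\<lambda>n. \<Sum>k<n. a k) \<longlonglongrightarrow> suminf a" by (rule summable_LIMSEQ)
    moreover have "(\<Sum>k<n. a k) = w (r n) x - w (r 0) x" for n
      by (induction n) (auto simp: a_def)
    ultimately have "(\<lambda>n. w (r n) x - w (r 0) x + w (r 0) x) \<longlonglongrightarrow> suminf a + w (r 0) x"
      by (intro tendsto_intros) simp
    then have "(\<lambda>n. w (r n) x) \<longlonglongrightarrow> suminf a + w (r 0) x" by simp
    then show "(\<lambda>k. w (r k) x) \<longlonglongrightarrow> g x" by (simp add: g_def limI)
  qed
  have "(\<lambda>j. \<integral>\<^sup>+x. ennreal (\<bar>w j x - g x\<bar> powr p) \<partial>M) \<longlonglongrightarrow> 0"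
  proof (rule order_tendstoI)
    fix e :: ennreal assume "0 < e"
    then obtain e' where e': "0 < e'" "ennreal e' < e"
      by (metis dense ennreal_cases ennreal_less_zero_iff not_less_iff_gr_or_eq top.not_eq_extremum)
    obtain n where n: "\<forall>i\<ge>n. \<forall>j\<ge>n. (\<integral>\<^sup>+x. ennreal (\<bar>w i x - w j x\<bar> powr p) \<partial>M) \<le> ennreal e'"
      using Cauchy[OF e'(1)] by blast
    show "\<forall>\<^sub>F j in sequentially. (\<integral>\<^sup>+x. ennreal (\<bar>w j x - g x\<bar> powr p) \<partial>M) < e"
      unfolding eventually_sequentially
    proof (intro exI allI impI)
      fix j assume j: "n \<le> j"
      \<comment> \<open>Fatou along the subsequence, with \<open>j\<close> fixed.\<close>
      have "(\<integral>\<^sup>+x. ennreal (\<bar>w j x - g x\<bar> powr p) \<partial>M)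
          = (\<integral>\<^sup>+x. liminf (\<lambda>k. ennreal (\<bar>w j x - w (r k) x\<bar> powr p)) \<partial>M)"
      proof (rule nn_integral_cong_AE, use conv in eventually_elim)
        fix x assume "(\<lambda>k. w (r k) x) \<longlonglongrightarrow> g x"
        then have "(\<lambda>k. ennreal (\<bar>w j x - w (r k) x\<bar> powr p)) \<longlonglongrightarrow> ennreal (\<bar>w j x - g x\<bar> powr p)"
          using p by (intro tendsto_abs_diff_powr) auto
        then show "ennreal (\<bar>w j x - g x\<bar> powr p) = liminf (\<lambda>k. ennreal (\<bar>w j x - w (r k) x\<bar> powr p))"
          by (rule lim_imp_Liminf[OF trivial_limit_sequentially, symmetric])
      qed
      also have "\<dots> \<le> liminf (\<lambda>k. \<integral>\<^sup>+x. ennreal (\<bar>w j x - w (r k) x\<bar> powr p) \<partial>M)"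
        by (rule nn_integral_liminf) measurable
      also have "\<dots> \<le> ennreal e'"
      proof (rule Liminf_le)
        show "\<forall>\<^sub>F k in sequentially. (\<integral>\<^sup>+x. ennreal (\<bar>w j x - w (r k) x\<bar> powr p) \<partial>M) \<le> ennreal e'"
          using n j rk order_trans unfolding eventually_sequentially by blast
      qed simp
      finally show "(\<integral>\<^sup>+x. ennreal (\<bar>w j x - g x\<bar> powr p) \<partial>M) < e" using e'(2) by simp
    qed
  qed simp
  then show ?thesis using that[of g] by simp
qed

text \<open>Jensen for the probability density \<open>\<eta>\<close>: integrate the tangent
  inequality at the mean \<open>m\<close> of \<bar>f\<bar>. An infinite right side leaves nothing to
  prove; a finite one makes all integrals below exist.\<close>

lemma powr_average_le:
  fixes \<eta> f :: "'b \<Rightarrow> real"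
  assumes p: "1 \<le> p" and [measurable]: "\<eta> \<in> borel_measurable M" "f \<in> borel_measurable M"
    and nonneg: "\<And>x. 0 \<le> \<eta> x" and one: "(\<integral>\<^sup>+x. ennreal (\<eta> x) \<partial>M) = 1"
  shows "ennreal (\<bar>\<integral>x. \<eta> x * f x \<partial>M\<bar> powr p) \<le> (\<integral>\<^sup>+x. ennreal (\<eta> x * \<bar>f x\<bar> powr p) \<partial>M)"
proof (cases "(\<integral>\<^sup>+x. ennreal (\<eta> x * \<bar>f x\<bar> powr p) \<partial>M) = \<infinity>")
  case False
  have int\<eta>: "integrable M \<eta>" "(\<integral>x. \<eta> x \<partial>M) = 1"
    using one nonneg by (auto intro!: integrableI_nonneg simp: integral_eq_nn_integral)
  have intp: "integrable M (\<lambda>x. \<eta> x * \<bar>f x\<bar> powr p)"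
    using False nonneg by (intro integrableI_nonneg) (auto simp: top.not_eq_extremum)
  have int1: "integrable M (\<lambda>x. \<eta> x * \<bar>f x\<bar>)"
  proof (rule Bochner_Integration.integrable_bound[OF Bochner_Integration.integrable_add[OF int\<eta>(1) intp]])
    show "AE x in M. norm (\<eta> x * \<bar>f x\<bar>) \<le> norm (\<eta> x + \<eta> x * \<bar>f x\<bar> powr p)"
    proof (intro AE_I2)
      fix x
      have "\<eta> x * \<bar>f x\<bar> \<le> \<eta> x * (1 + \<bar>f x\<bar> powr p)"
        by (intro mult_left_mono abs_le_1_plus_powr p nonneg)
      then show "norm (\<eta> x * \<bar>f x\<bar>) \<le> norm (\<eta> x + \<eta> x * \<bar>f x\<bar> powr p)"
        using nonneg[of x] by (simp add: abs_mult algebra_simps)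
    qed
  qed measurable
  define m where "m = (\<integral>x. \<eta> x * \<bar>f x\<bar> \<partial>M)"
  have m: "0 \<le> m" unfolding m_def by (intro integral_nonneg_AE) (use nonneg in auto)
  define c where "c = p * m powr (p - 1)"
  have "\<bar>\<integral>x. \<eta> x * f x \<partial>M\<bar> \<le> m"
    unfolding m_def using integral_norm_bound[of M "\<lambda>x. \<eta> x * f x"] nonneg by (simp add: abs_mult)
  then have "\<bar>\<integral>x. \<eta> x * f x \<partial>M\<bar> powr p \<le> m powr p"
    using p by (intro powr_mono2) auto
  \<comment> \<open>The tangent line at \<open>m\<close>, weighted by \<open>\<eta>\<close>,
    integrates to its value at the mean.\<close>
  also have "\<dots> = (\<integral>x. (m powr p - c * m) * \<eta> x + c * (\<eta> x * \<bar>f x\<bar>) \<partial>M)"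
    using int\<eta> int1 by (simp add: m_def[symmetric])
  also have "\<dots> \<le> (\<integral>x. \<eta> x * \<bar>f x\<bar> powr p \<partial>M)"
  proof (intro integral_mono Bochner_Integration.integrable_add integrable_mult_right int1 int\<eta> intp)
    fix x
    have "m powr p + c * (\<bar>f x\<bar> - m) \<le> \<bar>f x\<bar> powr p"
      unfolding c_def by (rule powr_ge_tangent[OF p m]) simp
    then have "\<eta> x * (m powr p + c * (\<bar>f x\<bar> - m)) \<le> \<eta> x * \<bar>f x\<bar> powr p"
      by (intro mult_left_mono nonneg)
    then show "(m powr p - c * m) * \<eta> x + c * (\<eta> x * \<bar>f x\<bar>) \<le> \<eta> x * \<bar>f x\<bar> powr p"
      by (simp add: algebra_simps)
  qed
  finally have "ennreal (\<bar>\<integral>x. \<eta> x * f x \<partial>M\<bar> powr p) \<le> ennreal (\<integral>x. \<eta> x * \<bar>f x\<bar> powr p \<partial>M)"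
    by (rule ennreal_leI)
  also have "\<dots> = (\<integral>\<^sup>+x. ennreal (\<eta> x * \<bar>f x\<bar> powr p) \<partial>M)"
    using nonneg by (intro nn_integral_eq_integral[symmetric] intp) auto
  finally show ?thesis .
qed simp

section \<open>Mollification and the Frechet-Kolmogorov criterion\<close>

text \<open>A Lipschitz bump is enough: the averages need to be equicontinuous, not smooth.\<close>

lemma tent_kernel:
  fixes d :: real
  assumes d: "0 < d"
  obtains \<eta> :: "'a::euclidean_space \<Rightarrow> real" and L :: real
  where "0 < L" "\<And>x. 0 \<le> \<eta> x" "\<And>x. \<eta> x \<le> L" "\<And>x. \<eta> (- x) = \<eta> x" "\<And>x. d \<le> norm x \<Longrightarrow> \<eta> x = 0"
    "\<And>x y. \<bar>\<eta> x - \<eta> y\<bar> \<le> L * norm (x - y)" "\<eta> \<in> borel_measurable borel"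
    "(\<integral>\<^sup>+x. ennreal (\<eta> x) \<partial>lborel) = 1"
proof -
  define \<tau> where "\<tau> = (\<lambda>x::'a. max 0 (d - norm x))"
  have [measurable]: "\<tau> \<in> borel_measurable borel" unfolding \<tau>_def by measurable
  have le: "ennreal (\<tau> x) \<le> ennreal d * indicator (cball 0 d) x" for x
    using d by (auto simp: \<tau>_def indicator_def intro!: ennreal_leI)
  have ge: "ennreal (d / 2) * indicator (ball 0 (d / 2)) x \<le> ennreal (\<tau> x)" for x
    using d by (auto simp: \<tau>_def indicator_def intro!: ennreal_leI)
  define I where "I = (\<integral>\<^sup>+x. ennreal (\<tau> x) \<partial>lborel)"
  have "I \<le> (\<integral>\<^sup>+x. ennreal d * indicator (cball (0::'a) d) x \<partial>lborel)"
    unfolding I_def by (intro nn_integral_mono le)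
  also have "\<dots> = ennreal d * emeasure lborel (cball (0::'a) d)"
    by (intro nn_integral_cmult_indicator) auto
  also have "\<dots> < \<infinity>"
    using emeasure_compact_finite[of "cball (0::'a) d"] by (simp add: ennreal_mult_less_top)
  finally have Ifin: "I < \<infinity>" .
  have "0 < emeasure lborel (ball (0::'a) (d / 2))"
    using d unit_ball_vol_pos[of "real DIM('a)"] by (simp add: emeasure_ball)
  then have "0 < ennreal (d / 2) * emeasure lborel (ball (0::'a) (d / 2))"
    using d by (simp add: ennreal_zero_less_mult_iff)
  also have "\<dots> = (\<integral>\<^sup>+x. ennreal (d / 2) * indicator (ball (0::'a) (d / 2)) x \<partial>lborel)"
    by (intro nn_integral_cmult_indicator[symmetric]) auto
  also have "\<dots> \<le> I" unfolding I_def by (intro nn_integral_mono ge)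
  finally have Ipos: "0 < I" .
  obtain c where c: "I = ennreal c" "0 < c"
    using Ifin Ipos by (metis ennreal_cases ennreal_less_zero_iff infinity_ennreal_def order_less_irrefl)
  \<comment> \<open>Dominates both the height d / c and the Lipschitz constant 1 / c of the
    normalised tent.\<close>
  define L where "L = (1 + d) / c"
  define \<eta> where "\<eta> = (\<lambda>x. \<tau> x / c)"
  show ?thesis
  proof (rule that[of L \<eta>])
    show "0 < L" using c d by (simp add: L_def)
    show "0 \<le> \<eta> x" for x using c by (simp add: \<eta>_def \<tau>_def)
    show "\<eta> x \<le> L" for x
      using c d norm_ge_zero[of x] by (auto simp: \<eta>_def \<tau>_def L_def divide_simps simp del: norm_ge_zero)
    show "\<eta> (- x) = \<eta> x" for x by (simp add: \<eta>_def \<tau>_def)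
    show "d \<le> norm x \<Longrightarrow> \<eta> x = 0" for x by (simp add: \<eta>_def \<tau>_def)
    show "\<eta> \<in> borel_measurable borel" unfolding \<eta>_def by measurable
    have "(\<integral>\<^sup>+x. ennreal (\<eta> x) \<partial>lborel) = (\<integral>\<^sup>+x. ennreal (1 / c) * ennreal (\<tau> x) \<partial>lborel)"
      using c by (intro nn_integral_cong) (simp add: \<eta>_def \<tau>_def ennreal_mult[symmetric])
    also have "\<dots> = ennreal (1 / c) * ennreal c"
      using c by (subst nn_integral_cmult) (auto simp: I_def)
    also have "\<dots> = 1" using c by (simp add: ennreal_mult[symmetric])
    finally show "(\<integral>\<^sup>+x. ennreal (\<eta> x) \<partial>lborel) = 1" .
    show "\<bar>\<eta> x - \<eta> y\<bar> \<le> L * norm (x - y)" for x y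
    proof -
      have "\<bar>\<tau> x - \<tau> y\<bar> \<le> norm (x - y)"
        using norm_triangle_ineq3[of x y] unfolding \<tau>_def by linarith
      then have "\<bar>\<tau> x - \<tau> y\<bar> / c \<le> 1 / c * norm (x - y)" using c by (simp add: divide_simps)
      also have "\<dots> \<le> L * norm (x - y)"
        using c d by (intro mult_right_mono) (auto simp: L_def divide_simps)
      finally show ?thesis using c by (simp add: \<eta>_def diff_divide_distrib[symmetric])
    qed
  qed
qed

text \<open>Two uses of the inequality for two terms, whence 4^(p-1). Its integrated form stands in
  for the Minkowski inequality.\<close>

lemma abs_add3_powr_le:
  fixes a b c p :: real
  assumes p: "1 \<le> p"
  shows "\<bar>a + b + c\<bar> powr p \<le> 4 powr (p - 1) * (\<bar>a\<bar> powr p + \<bar>b\<bar> powr p + \<bar>c\<bar> powr p)"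
proof -
  define q :: real where "q = 2 powr (p - 1)"
  have q: "1 \<le> q" using p by (simp add: q_def ge_one_powr_ge_zero)
  have "\<bar>a + b + c\<bar> powr p \<le> q * (\<bar>a + b\<bar> powr p + \<bar>c\<bar> powr p)"
    unfolding q_def by (rule abs_add_powr_le[OF p])
  also have "\<dots> \<le> q * (q * (\<bar>a\<bar> powr p + \<bar>b\<bar> powr p) + q * \<bar>c\<bar> powr p)"
    using q abs_add_powr_le[OF p, of a b] mult_right_mono[OF q, of "\<bar>c\<bar> powr p"]
    by (intro mult_left_mono add_mono) (auto simp: q_def)
  also have "\<dots> = q * q * (\<bar>a\<bar> powr p + \<bar>b\<bar> powr p + \<bar>c\<bar> powr p)"
    by (simp add: algebra_simps)
  also have "q * q = 4 powr (p - 1)"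
    unfolding q_def powr_mult[symmetric] by simp
  finally show ?thesis .
qed

lemma nn_integral_abs_add3_powr_le:
  fixes f g h :: "'b \<Rightarrow> real"
  assumes p: "1 \<le> p"
    and [measurable]: "f \<in> borel_measurable M" "g \<in> borel_measurable M" "h \<in> borel_measurable M"
  shows "(\<integral>\<^sup>+x. ennreal (\<bar>f x + g x + h x\<bar> powr p) \<partial>M) \<le> ennreal (4 powr (p - 1)) *
    ((\<integral>\<^sup>+x. ennreal (\<bar>f x\<bar> powr p) \<partial>M) + (\<integral>\<^sup>+x. ennreal (\<bar>g x\<bar> powr p) \<partial>M) + (\<integral>\<^sup>+x. ennreal (\<bar>h x\<bar> powr p) \<partial>M))"
proof -
  have "(\<integral>\<^sup>+x. ennreal (\<bar>f x + g x + h x\<bar> powr p) \<partial>M)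
      \<le> (\<integral>\<^sup>+x. ennreal (4 powr (p - 1)) * (ennreal (\<bar>f x\<bar> powr p) + ennreal (\<bar>g x\<bar> powr p) + ennreal (\<bar>h x\<bar> powr p)) \<partial>M)"
    using abs_add3_powr_le[OF p]
    by (intro nn_integral_mono)
      (simp add: ennreal_plus[symmetric] ennreal_mult[symmetric] ennreal_leI del: ennreal_plus)
  also have "\<dots> = ennreal (4 powr (p - 1)) *
    ((\<integral>\<^sup>+x. ennreal (\<bar>f x\<bar> powr p) \<partial>M) + (\<integral>\<^sup>+x. ennreal (\<bar>g x\<bar> powr p) \<partial>M) + (\<integral>\<^sup>+x. ennreal (\<bar>h x\<bar> powr p) \<partial>M))"
    by (simp add: nn_integral_cmult nn_integral_add)
  finally show ?thesis .
qed

text \<open>For even \<open>\<eta>\<close> this is the convolution of \<open>\<eta>\<close> and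
  \<open>w\<close>; the variable \<open>x\<close> sits in the kernel alone, so regularity in
  \<open>x\<close> comes from \<open>\<eta>\<close>.\<close>

definition average :: "('a::euclidean_space \<Rightarrow> real) \<Rightarrow> ('a \<Rightarrow> real) \<Rightarrow> 'a \<Rightarrow> real" where
  "average \<eta> w x = (\<integral>z. \<eta> (z - x) * w z \<partial>lborel)"

lemma average_measurable [measurable]:
  assumes [measurable]: "\<eta> \<in> borel_measurable borel" "w \<in> borel_measurable borel"
  shows "average \<eta> w \<in> borel_measurable borel"
  unfolding average_def[abs_def] by measurable

lemma integrable_abs_on_finite_measure:
  fixes w :: "'b \<Rightarrow> real"
  assumes p: "1 \<le> p" and [measurable]: "w \<in> borel_measurable M" "E \<in> sets M"
    and B: "(\<integral>\<^sup>+x. ennreal (\<bar>w x\<bar> powr p) \<partial>M) \<le> ennreal B" "0 \<le> B"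
    and E: "emeasure M E < \<infinity>"
  shows "integrable M (\<lambda>x. indicator E x * \<bar>w x\<bar>)"
    "(\<integral>x. indicator E x * \<bar>w x\<bar> \<partial>M) \<le> measure M E + B"
proof -
  have "(\<integral>\<^sup>+x. ennreal (indicator E x * \<bar>w x\<bar>) \<partial>M) \<le> (\<integral>\<^sup>+x. indicator E x + ennreal (\<bar>w x\<bar> powr p) \<partial>M)"
  proof (intro nn_integral_mono)
    fix x
    have "indicator E x * \<bar>w x\<bar> \<le> indicator E x + \<bar>w x\<bar> powr p"
      using abs_le_1_plus_powr[OF p, of "w x"] by (simp add: indicator_def)
    then show "ennreal (indicator E x * \<bar>w x\<bar>) \<le> indicator E x + ennreal (\<bar>w x\<bar> powr p)"
      by (metis (no_types) ennreal_indicator ennreal_leI ennreal_plus indicator_pos_le powr_ge_zero)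
  qed
  also have "\<dots> = emeasure M E + (\<integral>\<^sup>+x. ennreal (\<bar>w x\<bar> powr p) \<partial>M)"
    by (subst nn_integral_add) auto
  also have "\<dots> \<le> ennreal (measure M E) + ennreal B"
    using B E by (intro add_mono) (auto simp: emeasure_eq_ennreal_measure)
  also have "\<dots> = ennreal (measure M E + B)" using B by simp
  finally have le: "(\<integral>\<^sup>+x. ennreal (indicator E x * \<bar>w x\<bar>) \<partial>M) \<le> ennreal (measure M E + B)" .
  then show int: "integrable M (\<lambda>x. indicator E x * \<bar>w x\<bar>)"
    by (intro integrableI_nonneg) (auto simp: le_less_trans)
  show "(\<integral>x. indicator E x * \<bar>w x\<bar> \<partial>M) \<le> measure M E + B"
    using le B(2) by (subst (asm) nn_integral_eq_integral[OF int]) (auto simp del: ennreal_plus)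
qed

text \<open>All bounds depend on \<open>w\<close> only through \<open>B\<close>, as Arzela-Ascoli
  requires. The kernel confines each integral to balls of radius \<open>d\<close>, where
  \<bar>w\<bar> is integrable with a bound uniform in \<open>w\<close>.\<close>

lemma average_equi_Lipschitz:
  fixes \<eta> :: "'a::euclidean_space \<Rightarrow> real"
  assumes p: "1 \<le> p" and [measurable]: "\<eta> \<in> borel_measurable borel"
    and L: "0 < L" "\<And>x. 0 \<le> \<eta> x" "\<And>x. \<eta> x \<le> L" "\<And>x. d \<le> norm x \<Longrightarrow> \<eta> x = 0"
      "\<And>x y. \<bar>\<eta> x - \<eta> y\<bar> \<le> L * norm (x - y)"
    and [measurable]: "w \<in> borel_measurable borel"
    and B: "(\<integral>\<^sup>+x. ennreal (\<bar>w x\<bar> powr p) \<partial>lborel) \<le> ennreal B" "0 \<le> B"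
  shows "integrable lborel (\<lambda>z. \<eta> (z - x) * w z)"
    "\<bar>average \<eta> w x\<bar> \<le> L * (measure lborel (cball x d) + B)"
    "\<bar>average \<eta> w x - average \<eta> w y\<bar>
      \<le> L * (measure lborel (cball x d) + measure lborel (cball y d) + B) * norm (x - y)"
proof -
  have int: "integrable lborel (\<lambda>z. indicator E z * \<bar>w z\<bar>)"
    "(\<integral>z. indicator E z * \<bar>w z\<bar> \<partial>lborel) \<le> measure lborel E + B" if "compact E" for E
    using integrable_abs_on_finite_measure[OF p _ _ B, of E] emeasure_compact_finite[OF that]
      borel_compact[OF that] by auto
  have bd: "\<bar>\<eta> (z - x) * w z\<bar> \<le> L * (indicator (cball x d) z * \<bar>w z\<bar>)" for x z
    using L(2)[of "z - x"] L(3)[of "z - x"] L(4)[of "z - x"]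
    by (cases "z \<in> cball x d")
      (auto simp: abs_mult dist_norm norm_minus_commute intro!: mult_right_mono)
  have I: "integrable lborel (\<lambda>z. \<eta> (z - x) * w z)" for x
  proof (rule Bochner_Integration.integrable_bound)
    show "integrable lborel (\<lambda>z. L * (indicator (cball x d) z * \<bar>w z\<bar>))"
      by (intro integrable_mult_right int) simp
  qed (use bd L(1) in \<open>auto simp: abs_mult\<close>)
  show "integrable lborel (\<lambda>z. \<eta> (z - x) * w z)" by (rule I)
  have "\<bar>average \<eta> w x\<bar> \<le> (\<integral>z. \<bar>\<eta> (z - x) * w z\<bar> \<partial>lborel)"
    unfolding average_def by (rule integral_abs_bound)
  also have "\<dots> \<le> (\<integral>z. L * (indicator (cball x d) z * \<bar>w z\<bar>) \<partial>lborel)"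
    by (intro integral_mono integrable_abs I integrable_mult_right int bd) simp
  also have "\<dots> \<le> L * (measure lborel (cball x d) + B)"
    using int(2)[of "cball x d"] L(1) by simp
  finally show "\<bar>average \<eta> w x\<bar> \<le> L * (measure lborel (cball x d) + B)" .
  define E where "E = cball x d \<union> cball y d"
  have E: "compact E" by (simp add: E_def compact_Un)
  have bd2: "\<bar>\<eta> (z - x) * w z - \<eta> (z - y) * w z\<bar> \<le> L * norm (x - y) * (indicator E z * \<bar>w z\<bar>)" for z
  proof (cases "z \<in> E")
    case True
    have "\<bar>\<eta> (z - x) - \<eta> (z - y)\<bar> \<le> L * norm (x - y)"
      using L(5)[of "z - x" "z - y"] by (simp add: norm_minus_commute)
    then have "\<bar>\<eta> (z - x) - \<eta> (z - y)\<bar> * \<bar>w z\<bar> \<le> L * norm (x - y) * \<bar>w z\<bar>"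
      by (intro mult_right_mono) auto
    then show ?thesis using True by (simp add: abs_mult[symmetric] left_diff_distrib)
  next
    case False
    then have "\<eta> (z - x) = 0" "\<eta> (z - y) = 0"
      by (auto simp: E_def dist_norm norm_minus_commute intro!: L(4))
    then show ?thesis using False by simp
  qed
  have "average \<eta> w x - average \<eta> w y = (\<integral>z. \<eta> (z - x) * w z - \<eta> (z - y) * w z \<partial>lborel)"
    unfolding average_def by (rule Bochner_Integration.integral_diff[symmetric]; rule I)
  then have "\<bar>average \<eta> w x - average \<eta> w y\<bar> \<le> (\<integral>z. \<bar>\<eta> (z - x) * w z - \<eta> (z - y) * w z\<bar> \<partial>lborel)"
    by (metis integral_abs_bound)
  also have "\<dots> \<le> (\<integral>z. L * norm (x - y) * (indicator E z * \<bar>w z\<bar>) \<partial>lborel)"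
    by (intro integral_mono integrable_abs Bochner_Integration.integrable_diff I integrable_mult_right int E bd2)
  also have "\<dots> \<le> L * norm (x - y) * (measure lborel E + B)"
    using int(2)[OF E] L(1) by (simp add: mult_left_mono)
  also have "\<dots> \<le> L * norm (x - y) * (measure lborel (cball x d) + measure lborel (cball y d) + B)"
  proof -
    have "measure lborel E \<le> measure lborel (cball x d) + measure lborel (cball y d)"
      unfolding E_def by (rule measure_Un_le) auto
    then show ?thesis using L(1) by (intro mult_left_mono) auto
  qed
  finally show "\<bar>average \<eta> w x - average \<eta> w y\<bar>
      \<le> L * (measure lborel (cball x d) + measure lborel (cball y d) + B) * norm (x - y)"
    by (simp add: mult.commute mult.left_commute)
qed

text \<open>By Jensen the error is at most the nonlocal energy with kernel \<open>\<eta>\<close>,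
  hence an \<open>\<eta>\<close>-average of shift energies over shifts of length at most
  \<open>d\<close>.\<close>

lemma average_close:
  fixes \<eta> :: "'a::euclidean_space \<Rightarrow> real"
  assumes p: "1 \<le> p" and [measurable]: "\<eta> \<in> borel_measurable borel"
    and \<eta>: "\<And>x. 0 \<le> \<eta> x" "\<And>x. \<eta> (- x) = \<eta> x" "\<And>x. d \<le> norm x \<Longrightarrow> \<eta> x = 0"
      "(\<integral>\<^sup>+x. ennreal (\<eta> x) \<partial>lborel) = 1"
    and [measurable]: "w \<in> borel_measurable borel"
    and int: "\<And>x. integrable lborel (\<lambda>z. \<eta> (z - x) * w z)"
    and e: "\<And>h. norm h \<le> d \<Longrightarrow> shift_energy p w h \<le> e"
  shows "(\<integral>\<^sup>+x. ennreal (\<bar>average \<eta> w x - w x\<bar> powr p) \<partial>lborel) \<le> e"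
proof -
  have one: "(\<integral>\<^sup>+z. ennreal (\<eta> (z - x)) \<partial>lborel) = 1" for x
    using nn_integral_lborel_translate[of "\<lambda>z. ennreal (\<eta> z)" "- x"] \<eta>(4) by simp
  have int1: "integrable lborel (\<lambda>z. \<eta> (z - x))" "(\<integral>z. \<eta> (z - x) \<partial>lborel) = 1" for x
    using one[of x] \<eta>(1) by (auto intro!: integrableI_nonneg simp: integral_eq_nn_integral)
  have eq: "average \<eta> w x - w x = (\<integral>z. \<eta> (z - x) * (w z - w x) \<partial>lborel)" for x
  proof -
    have "(\<integral>z. \<eta> (z - x) * (w z - w x) \<partial>lborel) = (\<integral>z. \<eta> (z - x) * w z - w x * \<eta> (z - x) \<partial>lborel)"
      by (simp add: algebra_simps)
    also have "\<dots> = average \<eta> w x - w x * (\<integral>z. \<eta> (z - x) \<partial>lborel)"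
      unfolding average_def using int int1 by (subst Bochner_Integration.integral_diff) auto
    finally show ?thesis by (simp add: int1)
  qed
  have "(\<integral>\<^sup>+x. ennreal (\<bar>average \<eta> w x - w x\<bar> powr p) \<partial>lborel)
      \<le> (\<integral>\<^sup>+x. \<integral>\<^sup>+z. ennreal (\<eta> (z - x) * \<bar>w z - w x\<bar> powr p) \<partial>lborel \<partial>lborel)"
    unfolding eq by (intro nn_integral_mono powr_average_le p one \<eta>(1)) measurable
  also have "\<dots> = (\<integral>\<^sup>+x. \<integral>\<^sup>+z. ennreal (\<bar>w x - w z\<bar> powr p) * ennreal (\<eta> (x - z)) \<partial>lborel \<partial>lborel)"
  proof (intro nn_integral_cong)
    fix x z
    show "ennreal (\<eta> (z - x) * \<bar>w z - w x\<bar> powr p) = ennreal (\<bar>w x - w z\<bar> powr p) * ennreal (\<eta> (x - z))"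
      using \<eta>(2)[of "x - z"] \<eta>(1) by (simp add: ennreal_mult abs_minus_commute mult.commute)
  qed
  also have "\<dots> = (\<integral>\<^sup>+h. ennreal (\<eta> h) * shift_energy p w h \<partial>lborel)"
    by (rule nonlocal_energy_eq_shift_energy) measurable
  also have "\<dots> \<le> (\<integral>\<^sup>+h. ennreal (\<eta> h) * e \<partial>lborel)"
  proof (intro nn_integral_mono)
    fix h
    show "ennreal (\<eta> h) * shift_energy p w h \<le> ennreal (\<eta> h) * e"
      using e[of h] \<eta>(3)[of h] by (cases "norm h \<le> d") (auto intro!: mult_left_mono)
  qed
  also have "\<dots> = e" by (simp add: nn_integral_multc \<eta>(4))
  finally show ?thesis .
qed

text \<open>The equicontinuity hypothesis concerns only indices beyond an \<open>N\<close> depending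
  on \<open>e\<close>; this is enough because Cauchyness concerns the tail alone. For each
  mollification scale Arzela-Ascoli applies to the averages on \<open>E\<close>, a diagonal sequence
  serves all scales, and \<open>average_close\<close> transfers the Cauchy property to the
  functions.\<close>

lemma Frechet_Kolmogorov:
  fixes w :: "nat \<Rightarrow> 'a::euclidean_space \<Rightarrow> real"
  assumes p: "1 \<le> p" and w[measurable]: "\<And>j. w j \<in> borel_measurable borel"
    and B: "\<And>j. (\<integral>\<^sup>+x. ennreal (\<bar>w j x\<bar> powr p) \<partial>lborel) \<le> ennreal B" "0 \<le> B"
    and equi: "\<And>e. 0 < e \<Longrightarrow> \<exists>d>0. \<exists>N. \<forall>j\<ge>N. \<forall>h. norm h \<le> d \<longrightarrow> shift_energy p (w j) h \<le> ennreal e"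
    and E: "compact E"
  obtains r g where "strict_mono (r :: nat \<Rightarrow> nat)" "g \<in> borel_measurable borel"
    "(\<lambda>j. \<integral>\<^sup>+x. ennreal (\<bar>w (r j) x - g x\<bar> powr p) * indicator E x \<partial>lborel) \<longlonglongrightarrow> 0"
proof -
  have Eb[measurable]: "E \<in> sets borel" using E by (simp add: borel_compact)
  define dd where "dd = (\<lambda>n. 1 / real (Suc n))"
  have dd0: "0 < dd n" for n by (simp add: dd_def)
  have "\<exists>\<eta> :: 'a \<Rightarrow> real. \<exists>L. 0 < L \<and> (\<forall>x. 0 \<le> \<eta> x) \<and> (\<forall>x. \<eta> x \<le> L) \<and> (\<forall>x. \<eta> (- x) = \<eta> x)
      \<and> (\<forall>x. dd n \<le> norm x \<longrightarrow> \<eta> x = 0) \<and> (\<forall>x y. \<bar>\<eta> x - \<eta> y\<bar> \<le> L * norm (x - y))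
      \<and> \<eta> \<in> borel_measurable borel \<and> (\<integral>\<^sup>+x. ennreal (\<eta> x) \<partial>lborel) = 1" for n
  proof -
    obtain L and \<eta> :: "'a \<Rightarrow> real" where "0 < L" "\<And>x. 0 \<le> \<eta> x" "\<And>x. \<eta> x \<le> L" "\<And>x. \<eta> (- x) = \<eta> x"
      "\<And>x. dd n \<le> norm x \<Longrightarrow> \<eta> x = 0" "\<And>x y. \<bar>\<eta> x - \<eta> y\<bar> \<le> L * norm (x - y)"
      "\<eta> \<in> borel_measurable borel" "(\<integral>\<^sup>+x. ennreal (\<eta> x) \<partial>lborel) = 1"
      by (rule tent_kernel[OF dd0[of n]], rule that)
    then show ?thesis by (intro exI[of _ \<eta>] exI[of _ L]) simp
  qed
  then obtain \<eta> :: "nat \<Rightarrow> 'a \<Rightarrow> real" and L where \<eta>: "\<And>n. 0 < L n" "\<And>n x. 0 \<le> \<eta> n x" "\<And>n x. \<eta> n x \<le> L n"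
      "\<And>n x. \<eta> n (- x) = \<eta> n x" "\<And>n x. dd n \<le> norm x \<Longrightarrow> \<eta> n x = 0"
      "\<And>n x y. \<bar>\<eta> n x - \<eta> n y\<bar> \<le> L n * norm (x - y)"
      "\<And>n. \<eta> n \<in> borel_measurable borel" "\<And>n. (\<integral>\<^sup>+x. ennreal (\<eta> n x) \<partial>lborel) = 1"
    by metis
  note [measurable] = \<eta>(7)
  define A where "A = (\<lambda>n j. average (\<eta> n) (w j))"
  have [measurable]: "A n j \<in> borel_measurable borel" for n j unfolding A_def by measurable
  define vol where "vol = (\<lambda>n. measure lborel (cball (0::'a) (dd n)))"
  have vol: "measure lborel (cball x (dd n)) = vol n" for x :: 'a and n
    using dd0[of n] by (simp add: vol_def content_cball)
  have avg: "integrable lborel (\<lambda>z. \<eta> n (z - x) * w j z)"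
    "\<bar>A n j x\<bar> \<le> L n * (vol n + B)"
    "\<bar>A n j x - A n j y\<bar> \<le> L n * (vol n + vol n + B) * norm (x - y)" for n j x y
    using average_equi_Lipschitz[where d = "dd n", OF p \<eta>(7)[of n] \<eta>(1)[of n] \<eta>(2)[of n] \<eta>(3)[of n] \<eta>(5)[of n]
        \<eta>(6)[of n] w[of j] B(1)[of j] B(2)]
    by (simp_all add: A_def vol)
  \<comment> \<open>Stated as a uniform Cauchy property, which passes to subsequences without a
    limit function to carry along.\<close>
  define P where "P = (\<lambda>n (s :: nat \<Rightarrow> nat). \<forall>e>0. \<exists>N. \<forall>i\<ge>N. \<forall>j\<ge>N. \<forall>x\<in>E. \<bar>A n (s i) x - A n (s j) x\<bar> < (e::real))"
  interpret subseqs P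
  proof
    fix n and s :: "nat \<Rightarrow> nat" assume "strict_mono s"
    define M where "M = L n * (vol n + vol n + B)"
    have M: "0 \<le> M" using \<eta>(1)[of n] B(2) by (simp add: M_def vol_def)
    have Lip: "\<bar>A n j x - A n j y\<bar> \<le> M * norm (x - y)" for j x y
      unfolding M_def by (rule avg(3))
    obtain g and k :: "nat \<Rightarrow> nat" where k: "strict_mono k"
      "\<And>e. 0 < e \<Longrightarrow> \<exists>N. \<forall>m x. m \<ge> N \<and> x \<in> E \<longrightarrow> norm (A n (s (k m)) x - g x) < e"
    proof (rule Arzela_Ascoli[OF E, of "\<lambda>m. A n (s m)" "L n * (vol n + B)"])
      show "norm (A n (s m) x) \<le> L n * (vol n + B)" for m x
        unfolding real_norm_def by (rule avg(2))
    next
      fix x and e :: real assume e: "0 < e"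
      show "\<exists>d>0. \<forall>m y. y \<in> E \<and> norm (x - y) < d \<longrightarrow> norm (A n (s m) x - A n (s m) y) < e"
      proof (intro exI[of _ "e / (M + 1)"] conjI allI impI)
        show "0 < e / (M + 1)" using e M by simp
        fix m y assume y: "y \<in> E \<and> norm (x - y) < e / (M + 1)"
        have "\<bar>A n (s m) x - A n (s m) y\<bar> \<le> M * norm (x - y)" by (rule Lip)
        also have "\<dots> \<le> (M + 1) * norm (x - y)" by (intro mult_right_mono) auto
        also have "\<dots> < e" using y M by (simp add: field_simps)
        finally show "norm (A n (s m) x - A n (s m) y) < e" by simp
      qed
    qed blast
    have "P n (s \<circ> k)"
      unfolding P_def
    proof (intro allI impI)
      fix e :: real assume "0 < e"
      then obtain N where N: "\<And>m x. m \<ge> N \<Longrightarrow> x \<in> E \<Longrightarrow> \<bar>A n (s (k m)) x - g x\<bar> < e / 2"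
        using k(2)[of "e / 2"] by auto
      show "\<exists>N. \<forall>i\<ge>N. \<forall>j\<ge>N. \<forall>x\<in>E. \<bar>A n ((s \<circ> k) i) x - A n ((s \<circ> k) j) x\<bar> < e"
      proof (intro exI[of _ N] allI impI ballI)
        fix i j x assume "N \<le> i" "N \<le> j" "x \<in> E"
        then show "\<bar>A n ((s \<circ> k) i) x - A n ((s \<circ> k) j) x\<bar> < e"
          using N[of i x] N[of j x] unfolding o_def by linarith
      qed
    qed
    then show "\<exists>r'. strict_mono r' \<and> P n (s \<circ> r')" using k(1) by blast
  qed
  define r where "r = diagseq"
  have r: "strict_mono r" unfolding r_def by (rule subseq_diagseq)
  have Pr: "P n r" for n
  proof -
    \<comment> \<open>The diagonal sequence is a subsequence of the n-th choice only after its first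
      terms; \<open>P n\<close> ignores finitely many terms, so the offset is removed below.\<close>
    have "P n (diagseq \<circ> (+) (Suc n))"
    proof (rule diagseq_holds)
      fix k s m assume k: "strict_mono (k :: nat \<Rightarrow> nat)" and "P m s"
      then show "P m (s \<circ> k)" unfolding P_def o_def by (meson order_trans seq_suble)
    qed
    then have H: "\<exists>N. \<forall>i\<ge>N. \<forall>j\<ge>N. \<forall>x\<in>E. \<bar>A n (r (Suc n + i)) x - A n (r (Suc n + j)) x\<bar> < e" if "0 < e" for e
      using that unfolding P_def r_def o_def by blast
    show ?thesis unfolding P_def
    proof (intro allI impI)
      fix e :: real assume "0 < e"
      then obtain N where N: "\<forall>i\<ge>N. \<forall>j\<ge>N. \<forall>x\<in>E. \<bar>A n (r (Suc n + i)) x - A n (r (Suc n + j)) x\<bar> < e"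
        using H by blast
      show "\<exists>N. \<forall>i\<ge>N. \<forall>j\<ge>N. \<forall>x\<in>E. \<bar>A n (r i) x - A n (r j) x\<bar> < e"
      proof (intro exI[of _ "Suc n + N"] allI impI)
        fix i j assume "Suc n + N \<le> i" "Suc n + N \<le> j"
        then have "N \<le> i - Suc n" "N \<le> j - Suc n" "Suc n + (i - Suc n) = i" "Suc n + (j - Suc n) = j" by auto
        then show "\<forall>x\<in>E. \<bar>A n (r i) x - A n (r j) x\<bar> < e" using N by metis
      qed
    qed
  qed
  \<comment> \<open>Restricting the measure instead of the functions lets the completeness lemma for
    arbitrary measures apply on \<open>E\<close>.\<close>
  define M where "M = density lborel (indicator E)"
  have setsM[measurable_cong]: "sets M = sets borel" by (simp add: M_def)
  have intM: "(\<integral>\<^sup>+x. f x \<partial>M) = (\<integral>\<^sup>+x. f x * indicator E x \<partial>lborel)" if "f \<in> borel_measurable borel" for f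
    using that unfolding M_def by (subst nn_integral_density) (auto simp: mult.commute)
  have intM_le: "(\<integral>\<^sup>+x. f x \<partial>M) \<le> (\<integral>\<^sup>+x. f x \<partial>lborel)" if "f \<in> borel_measurable borel" for f
    unfolding intM[OF that] by (intro nn_integral_mono) (auto simp: indicator_def)
  have Cauchy: "\<exists>N. \<forall>i\<ge>N. \<forall>j\<ge>N. (\<integral>\<^sup>+x. ennreal (\<bar>w (r i) x - w (r j) x\<bar> powr p) \<partial>M) \<le> ennreal e" if e: "0 < e" for e
  proof -
    \<comment> \<open>Three error terms, each multiplied by 4^(p-1).\<close>
    define e1 where "e1 = e / (3 * 4 powr (p - 1))"
    have e1: "0 < e1" using e by (simp add: e1_def)
    obtain d N where d: "0 < d" and N: "\<And>j h. N \<le> j \<Longrightarrow> norm h \<le> d \<Longrightarrow> shift_energy p (w j) h \<le> ennreal e1"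
      using equi[OF e1] by blast
    obtain n where n: "dd n < d" unfolding dd_def using d nat_approx_posE by blast
    define V where "V = measure lborel E"
    \<comment> \<open>A uniform gap of this size on \<open>E\<close> integrates to at most
      \<open>e1\<close>; \<open>V + 1\<close> avoids dividing by 0 for a null set.\<close>
    define \<delta> where "\<delta> = (e1 / (V + 1)) powr (1 / p)"
    have V: "0 \<le> V" by (simp add: V_def)
    have \<delta>: "0 < \<delta>" using e1 V by (simp add: \<delta>_def)
    have \<delta>p: "\<delta> powr p * V \<le> e1"
    proof -
      have "\<delta> powr p = e1 / (V + 1)" using e1 V p by (simp add: \<delta>_def powr_powr)
      then have "\<delta> powr p * (V + 1) = e1" using V by simp
      moreover have "\<delta> powr p * V \<le> \<delta> powr p * (V + 1)" by (intro mult_left_mono) auto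
      ultimately show ?thesis by simp
    qed
    obtain N' where N': "\<And>i j x. N' \<le> i \<Longrightarrow> N' \<le> j \<Longrightarrow> x \<in> E \<Longrightarrow> \<bar>A n (r i) x - A n (r j) x\<bar> < \<delta>"
      using Pr[of n] \<delta> unfolding P_def by blast
    have close: "(\<integral>\<^sup>+x. ennreal (\<bar>A n (r i) x - w (r i) x\<bar> powr p) \<partial>M) \<le> ennreal e1" if "N \<le> i" for i
    proof -
      have "(\<integral>\<^sup>+x. ennreal (\<bar>A n (r i) x - w (r i) x\<bar> powr p) \<partial>M)
          \<le> (\<integral>\<^sup>+x. ennreal (\<bar>A n (r i) x - w (r i) x\<bar> powr p) \<partial>lborel)"
        by (rule intM_le) measurable
      also have "\<dots> \<le> ennreal e1"
        unfolding A_def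
      proof (rule average_close[where d = "dd n"])
        fix h :: 'a assume "norm h \<le> dd n"
        then show "shift_energy p (w (r i)) h \<le> ennreal e1"
          using N[of "r i" h] n that seq_suble[OF r, of i] by linarith
      qed (use p \<eta> avg(1) in auto)
      finally show ?thesis .
    qed
    show ?thesis
    proof (intro exI[of _ "max N N'"] allI impI)
      fix i j assume i: "max N N' \<le> i" and j: "max N N' \<le> j"
      have mid: "(\<integral>\<^sup>+x. ennreal (\<bar>A n (r i) x - A n (r j) x\<bar> powr p) \<partial>M) \<le> ennreal e1"
      proof -
        have "(\<integral>\<^sup>+x. ennreal (\<bar>A n (r i) x - A n (r j) x\<bar> powr p) \<partial>M)
            = (\<integral>\<^sup>+x. ennreal (\<bar>A n (r i) x - A n (r j) x\<bar> powr p) * indicator E x \<partial>lborel)"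
          by (rule intM) measurable
        also have "\<dots> \<le> (\<integral>\<^sup>+x. ennreal (\<delta> powr p) * indicator E x \<partial>lborel)"
        proof (intro nn_integral_mono)
          fix x
          show "ennreal (\<bar>A n (r i) x - A n (r j) x\<bar> powr p) * indicator E x \<le> ennreal (\<delta> powr p) * indicator E x"
          proof (cases "x \<in> E")
            case True
            then have "\<bar>A n (r i) x - A n (r j) x\<bar> \<le> \<delta>" using N'[of i j x] i j by simp
            then show ?thesis using True p by (auto intro!: ennreal_leI powr_mono2)
          qed simp
        qed
        also have "\<dots> = ennreal (\<delta> powr p) * emeasure lborel E"
          by (intro nn_integral_cmult_indicator) auto
        also have "\<dots> = ennreal (\<delta> powr p * V)"
          using emeasure_compact_finite[OF E] by (simp add: V_def emeasure_eq_ennreal_measure ennreal_mult)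
        also have "\<dots> \<le> ennreal e1" by (rule ennreal_leI[OF \<delta>p])
        finally show ?thesis .
      qed
      have "(\<integral>\<^sup>+x. ennreal (\<bar>w (r i) x - w (r j) x\<bar> powr p) \<partial>M)
          = (\<integral>\<^sup>+x. ennreal (\<bar>(w (r i) x - A n (r i) x) + (A n (r i) x - A n (r j) x) + (A n (r j) x - w (r j) x)\<bar> powr p) \<partial>M)"
        by simp
      also have "\<dots> \<le> ennreal (4 powr (p - 1)) * ((\<integral>\<^sup>+x. ennreal (\<bar>w (r i) x - A n (r i) x\<bar> powr p) \<partial>M)
          + (\<integral>\<^sup>+x. ennreal (\<bar>A n (r i) x - A n (r j) x\<bar> powr p) \<partial>M)
          + (\<integral>\<^sup>+x. ennreal (\<bar>A n (r j) x - w (r j) x\<bar> powr p) \<partial>M))"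
        by (rule nn_integral_abs_add3_powr_le[OF p]) measurable
      also have "\<dots> \<le> ennreal (4 powr (p - 1)) * (ennreal e1 + ennreal e1 + ennreal e1)"
        using close[of i] close[of j] mid i j
        by (intro mult_left_mono add_mono) (auto simp: abs_minus_commute)
      also have "\<dots> = ennreal e"
        using e1 by (simp add: ennreal_plus[symmetric] ennreal_mult[symmetric] del: ennreal_plus) (simp add: e1_def)
      finally show "(\<integral>\<^sup>+x. ennreal (\<bar>w (r i) x - w (r j) x\<bar> powr p) \<partial>M) \<le> ennreal e" .
    qed
  qed
  have wM: "w (r j) \<in> borel_measurable M" for j by measurable
  obtain g where g: "g \<in> borel_measurable M"
    "(\<lambda>j. \<integral>\<^sup>+x. ennreal (\<bar>w (r j) x - g x\<bar> powr p) \<partial>M) \<longlonglongrightarrow> 0"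
    using Lp_Cauchy_imp_convergent[where w = "\<lambda>j. w (r j)", OF p wM Cauchy] by blast
  have gb[measurable]: "g \<in> borel_measurable borel" using g(1) by (simp cong: measurable_cong_sets add: setsM)
  show ?thesis
  proof (rule that[OF r gb])
    show "(\<lambda>j. \<integral>\<^sup>+x. ennreal (\<bar>w (r j) x - g x\<bar> powr p) * indicator E x \<partial>lborel) \<longlonglongrightarrow> 0"
      using g(2) by (subst (asm) intM) auto
  qed
qed

section \<open>Strong limits of midpoint combinations\<close>

text \<open>Convex combinations with dyadic weights, built by the one operation that the convexity
  inequality controls.\<close>

inductive_set midpoint_hull :: "('b \<Rightarrow> real) set \<Rightarrow> ('b \<Rightarrow> real) set" for S where
  base: "f \<in> S \<Longrightarrow> f \<in> midpoint_hull S"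
| midpoint: "f \<in> midpoint_hull S \<Longrightarrow> g \<in> midpoint_hull S \<Longrightarrow> (\<lambda>x. (f x + g x) / 2) \<in> midpoint_hull S"

lemma midpoint_hull_mono:
  assumes "S \<subseteq> T"
  shows "midpoint_hull S \<subseteq> midpoint_hull T"
proof
  fix f assume "f \<in> midpoint_hull S"
  then show "f \<in> midpoint_hull T"
    by induction (use assms in \<open>auto intro: midpoint_hull.intros\<close>)
qed

lemma nn_integral_midpoint_le:
  fixes f g :: "'b \<Rightarrow> real"
  assumes p: "1 \<le> p" and [measurable]: "f \<in> borel_measurable M" "g \<in> borel_measurable M"
    and "(\<integral>\<^sup>+x. ennreal (\<bar>f x\<bar> powr p) \<partial>M) \<le> c" "(\<integral>\<^sup>+x. ennreal (\<bar>g x\<bar> powr p) \<partial>M) \<le> c"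
  shows "(\<integral>\<^sup>+x. ennreal (\<bar>(f x + g x) / 2\<bar> powr p) \<partial>M) \<le> c"
proof -
  have "(\<integral>\<^sup>+x. ennreal (\<bar>(f x + g x) / 2\<bar> powr p) \<partial>M)
      \<le> (\<integral>\<^sup>+x. ennreal (1 / 2) * ennreal (\<bar>f x\<bar> powr p) + ennreal (1 / 2) * ennreal (\<bar>g x\<bar> powr p) \<partial>M)"
  proof (intro nn_integral_mono)
    fix x
    have "ennreal (\<bar>(f x + g x) / 2\<bar> powr p) \<le> ennreal (1 / 2 * \<bar>f x\<bar> powr p + 1 / 2 * \<bar>g x\<bar> powr p)"
      using abs_midpoint_powr_le[OF p, of "f x" "g x"] by (intro ennreal_leI) simp
    then show "ennreal (\<bar>(f x + g x) / 2\<bar> powr p)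
        \<le> ennreal (1 / 2) * ennreal (\<bar>f x\<bar> powr p) + ennreal (1 / 2) * ennreal (\<bar>g x\<bar> powr p)"
      by (simp only: ennreal_plus ennreal_mult powr_ge_zero mult_nonneg_nonneg zero_le_divide_1_iff zero_le_numeral)
  qed
  also have "\<dots> = ennreal (1 / 2) * (\<integral>\<^sup>+x. ennreal (\<bar>f x\<bar> powr p) \<partial>M) + ennreal (1 / 2) * (\<integral>\<^sup>+x. ennreal (\<bar>g x\<bar> powr p) \<partial>M)"
    by (subst nn_integral_add, measurable, subst (1 2) nn_integral_cmult) auto
  also have "\<dots> \<le> ennreal (1 / 2) * c + ennreal (1 / 2) * c"
    using assms by (intro add_mono mult_left_mono) auto
  also have "\<dots> = (ennreal (1 / 2) + ennreal (1 / 2)) * c" by (simp only: distrib_right)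
  also have "ennreal (1 / 2) + ennreal (1 / 2) = 1" by (subst ennreal_plus[symmetric]) auto
  finally show ?thesis by simp
qed

text \<open>A Banach-Saks type substitute for weak compactness: by uniform convexity, almost minimisers
  of the norm over the hulls of the tails form a Cauchy sequence.\<close>

lemma Lp_bounded_imp_midpoint_convergent:
  fixes f :: "nat \<Rightarrow> 'b \<Rightarrow> real"
  assumes p: "1 < p" and [measurable]: "\<And>n. f n \<in> borel_measurable M"
    and C: "\<And>n. (\<integral>\<^sup>+x. ennreal (\<bar>f n x\<bar> powr p) \<partial>M) \<le> ennreal C" "0 \<le> C"
  obtains G g where "\<And>n. G n \<in> midpoint_hull (f ` {n..})" "\<And>n. G n \<in> borel_measurable M"
    "g \<in> borel_measurable M"
    "(\<lambda>n. \<integral>\<^sup>+x. ennreal (\<bar>G n x - g x\<bar> powr p) \<partial>M) \<longlonglongrightarrow> 0"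
proof -
  define H where "H = (\<lambda>n. midpoint_hull (f ` {n..}))"
  have p1: "1 \<le> p" using p by simp
  have H: "a \<in> borel_measurable M \<and> (\<integral>\<^sup>+x. ennreal (\<bar>a x\<bar> powr p) \<partial>M) \<le> ennreal C" if "a \<in> H n" for a n
    using that unfolding H_def
  proof induction
    case (base a)
    then show ?case using C by auto
  next
    case (midpoint a b)
    then have [measurable]: "a \<in> borel_measurable M" "b \<in> borel_measurable M" by auto
    have "(\<lambda>x. (a x + b x) / 2) \<in> borel_measurable M" by measurable
    then show ?case using nn_integral_midpoint_le[OF p1, of a M b "ennreal C"] midpoint.IH by simp
  qed
  have Hmono: "H n \<subseteq> H m" if "m \<le> n" for m n
    unfolding H_def using that by (intro midpoint_hull_mono image_mono) auto
  have Hmid: "(\<lambda>x. (a x + b x) / 2) \<in> H n" if "a \<in> H n" "b \<in> H n" for a b n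
    using that unfolding H_def by (rule midpoint_hull.midpoint)
  have Hne: "f n \<in> H n" for n unfolding H_def by (intro midpoint_hull.base) auto
  define N where "N = (\<lambda>a. \<integral>x. \<bar>a x\<bar> powr p \<partial>M)"
  have int: "integrable M (\<lambda>x. \<bar>a x\<bar> powr p)" if "a \<in> H n" for a n
    using H[OF that] by (intro integrableI_nonneg) (auto simp: le_less_trans)
  have N0: "0 \<le> N a" for a unfolding N_def by simp
  have NC: "N a \<le> C" if "a \<in> H n" for a n
    using H[OF that] C(2) nn_integral_eq_integral[OF int[OF that]] by (auto simp: N_def)
  \<comment> \<open>The hulls of the tails shrink, so these infima increase; bounded by
    \<open>C\<close>, they converge to \<open>J\<close>.\<close>
  define I where "I = (\<lambda>n. Inf (N ` H n))"
  have bdd: "bdd_below (N ` H n)" for n by (intro bdd_belowI[of _ 0]) (use N0 in auto)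
  have IN: "I n \<le> N a" if "a \<in> H n" for a n
    unfolding I_def using that bdd by (intro cInf_lower) auto
  have Imono: "I m \<le> I n" if "m \<le> n" for m n
    unfolding I_def using Hne[of n] Hmono[OF that] bdd by (intro cInf_superset_mono) auto
  have IC: "I n \<le> C" for n using IN[OF Hne] NC[OF Hne] by (rule order_trans)
  have Iconv: "I \<longlonglongrightarrow> (SUP n. I n)"
    using Imono IC by (intro LIMSEQ_incseq_SUP) (auto simp: incseq_def intro!: bdd_aboveI[of _ C])
  define J where "J = (SUP n. I n)"
  have IJ: "I n \<le> J" for n
    unfolding J_def using IC by (intro cSUP_upper bdd_aboveI[of _ C]) auto
  have "\<exists>a\<in>H n. N a < I n + 1 / Suc n" for n
  proof -
    have "Inf (N ` H n) < I n + 1 / Suc n" by (simp add: I_def)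
    then show ?thesis using Hne[of n] cInf_less_iff[OF _ bdd, of n "I n + 1 / Suc n"] by auto
  qed
  then obtain G where G: "\<And>n. G n \<in> H n" "\<And>n. N (G n) < I n + 1 / Suc n" by metis
  have GM[measurable]: "G n \<in> borel_measurable M" for n using H[OF G(1)] by simp
  have Cauchy: "\<exists>k. \<forall>m\<ge>k. \<forall>n\<ge>k. (\<integral>\<^sup>+x. ennreal (\<bar>G m x - G n x\<bar> powr p) \<partial>M) \<le> ennreal \<epsilon>" if \<epsilon>: "0 < \<epsilon>" for \<epsilon>
  proof -
    \<comment> \<open>Makes the \<open>e\<close> term of the convexity inequality, at most
      \<open>e * (C + C)\<close>, cost no more than half of \<epsilon>.\<close>
    define e where "e = \<epsilon> / (4 * (C + 1))"
    have e: "0 < e" using \<epsilon> C(2) by (simp add: e_def)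
    obtain Q where Q: "0 \<le> Q" and Quc: "\<And>a b. \<bar>a - b\<bar> powr p \<le> e * (\<bar>a\<bar> powr p + \<bar>b\<bar> powr p)
        + Q * ((\<bar>a\<bar> powr p + \<bar>b\<bar> powr p) / 2 - \<bar>(a + b) / 2\<bar> powr p)"
      using abs_powr_uniformly_convex[OF p e] by blast
    \<comment> \<open>For two almost minimisers from the tail \<open>k\<close>, the mean of their
      \<open>N\<close> is at most J + 1 / (k+1), while their midpoint lies in \<open>H k\<close> and
      has \<open>N\<close> at least \<open>I k\<close>. The convexity gap is thus bounded by this
      vanishing difference.\<close>
    have "(\<lambda>k. Q * (J + 1 / Suc k - I k)) \<longlonglongrightarrow> Q * (J + 0 - J)"
      using Iconv unfolding J_def[symmetric] by (intro tendsto_intros LIMSEQ_Suc[OF lim_1_over_n])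
    then have "(\<lambda>k. Q * (J + 1 / Suc k - I k)) \<longlonglongrightarrow> 0" by simp
    then have "\<forall>\<^sub>F k in sequentially. Q * (J + 1 / Suc k - I k) < \<epsilon> / 2"
      using \<epsilon> by (intro order_tendstoD(2)) auto
    then obtain k where k: "Q * (J + 1 / Suc k - I k) < \<epsilon> / 2"
      unfolding eventually_sequentially by blast
    show ?thesis
    proof (intro exI[of _ k] allI impI)
      fix m n assume m: "k \<le> m" and n: "k \<le> n"
      define c where "c = (\<lambda>x. (G m x + G n x) / 2)"
      have Gk: "G m \<in> H k" "G n \<in> H k" using G(1) Hmono m n by blast+
      then have c: "c \<in> H k" unfolding c_def by (rule Hmid)
      note ints = int[OF Gk(1)] int[OF Gk(2)] int[OF c]
      have le: "N (G j) \<le> J + 1 / Suc k" if "k \<le> j" for j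
      proof -
        have "1 / real (Suc j) \<le> 1 / real (Suc k)" using that by (simp add: frac_le)
        then show ?thesis using G(2)[of j] IJ[of j] by linarith
      qed
      let ?U = "\<lambda>x. e * (\<bar>G m x\<bar> powr p + \<bar>G n x\<bar> powr p)
          + Q * ((\<bar>G m x\<bar> powr p + \<bar>G n x\<bar> powr p) / 2 - \<bar>c x\<bar> powr p)"
      have intU: "integrable M ?U" using ints by auto
      have "(\<integral>\<^sup>+x. ennreal (\<bar>G m x - G n x\<bar> powr p) \<partial>M) \<le> (\<integral>\<^sup>+x. ennreal (?U x) \<partial>M)"
        unfolding c_def using Quc by (intro nn_integral_mono ennreal_leI)
      also have "\<dots> = ennreal (\<integral>x. ?U x \<partial>M)"
      proof (intro nn_integral_eq_integral intU AE_I2)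
        fix x
        show "0 \<le> ?U x" unfolding c_def using Quc[of "G m x" "G n x"] powr_ge_zero order_trans by blast
      qed
      also have "(\<integral>x. ?U x \<partial>M) = e * (N (G m) + N (G n)) + Q * ((N (G m) + N (G n)) / 2 - N c)"
        using ints by (simp add: N_def)
      also have "\<dots> \<le> e * (C + C) + Q * (J + 1 / Suc k - I k)"
      proof (intro add_mono mult_left_mono NC[OF Gk(1)] NC[OF Gk(2)] Q)
        have "(N (G m) + N (G n)) / 2 \<le> J + 1 / Suc k"
          using add_mono[OF le[OF m] le[OF n]] by (simp only: mult_2[symmetric] divide_le_eq_numeral1 mult.commute)
        then show "(N (G m) + N (G n)) / 2 - N c \<le> J + 1 / Suc k - I k"
          using IN[OF c] by (rule diff_mono)
      qed (use e in simp)
      also have "\<dots> \<le> \<epsilon>"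
      proof -
        have "e * (C + C) \<le> e * (2 * (C + 1))" using e by (intro mult_left_mono) auto
        also have "\<dots> = \<epsilon> / 2" using C(2) by (simp add: e_def field_simps)
        finally show ?thesis using k by linarith
      qed
      finally show "(\<integral>\<^sup>+x. ennreal (\<bar>G m x - G n x\<bar> powr p) \<partial>M) \<le> ennreal \<epsilon>" by (simp add: ennreal_leI)
    qed
  qed
  obtain g where "g \<in> borel_measurable M"
    "(\<lambda>n. \<integral>\<^sup>+x. ennreal (\<bar>G n x - g x\<bar> powr p) \<partial>M) \<longlonglongrightarrow> 0"
    using Lp_Cauchy_imp_convergent[where w = G, OF p1 GM Cauchy] by blast
  then show ?thesis using that[of G g] G(1) by (simp add: H_def)
qed

section \<open>Pairings with bounded functions of compact support\<close>

text \<open>Hoelder on a ball in p-th power form, obtained from Jensen for the uniform density; no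
  conjugate exponent appears, so \<open>p = 1\<close> is covered.\<close>

lemma pairing_powr_le:
  fixes f \<psi> :: "'a::euclidean_space \<Rightarrow> real"
  assumes p: "1 \<le> p" and [measurable]: "f \<in> borel_measurable borel" "\<psi> \<in> borel_measurable borel"
    and \<psi>: "\<And>x. \<bar>\<psi> x\<bar> \<le> B" "\<And>x. R < norm x \<Longrightarrow> \<psi> x = 0" and R: "0 < R"
  shows "ennreal (\<bar>\<integral>x. f x * \<psi> x \<partial>lborel\<bar> powr p)
    \<le> ennreal (B powr p * measure lborel (cball (0::'a) R) powr (p - 1)) * (\<integral>\<^sup>+x. ennreal (\<bar>f x\<bar> powr p) \<partial>lborel)"
proof -
  define E where "E = cball (0::'a) R"
  define m where "m = measure lborel E"
  have em: "emeasure lborel E = ennreal m"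
    using emeasure_compact_finite[of E] by (simp add: m_def emeasure_eq_ennreal_measure E_def)
  have m: "0 < m" unfolding m_def E_def using content_cball_pos[OF R] by simp
  have [measurable]: "E \<in> sets borel" by (simp add: E_def)
  define \<eta> where "\<eta> = (\<lambda>x. indicator E x / m)"
  have [measurable]: "\<eta> \<in> borel_measurable borel" unfolding \<eta>_def by measurable
  have one: "(\<integral>\<^sup>+x. ennreal (\<eta> x) \<partial>lborel) = 1"
  proof -
    have "(\<integral>\<^sup>+x. ennreal (\<eta> x) \<partial>lborel) = (\<integral>\<^sup>+x. ennreal (1 / m) * indicator E x \<partial>lborel)"
      by (intro nn_integral_cong) (auto simp: \<eta>_def indicator_def)
    also have "\<dots> = ennreal (1 / m) * ennreal m"
      using em by (subst nn_integral_cmult_indicator) auto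
    also have "\<dots> = 1" using m by (simp add: ennreal_mult[symmetric])
    finally show ?thesis .
  qed
  have supp: "\<psi> x = 0" if "x \<notin> E" for x using that \<psi>(2)[of x] by (auto simp: E_def)
  \<comment> \<open>The factor \<open>m\<close> undoes the normalisation of \<open>\<eta>\<close>;
    raised to the power \<open>p\<close> against the density 1 / m it leaves m^(p-1).\<close>
  have "f x * \<psi> x = \<eta> x * (f x * \<psi> x * m)" for x
    using m supp[of x] by (auto simp: \<eta>_def indicator_def)
  then have "ennreal (\<bar>\<integral>x. f x * \<psi> x \<partial>lborel\<bar> powr p) = ennreal (\<bar>\<integral>x. \<eta> x * (f x * \<psi> x * m) \<partial>lborel\<bar> powr p)"
    by metis
  also have "\<dots> \<le> (\<integral>\<^sup>+x. ennreal (\<eta> x * \<bar>f x * \<psi> x * m\<bar> powr p) \<partial>lborel)"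
    by (rule powr_average_le[OF p _ _ _ one]) (use m in \<open>auto simp: \<eta>_def\<close>)
  also have "\<dots> \<le> (\<integral>\<^sup>+x. ennreal (B powr p * m powr (p - 1)) * ennreal (\<bar>f x\<bar> powr p) \<partial>lborel)"
  proof (intro nn_integral_mono)
    fix x
    have "\<eta> x * \<bar>f x * \<psi> x * m\<bar> powr p = \<eta> x * m powr p * \<bar>\<psi> x\<bar> powr p * \<bar>f x\<bar> powr p"
      using m by (simp add: abs_mult powr_mult)
    also have "\<dots> \<le> (1 / m) * m powr p * B powr p * \<bar>f x\<bar> powr p"
      using m p \<psi>(1)[of x] by (intro mult_mono powr_mono2) (auto simp: \<eta>_def indicator_def)
    also have "\<dots> = B powr p * m powr (p - 1) * \<bar>f x\<bar> powr p"
      using m by (simp add: powr_diff)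
    finally show "ennreal (\<eta> x * \<bar>f x * \<psi> x * m\<bar> powr p)
        \<le> ennreal (B powr p * m powr (p - 1)) * ennreal (\<bar>f x\<bar> powr p)"
      by (simp add: ennreal_mult[symmetric] ennreal_leI)
  qed
  also have "\<dots> = ennreal (B powr p * m powr (p - 1)) * (\<integral>\<^sup>+x. ennreal (\<bar>f x\<bar> powr p) \<partial>lborel)"
    by (simp add: nn_integral_cmult)
  finally show ?thesis by (simp add: m_def E_def)
qed

lemma pairing_integrable:
  fixes f \<psi> :: "'a::euclidean_space \<Rightarrow> real"
  assumes p: "1 \<le> p" and [measurable]: "f \<in> borel_measurable borel" "\<psi> \<in> borel_measurable borel"
    and \<psi>: "\<And>x. \<bar>\<psi> x\<bar> \<le> B" "\<And>x. R < norm x \<Longrightarrow> \<psi> x = 0"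
    and f: "(\<integral>\<^sup>+x. ennreal (\<bar>f x\<bar> powr p) \<partial>lborel) < \<infinity>"
  shows "integrable lborel (\<lambda>x. f x * \<psi> x)"
proof -
  define E where "E = cball (0::'a) R"
  obtain C where C: "(\<integral>\<^sup>+x. ennreal (\<bar>f x\<bar> powr p) \<partial>lborel) = ennreal C" "0 \<le> C"
    using f by (metis ennreal_cases infinity_ennreal_def order_less_irrefl)
  have int: "integrable lborel (\<lambda>x. indicator E x * \<bar>f x\<bar>)"
    using integrable_abs_on_finite_measure(1)[OF p, of f lborel E C] C emeasure_compact_finite[of E]
    by (auto simp: E_def)
  have B: "0 \<le> B" using \<psi>(1)[of 0] by linarith
  show ?thesis
  proof (rule Bochner_Integration.integrable_bound)
    show "integrable lborel (\<lambda>x. B * (indicator E x * \<bar>f x\<bar>))"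
      by (intro integrable_mult_right int)
    show "AE x in lborel. norm (f x * \<psi> x) \<le> norm (B * (indicator E x * \<bar>f x\<bar>))"
    proof (intro AE_I2)
      fix x
      show "norm (f x * \<psi> x) \<le> norm (B * (indicator E x * \<bar>f x\<bar>))"
        using \<psi>(1)[of x] \<psi>(2)[of x] B
        by (cases "x \<in> E") (auto simp: E_def abs_mult mult.commute intro!: mult_right_mono)
    qed
  qed measurable
qed

section \<open>Difference quotients and weak derivatives\<close>

lemma smooth_differentiable: "smooth f \<Longrightarrow> f differentiable (at x)"
  by (auto elim: smooth.cases)

lemma smooth_partial: "smooth f \<Longrightarrow> i \<in> Basis \<Longrightarrow> smooth (partial i f)"
  by (auto elim: smooth.cases)

lemma smooth_continuous_on: "smooth f \<Longrightarrow> continuous_on S f"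
  by (meson continuous_on_subset differentiable_imp_continuous_on differentiable_on_def
      differentiable_at_withinI smooth_differentiable subset_UNIV)

lemma partial_eq_0:
  assumes "open S" "x \<in> S" "\<And>y. y \<in> S \<Longrightarrow> f y = 0"
  shows "partial i f x = 0"
proof -
  have "((\<lambda>_. 0) has_derivative (\<lambda>_. 0)) (at x)" by simp
  then have "(f has_derivative (\<lambda>_. 0)) (at x)"
    by (rule has_derivative_transform_within_open[OF _ assms(1,2)]) (use assms(3) in auto)
  then have "(\<lambda>_. 0) = frechet_derivative f (at x)" by (rule frechet_derivative_at)
  then show ?thesis by (simp add: partial_def fun_eq_iff)
qed

text \<open>Outside the closed ball of radius \<open>R\<close> the function vanishes on an open set,
  so its partial derivative vanishes there as well; continuity on the ball bounds both.\<close>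

lemma test_fun_bounds:
  fixes \<phi> :: "'a::euclidean_space \<Rightarrow> real"
  assumes \<phi>: "test_fun \<phi>" and i: "i \<in> Basis"
  obtains R B where "0 < R" "\<And>x. \<bar>\<phi> x\<bar> \<le> B" "\<And>x. \<bar>partial i \<phi> x\<bar> \<le> B"
    "\<And>x. R < norm x \<Longrightarrow> \<phi> x = 0" "\<And>x. R < norm x \<Longrightarrow> partial i \<phi> x = 0"
proof -
  have s: "smooth \<phi>" and c: "compact (closure {x. \<phi> x \<noteq> 0})" using \<phi> by (auto simp: test_fun_def)
  obtain R where R: "0 < R" "\<And>x. x \<in> closure {x. \<phi> x \<noteq> 0} \<Longrightarrow> norm x \<le> R"
    using compact_imp_bounded[OF c] unfolding bounded_pos by blast
  have 1: "\<phi> x = 0" if "R < norm x" for x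
    using R(2)[of x] that closure_subset[of "{x. \<phi> x \<noteq> 0}"] by force
  have 2: "partial i \<phi> x = 0" if "R < norm x" for x
    by (rule partial_eq_0[of "{y. R < norm y}"]) (use that 1 in \<open>auto intro!: open_Collect_less continuous_intros\<close>)
  have bdd: "\<exists>B. \<forall>x. \<bar>f x\<bar> \<le> B" if "smooth f" "\<And>x. R < norm x \<Longrightarrow> f x = 0" for f :: "'a \<Rightarrow> real"
  proof -
    have "compact (f ` cball 0 R)"
      by (intro compact_continuous_image smooth_continuous_on that) simp
    then have "bounded (f ` cball 0 R)" by (rule compact_imp_bounded)
    then obtain B where B: "0 < B" "\<forall>y\<in>f ` cball 0 R. norm y \<le> B"
      unfolding bounded_pos by (elim exE conjE) (rule that)
    have "\<bar>f x\<bar> \<le> B" for x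
    proof (cases "norm x \<le> R")
      case True
      then have "f x \<in> f ` cball 0 R" by simp
      then show ?thesis using B(2) by (metis real_norm_def)
    qed (use B(1) that(2)[of x] in simp)
    then show ?thesis by blast
  qed
  obtain B1 B2 where "\<And>x. \<bar>\<phi> x\<bar> \<le> B1" "\<And>x. \<bar>partial i \<phi> x\<bar> \<le> B2"
    using bdd[OF s 1] bdd[OF smooth_partial[OF s i] 2] by blast
  then have "\<bar>\<phi> x\<bar> \<le> max B1 B2" "\<bar>partial i \<phi> x\<bar> \<le> max B1 B2" for x
    by (auto simp: le_max_iff_disj)
  then show ?thesis using that[OF R(1), of "max B1 B2"] 1 2 by blast
qed

lemma partial_has_real_derivative:
  fixes \<phi> :: "'a::euclidean_space \<Rightarrow> real"
  assumes "smooth \<phi>"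
  shows "((\<lambda>s. \<phi> (x - s *\<^sub>R i)) has_real_derivative - partial i \<phi> (x - s *\<^sub>R i)) (at s)"
proof -
  let ?D = "frechet_derivative \<phi> (at (x - s *\<^sub>R i))"
  have D: "(\<phi> has_derivative ?D) (at (x - s *\<^sub>R i))"
    using smooth_differentiable[OF assms] frechet_derivative_works by blast
  have "((\<lambda>s. x - s *\<^sub>R i) has_derivative (\<lambda>h. - (h *\<^sub>R i))) (at s)"
    by (auto intro!: derivative_eq_intros)
  then have "((\<lambda>s. \<phi> (x - s *\<^sub>R i)) has_derivative (\<lambda>h. ?D (- (h *\<^sub>R i)))) (at s)"
    using D by (rule has_derivative_compose)
  moreover have "(\<lambda>h. ?D (- (h *\<^sub>R i))) = (*) (- ?D i)"
    using has_derivative_bounded_linear[OF D]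
    by (intro ext) (simp add: linear_neg linear_scale bounded_linear.linear mult.commute)
  ultimately show ?thesis by (simp only: has_field_derivative_def partial_def)
qed

lemma integral_lborel_translate:
  fixes f :: "'a::euclidean_space \<Rightarrow> real"
  assumes [measurable]: "f \<in> borel_measurable borel"
  shows "(\<integral>x. f (x + a) \<partial>lborel) = (\<integral>x. f x \<partial>lborel)"
proof -
  have "(\<integral>x. f x \<partial>lborel) = (\<integral>x. f x \<partial>distr lborel borel ((+) a))"
    by (simp add: lborel_distr_plus)
  also have "\<dots> = (\<integral>x. f (x + a) \<partial>lborel)"
    by (subst integral_distr) (auto simp: add.commute)
  finally show ?thesis by simp
qed

text \<open>Discrete integration by parts: translation moves the difference quotient from
  \<open>v\<close> to the test function, as a backward quotient, and dominated convergence passes to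
  the limit. The reversed direction gives the minus sign.\<close>

lemma difference_quotient_weak_limit:
  fixes v \<phi> :: "'a::euclidean_space \<Rightarrow> real"
  assumes p: "1 \<le> p" and [measurable]: "v \<in> borel_measurable borel"
    and fin: "(\<integral>\<^sup>+x. ennreal (\<bar>v x\<bar> powr p) \<partial>lborel) < \<infinity>"
    and \<phi>: "test_fun \<phi>" and i: "i \<in> Basis"
  shows "(\<lambda>n. \<integral>x. ((v (x + (1 / Suc n) *\<^sub>R i) - v x) * Suc n) * \<phi> x \<partial>lborel)
    \<longlonglongrightarrow> - (\<integral>x. v x * partial i \<phi> x \<partial>lborel)"
proof -
  obtain R B where RB: "0 < R" "\<And>x. \<bar>\<phi> x\<bar> \<le> B" "\<And>x. \<bar>partial i \<phi> x\<bar> \<le> B"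
    "\<And>x. R < norm x \<Longrightarrow> \<phi> x = 0" "\<And>x. R < norm x \<Longrightarrow> partial i \<phi> x = 0"
    using test_fun_bounds[OF \<phi> i] by blast
  have s: "smooth \<phi>" using \<phi> by (simp add: test_fun_def)
  have [measurable]: "\<phi> \<in> borel_measurable borel" "partial i \<phi> \<in> borel_measurable borel"
    using s smooth_partial[OF s i] smooth_continuous_on borel_measurable_continuous_onI by blast+
  have [measurable]: "cball (0::'a) (R + 1) \<in> sets borel" by simp
  have B: "0 \<le> B" using RB(2)[of 0] by linarith
  define h where "h = (\<lambda>n. 1 / real (Suc n))"
  have h: "0 < h n" "h n \<le> 1" for n by (auto simp: h_def)
  define D where "D = (\<lambda>n x. (\<phi> (x - h n *\<^sub>R i) - \<phi> x) * Suc n)"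
  have [measurable]: "D n \<in> borel_measurable borel" for n unfolding D_def by measurable
  \<comment> \<open>By the mean value theorem the quotient is a value of minus the partial
    derivative.\<close>
  have Dbd: "\<bar>D n x\<bar> \<le> B" for n x
  proof -
    obtain z where "\<phi> (x - h n *\<^sub>R i) - \<phi> (x - 0 *\<^sub>R i) = (h n - 0) * (- partial i \<phi> (x - z *\<^sub>R i))"
      using MVT2[OF h(1)[of n], of "\<lambda>s. \<phi> (x - s *\<^sub>R i)" "\<lambda>s. - partial i \<phi> (x - s *\<^sub>R i)"]
        partial_has_real_derivative[OF s] by blast
    then have "D n x = - partial i \<phi> (x - z *\<^sub>R i)" by (simp add: D_def h_def)
    then show ?thesis using RB(3) by simp
  qed
  \<comment> \<open>Steps have length at most 1, so one ball of radius \<open>R + 1\<close> contains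
    all the supports.\<close>
  have Dsupp: "D n x = 0" if "R + 1 < norm x" for n x
  proof -
    have "norm (h n *\<^sub>R i) \<le> 1" using h[of n] i by simp
    then have "R < norm (x - h n *\<^sub>R i)" "R < norm x"
      using norm_triangle_ineq2[of x "h n *\<^sub>R i"] that by linarith+
    then show ?thesis by (simp add: D_def RB(4))
  qed
  have Dlim: "(\<lambda>n. D n x) \<longlonglongrightarrow> - partial i \<phi> x" for x
  proof -
    have "((\<lambda>s. (\<phi> (x - (0 + s) *\<^sub>R i) - \<phi> (x - 0 *\<^sub>R i)) / s) \<longlongrightarrow> - partial i \<phi> (x - 0 *\<^sub>R i)) (at 0)"
      using partial_has_real_derivative[OF s, of x i 0] unfolding DERIV_def .
    moreover have "filterlim h (at 0) sequentially"
      using h LIMSEQ_Suc[OF lim_1_over_n[where 'a = real]] unfolding filterlim_at h_def by auto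
    ultimately have "(\<lambda>n. (\<phi> (x - (0 + h n) *\<^sub>R i) - \<phi> (x - 0 *\<^sub>R i)) / h n) \<longlonglongrightarrow> - partial i \<phi> (x - 0 *\<^sub>R i)"
      by (rule filterlim_compose)
    then show ?thesis by (simp add: D_def h_def)
  qed
  have eq: "(\<integral>x. ((v (x + h n *\<^sub>R i) - v x) * Suc n) * \<phi> x \<partial>lborel) = (\<integral>x. v x * D n x \<partial>lborel)" for n
  proof -
    have i1: "integrable lborel (\<lambda>x. v x * \<phi> x)"
      by (rule pairing_integrable[OF p _ _ RB(2,4) fin]) auto
    have i2: "integrable lborel (\<lambda>x. v x * \<phi> (x - h n *\<^sub>R i))"
    proof (rule pairing_integrable[OF p _ _ _ _ fin])
      show "\<bar>\<phi> (x - h n *\<^sub>R i)\<bar> \<le> B" for x by (rule RB(2))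
      show "\<phi> (x - h n *\<^sub>R i) = 0" if "R + 1 < norm x" for x
      proof -
        have "norm (h n *\<^sub>R i) \<le> 1" using h[of n] i by simp
        then show ?thesis using norm_triangle_ineq2[of x "h n *\<^sub>R i"] that by (intro RB(4)) linarith
      qed
    qed measurable
    have fin': "(\<integral>\<^sup>+x. ennreal (\<bar>v (x + h n *\<^sub>R i)\<bar> powr p) \<partial>lborel) < \<infinity>"
      using fin nn_integral_lborel_translate[of "\<lambda>x. ennreal (\<bar>v x\<bar> powr p)" "h n *\<^sub>R i"] by simp
    have i3: "integrable lborel (\<lambda>x. v (x + h n *\<^sub>R i) * \<phi> x)"
      by (rule pairing_integrable[OF p _ _ RB(2,4) fin']) auto
    have "(\<integral>x. ((v (x + h n *\<^sub>R i) - v x) * Suc n) * \<phi> x \<partial>lborel)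
        = (\<integral>x. Suc n * (v (x + h n *\<^sub>R i) * \<phi> x) - Suc n * (v x * \<phi> x) \<partial>lborel)"
      by (simp add: algebra_simps)
    also have "\<dots> = Suc n * (\<integral>x. v (x + h n *\<^sub>R i) * \<phi> x \<partial>lborel) - Suc n * (\<integral>x. v x * \<phi> x \<partial>lborel)"
      using i1 i3 by (subst Bochner_Integration.integral_diff) auto
    also have "(\<integral>x. v (x + h n *\<^sub>R i) * \<phi> x \<partial>lborel) = (\<integral>x. v x * \<phi> (x - h n *\<^sub>R i) \<partial>lborel)"
      using integral_lborel_translate[of "\<lambda>x. v x * \<phi> (x - h n *\<^sub>R i)" "h n *\<^sub>R i"] by simp
    also have "Suc n * (\<integral>x. v x * \<phi> (x - h n *\<^sub>R i) \<partial>lborel) - Suc n * (\<integral>x. v x * \<phi> x \<partial>lborel)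
        = (\<integral>x. Suc n * (v x * \<phi> (x - h n *\<^sub>R i)) - Suc n * (v x * \<phi> x) \<partial>lborel)"
      using i1 i2 by (subst Bochner_Integration.integral_diff) auto
    also have "\<dots> = (\<integral>x. v x * D n x \<partial>lborel)"
      by (simp add: D_def algebra_simps)
    finally show ?thesis .
  qed
  have "(\<lambda>n. \<integral>x. v x * D n x \<partial>lborel) \<longlonglongrightarrow> (\<integral>x. v x * - partial i \<phi> x \<partial>lborel)"
  proof (rule integral_dominated_convergence)
    show "integrable lborel (\<lambda>x. \<bar>v x * (B * indicator (cball 0 (R + 1)) x)\<bar>)"
    proof (intro integrable_abs pairing_integrable[OF p _ _ _ _ fin])
      show "\<bar>B * indicator (cball 0 (R + 1)) x\<bar> \<le> B" for x :: 'a using B by (auto simp: indicator_def)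
      show "B * indicator (cball 0 (R + 1)) x = 0" if "R + 1 < norm x" for x :: 'a
        using that by (auto simp: indicator_def)
    qed measurable
    show "AE x in lborel. (\<lambda>n. v x * D n x) \<longlonglongrightarrow> v x * - partial i \<phi> x"
      by (intro AE_I2 tendsto_intros Dlim)
    show "AE x in lborel. norm (v x * D n x) \<le> \<bar>v x * (B * indicator (cball 0 (R + 1)) x)\<bar>" for n
    proof (intro AE_I2)
      fix x
      show "norm (v x * D n x) \<le> \<bar>v x * (B * indicator (cball 0 (R + 1)) x)\<bar>"
        using Dbd[of n x] Dsupp[of x n] B
        by (cases "norm x \<le> R + 1") (auto simp: abs_mult intro!: mult_left_mono)
    qed
  qed measurable
  then show ?thesis unfolding eq[symmetric] by (simp add: h_def)
qed

text \<open>The step has length 1 / (n+1), so the power of |h| cancels the p-th power of the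
  quotient's denominator.\<close>

lemma shift_energy_difference_quotient:
  fixes v :: "'a::euclidean_space \<Rightarrow> real"
  assumes [measurable]: "v \<in> borel_measurable borel" and C: "0 \<le> C" and i: "i \<in> Basis"
    and W: "\<And>h. shift_energy p v h \<le> ennreal (C * norm h powr p)"
  shows "(\<integral>\<^sup>+x. ennreal (\<bar>(v (x + (1 / Suc n) *\<^sub>R i) - v x) * Suc n\<bar> powr p) \<partial>lborel) \<le> ennreal C"
proof -
  let ?h = "(1 / real (Suc n)) *\<^sub>R i"
  have "(\<integral>\<^sup>+x. ennreal (\<bar>(v (x + ?h) - v x) * Suc n\<bar> powr p) \<partial>lborel)
      = ennreal (Suc n powr p) * shift_energy p v ?h"
    unfolding shift_energy_def
    by (subst nn_integral_cmult[symmetric])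
      (auto simp: abs_mult powr_mult ennreal_mult[symmetric] mult.commute intro!: nn_integral_cong)
  also have "\<dots> \<le> ennreal (Suc n powr p) * ennreal (C * norm ?h powr p)"
    by (intro mult_left_mono W) auto
  also have "\<dots> = ennreal (C * (Suc n powr p * norm ?h powr p))"
    using C by (simp add: ennreal_mult[symmetric] mult.left_commute)
  also have "Suc n powr p * norm ?h powr p = 1"
    using i by (simp add: powr_mult[symmetric] powr_divide)
  finally show ?thesis by simp
qed

text \<open>Midpoint combinations may replace the quotients because pairing with a test function is
  linear: combinations of late quotients pair with nearly the same number. Their strong limit
  \<open>g\<close> therefore has the required pairings, with one \<open>g\<close> for all test
  functions.\<close>

lemma shift_energy_bound_imp_weak_derivative:
  fixes v :: "'a::euclidean_space \<Rightarrow> real"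
  assumes p: "1 < p" and v[measurable]: "v \<in> borel_measurable borel"
    and fin: "(\<integral>\<^sup>+x. ennreal (\<bar>v x\<bar> powr p) \<partial>lborel) < \<infinity>"
    and C: "0 \<le> C" and W: "\<And>h. shift_energy p v h \<le> ennreal (C * norm h powr p)" and i: "i \<in> Basis"
  obtains g where "g \<in> borel_measurable borel" "(\<integral>\<^sup>+x. ennreal (\<bar>g x\<bar> powr p) \<partial>lborel) < \<infinity>"
    "\<And>\<phi>. test_fun \<phi> \<Longrightarrow> (\<integral>x. v x * partial i \<phi> x \<partial>lborel) = - (\<integral>x. g x * \<phi> x \<partial>lborel)"
proof -
  have p1: "1 \<le> p" using p by simp
  define f where "f = (\<lambda>n x. (v (x + (1 / Suc n) *\<^sub>R i) - v x) * Suc n)"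
  have fm[measurable]: "f n \<in> borel_measurable lborel" for n unfolding f_def by measurable
  have fC: "(\<integral>\<^sup>+x. ennreal (\<bar>f n x\<bar> powr p) \<partial>lborel) \<le> ennreal C" for n
    unfolding f_def by (rule shift_energy_difference_quotient[OF v C i W])
  obtain G g where G: "\<And>n. G n \<in> midpoint_hull (f ` {n..})" and [measurable]: "\<And>n. G n \<in> borel_measurable lborel"
    "g \<in> borel_measurable lborel"
    and lim: "(\<lambda>n. \<integral>\<^sup>+x. ennreal (\<bar>G n x - g x\<bar> powr p) \<partial>lborel) \<longlonglongrightarrow> 0"
    by (rule Lp_bounded_imp_midpoint_convergent[where f = f, OF p fm fC C], rule that)
  have hull: "a \<in> borel_measurable lborel \<and> (\<integral>\<^sup>+x. ennreal (\<bar>a x\<bar> powr p) \<partial>lborel) \<le> ennreal C"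
    if "a \<in> midpoint_hull (range f)" for a
    using that
  proof induction
    case (base a)
    then show ?case using fC by auto
  next
    case (midpoint a b)
    then have [measurable]: "a \<in> borel_measurable lborel" "b \<in> borel_measurable lborel" by auto
    have "(\<lambda>x. (a x + b x) / 2) \<in> borel_measurable lborel" by measurable
    then show ?case using nn_integral_midpoint_le[OF p1, of a lborel b "ennreal C"] midpoint.IH by simp
  qed
  have sub: "midpoint_hull (f ` {n..}) \<subseteq> midpoint_hull (range f)" for n
    by (intro midpoint_hull_mono) auto
  have GC: "(\<integral>\<^sup>+x. ennreal (\<bar>G n x\<bar> powr p) \<partial>lborel) \<le> ennreal C" for n
    using hull G sub by blast
  have gfin: "(\<integral>\<^sup>+x. ennreal (\<bar>g x\<bar> powr p) \<partial>lborel) < \<infinity>"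
  proof -
    have "\<forall>\<^sub>F n in sequentially. (\<integral>\<^sup>+x. ennreal (\<bar>G n x - g x\<bar> powr p) \<partial>lborel) < 1"
      using lim by (intro order_tendstoD(2)) auto
    then obtain n where n: "(\<integral>\<^sup>+x. ennreal (\<bar>G n x - g x\<bar> powr p) \<partial>lborel) < 1"
      unfolding eventually_sequentially by blast
    \<comment> \<open>The third summand 0 allows the inequality for three terms to be
      reused.\<close>
    have "(\<integral>\<^sup>+x. ennreal (\<bar>g x\<bar> powr p) \<partial>lborel) = (\<integral>\<^sup>+x. ennreal (\<bar>(g x - G n x) + G n x + 0\<bar> powr p) \<partial>lborel)"
      by simp
    also have "\<dots> \<le> ennreal (4 powr (p - 1)) * ((\<integral>\<^sup>+x. ennreal (\<bar>g x - G n x\<bar> powr p) \<partial>lborel)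
        + (\<integral>\<^sup>+x. ennreal (\<bar>G n x\<bar> powr p) \<partial>lborel) + (\<integral>\<^sup>+x. ennreal (\<bar>0\<bar> powr p) \<partial>(lborel :: 'a measure)))"
      by (rule nn_integral_abs_add3_powr_le[OF p1]) measurable
    also have "\<dots> \<le> ennreal (4 powr (p - 1)) * (1 + ennreal C + 0)"
      using n GC[of n] by (intro mult_left_mono add_mono) (auto simp: abs_minus_commute)
    also have "\<dots> < \<infinity>" by (simp add: ennreal_mult_less_top)
    finally show ?thesis .
  qed
  have "(\<integral>x. v x * partial i \<phi> x \<partial>lborel) = - (\<integral>x. g x * \<phi> x \<partial>lborel)" if \<phi>: "test_fun \<phi>" for \<phi>
  proof -
    obtain R B where RB: "0 < R" "\<And>x. \<bar>\<phi> x\<bar> \<le> B" "\<And>x. R < norm x \<Longrightarrow> \<phi> x = 0"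
      using test_fun_bounds[OF \<phi> i] by metis
    have s: "smooth \<phi>" using \<phi> by (simp add: test_fun_def)
    have [measurable]: "\<phi> \<in> borel_measurable borel"
      using s smooth_continuous_on borel_measurable_continuous_onI by blast
    have int: "integrable lborel (\<lambda>x. a x * \<phi> x)"
      if "a \<in> borel_measurable lborel" "(\<integral>\<^sup>+x. ennreal (\<bar>a x\<bar> powr p) \<partial>lborel) < \<infinity>" for a
      by (rule pairing_integrable[OF p1 _ _ RB(2,3) that(2)]) (use that(1) in auto)
    define l where "l = - (\<integral>x. v x * partial i \<phi> x \<partial>lborel)"
    have flim: "(\<lambda>n. \<integral>x. f n x * \<phi> x \<partial>lborel) \<longlonglongrightarrow> l"
      unfolding f_def l_def by (rule difference_quotient_weak_limit[OF p1 v fin \<phi> i])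
    have "(\<lambda>n. \<integral>x. G n x * \<phi> x \<partial>lborel) \<longlonglongrightarrow> l"
    proof (rule LIMSEQ_I)
      fix e :: real assume "0 < e"
      then obtain k where k: "\<And>n. k \<le> n \<Longrightarrow> norm ((\<integral>x. f n x * \<phi> x \<partial>lborel) - l) < e"
        using LIMSEQ_D[OF flim] by blast
      have int_hull: "integrable lborel (\<lambda>x. a x * \<phi> x)" if "a \<in> midpoint_hull (f ` {k..})" for a
      proof (rule int)
        have "a \<in> midpoint_hull (range f)" using that sub by blast
        from hull[OF this] show "a \<in> borel_measurable lborel" "(\<integral>\<^sup>+x. ennreal (\<bar>a x\<bar> powr p) \<partial>lborel) < \<infinity>"
          by (auto simp: le_less_trans)
      qed
      \<comment> \<open>An interval around \<open>l\<close> is closed under midpoints, so the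
        estimate spreads from the late quotients to their hull.\<close>
      have "\<bar>(\<integral>x. a x * \<phi> x \<partial>lborel) - l\<bar> < e" if "a \<in> midpoint_hull (f ` {k..})" for a
        using that
      proof induction
        case (base a)
        then show ?case using k by auto
      next
        case (midpoint a b)
        have ab: "integrable lborel (\<lambda>x. a x * \<phi> x)" "integrable lborel (\<lambda>x. b x * \<phi> x)"
          using midpoint.hyps by (auto intro: int_hull)
        have "(\<integral>x. (a x + b x) / 2 * \<phi> x \<partial>lborel) = (\<integral>x. (a x * \<phi> x) / 2 + (b x * \<phi> x) / 2 \<partial>lborel)"
          by (intro Bochner_Integration.integral_cong) (auto simp: algebra_simps add_divide_distrib)
        also have "\<dots> = (\<integral>x. a x * \<phi> x \<partial>lborel) / 2 + (\<integral>x. b x * \<phi> x \<partial>lborel) / 2"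
          using ab by (subst Bochner_Integration.integral_add) auto
        finally have "2 * (\<integral>x. (a x + b x) / 2 * \<phi> x \<partial>lborel) = (\<integral>x. a x * \<phi> x \<partial>lborel) + (\<integral>x. b x * \<phi> x \<partial>lborel)"
          by simp
        then show ?case using midpoint.IH by linarith
      qed
      moreover have "G n \<in> midpoint_hull (f ` {k..})" if "k \<le> n" for n
        using G[of n] midpoint_hull_mono[of "f ` {n..}" "f ` {k..}"] that by (auto simp: image_mono)
      ultimately show "\<exists>no. \<forall>n\<ge>no. norm ((\<integral>x. G n x * \<phi> x \<partial>lborel) - l) < e" by auto
    qed
    moreover have "(\<lambda>n. \<integral>x. G n x * \<phi> x \<partial>lborel) \<longlonglongrightarrow> (\<integral>x. g x * \<phi> x \<partial>lborel)"
    proof -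
      \<comment> \<open>The constant of \<open>pairing_powr_le\<close>; strong convergence then
        forces the pairings to converge.\<close>
      define c where "c = B powr p * measure lborel (cball (0::'a) R) powr (p - 1)"
      let ?a = "\<lambda>n. (\<integral>x. (G n x - g x) * \<phi> x \<partial>lborel)"
      have "(\<lambda>n. ennreal c * (\<integral>\<^sup>+x. ennreal (\<bar>G n x - g x\<bar> powr p) \<partial>lborel)) \<longlonglongrightarrow> ennreal c * 0"
        using lim by (intro tendsto_mult_ennreal tendsto_const) auto
      then have "(\<lambda>n. ennreal c * (\<integral>\<^sup>+x. ennreal (\<bar>G n x - g x\<bar> powr p) \<partial>lborel)) \<longlonglongrightarrow> 0" by simp
      then have "(\<lambda>n. ennreal (\<bar>?a n\<bar> powr p)) \<longlonglongrightarrow> 0"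
      proof (rule tendsto_sandwich[OF _ _ tendsto_const, rotated 2])
        show "\<forall>\<^sub>F n in sequentially. ennreal (\<bar>?a n\<bar> powr p) \<le> ennreal c * (\<integral>\<^sup>+x. ennreal (\<bar>G n x - g x\<bar> powr p) \<partial>lborel)"
          unfolding c_def by (intro always_eventually allI pairing_powr_le[OF p1 _ _ RB(2,3,1)]) auto
      qed simp
      then have "(\<lambda>n. \<bar>?a n\<bar> powr p) \<longlonglongrightarrow> 0"
        by (simp add: ennreal_tendsto_0_iff)
      then have "(\<lambda>n. (\<bar>?a n\<bar> powr p) powr (1 / p)) \<longlonglongrightarrow> 0 powr (1 / p)"
        using p by (intro tendsto_powr') auto
      then have "?a \<longlonglongrightarrow> 0"
        using p by (simp add: powr_powr tendsto_rabs_zero_iff)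
      moreover have "?a n = (\<integral>x. G n x * \<phi> x \<partial>lborel) - (\<integral>x. g x * \<phi> x \<partial>lborel)" for n
      proof -
        have "integrable lborel (\<lambda>x. G n x * \<phi> x)" "integrable lborel (\<lambda>x. g x * \<phi> x)"
          using GC[of n] gfin by (auto intro!: int simp: le_less_trans)
        then show ?thesis by (simp add: left_diff_distrib)
      qed
      ultimately show ?thesis using LIM_zero_cancel by auto
    qed
    ultimately have "l = (\<integral>x. g x * \<phi> x \<partial>lborel)" by (rule LIMSEQ_unique)
    then show ?thesis by (simp add: l_def)
  qed
  then show ?thesis using that[of g] gfin by simp
qed

text \<open>L^1 is not uniformly convex, but the variation asks for no derivative in L^1, only for a
  bound on pairings, and that bound passes from the quotients to their limit.\<close>

lemma shift_energy_bound_imp_partial_pairing_le: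
  fixes v \<phi> :: "'a::euclidean_space \<Rightarrow> real"
  assumes v[measurable]: "v \<in> borel_measurable borel"
    and fin: "(\<integral>\<^sup>+x. ennreal \<bar>v x\<bar> \<partial>lborel) < \<infinity>"
    and C: "0 \<le> C" and W: "\<And>h. shift_energy 1 v h \<le> ennreal (C * norm h)" and i: "i \<in> Basis"
    and \<phi>: "test_fun \<phi>" "\<And>x. \<bar>\<phi> x\<bar> \<le> 1"
  shows "\<bar>\<integral>x. v x * partial i \<phi> x \<partial>lborel\<bar> \<le> C"
proof -
  obtain R where R: "0 < R" "\<And>x. R < norm x \<Longrightarrow> \<phi> x = 0"
    using test_fun_bounds[OF \<phi>(1) i] by metis
  have s: "smooth \<phi>" using \<phi> by (simp add: test_fun_def)
  have [measurable]: "\<phi> \<in> borel_measurable borel"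
    using s smooth_continuous_on borel_measurable_continuous_onI by blast
  define f where "f = (\<lambda>n x. (v (x + (1 / Suc n) *\<^sub>R i) - v x) * Suc n)"
  have [measurable]: "f n \<in> borel_measurable borel" for n unfolding f_def by measurable
  have "(\<integral>\<^sup>+x. ennreal (\<bar>f n x\<bar> powr 1) \<partial>lborel) \<le> ennreal C" for n
    unfolding f_def by (rule shift_energy_difference_quotient[OF v C i]) (use W in simp)
  then have fC: "(\<integral>\<^sup>+x. ennreal \<bar>f n x\<bar> \<partial>lborel) \<le> ennreal C" for n by simp
  have "ennreal \<bar>\<integral>x. f n x * \<phi> x \<partial>lborel\<bar> \<le> ennreal C" for n
  proof -
    \<comment> \<open>With \<open>p = 1\<close> the constant contains the measure to the power 0,
      which is 1 only for a nonzero base.\<close>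
    have "measure lborel (cball (0::'a) R) \<noteq> 0" using content_cball_pos[OF R(1), of "0::'a"] by simp
    then have "ennreal \<bar>\<integral>x. f n x * \<phi> x \<partial>lborel\<bar> \<le> (\<integral>\<^sup>+x. ennreal \<bar>f n x\<bar> \<partial>lborel)"
      using pairing_powr_le[of 1 "f n" \<phi> 1 R] \<phi>(2) R by simp
    then show ?thesis using fC[of n] by (rule order_trans)
  qed
  then have "\<bar>\<integral>x. f n x * \<phi> x \<partial>lborel\<bar> \<le> C" for n using C by simp
  moreover have "(\<lambda>n. \<integral>x. f n x * \<phi> x \<partial>lborel) \<longlonglongrightarrow> - (\<integral>x. v x * partial i \<phi> x \<partial>lborel)"
    unfolding f_def by (rule difference_quotient_weak_limit[of 1]) (use fin \<phi> i in auto)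
  then have "(\<lambda>n. \<bar>\<integral>x. f n x * \<phi> x \<partial>lborel\<bar>) \<longlonglongrightarrow> \<bar>- (\<integral>x. v x * partial i \<phi> x \<partial>lborel)\<bar>"
    by (rule tendsto_rabs)
  ultimately have "\<bar>- (\<integral>x. v x * partial i \<phi> x \<partial>lborel)\<bar> \<le> C"
    by (intro LIMSEQ_le_const2) auto
  then show ?thesis by simp
qed

section \<open>Passage of the bounds to local limits\<close>

text \<open>Local convergence informs only about bounded sets; monotone convergence makes bounds
  uniform in the ball global.\<close>

lemma nn_integral_le_from_balls:
  fixes f :: "'a::euclidean_space \<Rightarrow> ennreal"
  assumes [measurable]: "f \<in> borel_measurable borel"
    and le: "\<And>n. (\<integral>\<^sup>+x. f x * indicator (cball 0 (real n)) x \<partial>lborel) \<le> c"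
  shows "(\<integral>\<^sup>+x. f x \<partial>lborel) \<le> c"
proof -
  have [measurable]: "cball (0::'a) (real n) \<in> sets borel" for n by simp
  have "(SUP n. f x * indicator (cball 0 (real n)) x) = f x" for x
  proof (rule antisym)
    show "(SUP n. f x * indicator (cball 0 (real n)) x) \<le> f x"
      by (intro SUP_least) (auto simp: indicator_def)
    obtain n where "norm x \<le> real n" using real_arch_simple by blast
    then have "f x = f x * indicator (cball 0 (real n)) x" by simp
    also have "\<dots> \<le> (SUP n. f x * indicator (cball 0 (real n)) x)" by (rule SUP_upper) simp
    finally show "f x \<le> (SUP n. f x * indicator (cball 0 (real n)) x)" .
  qed
  then have "(\<integral>\<^sup>+x. f x \<partial>lborel) = (\<integral>\<^sup>+x. (SUP n. f x * indicator (cball 0 (real n)) x) \<partial>lborel)" by simp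
  also have "\<dots> = (SUP n. \<integral>\<^sup>+x. f x * indicator (cball 0 (real n)) x \<partial>lborel)"
    by (intro nn_integral_monotone_convergence_SUP)
      (auto simp: incseq_def le_fun_def indicator_def intro!: mult_left_mono)
  also have "\<dots> \<le> c" by (intro SUP_least le)
  finally show ?thesis .
qed

text \<open>On each ball \<open>v\<close> is compared with \<open>w j\<close> and \<open>j\<close>
  tends to infinity: the comparison errors and 1 / b j vanish, leaving |h|^p. The three-term
  splitting costs the factor 4^(p-1).\<close>

lemma Lp_loc_limit_bounds:
  fixes w :: "nat \<Rightarrow> 'a::euclidean_space \<Rightarrow> real"
  assumes p: "1 \<le> p" and [measurable]: "\<And>j. w j \<in> borel_measurable borel" "v \<in> borel_measurable borel"
    and B: "\<And>j. (\<integral>\<^sup>+x. ennreal (\<bar>w j x\<bar> powr p) \<partial>lborel) \<le> ennreal B"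
    and b: "filterlim b at_top sequentially" "\<And>j. 0 < b j"
    and C: "0 \<le> C" "\<And>j h. shift_energy p (w j) h \<le> ennreal (C * (norm h + 1 / b j) powr p)"
    and conv: "\<And>E. compact E \<Longrightarrow> (\<lambda>j. \<integral>\<^sup>+x. ennreal (\<bar>w j x - v x\<bar> powr p) * indicator E x \<partial>lborel) \<longlonglongrightarrow> 0"
  shows "(\<integral>\<^sup>+x. ennreal (\<bar>v x\<bar> powr p) \<partial>lborel) < \<infinity>"
    "shift_energy p v h \<le> ennreal (4 powr (p - 1) * C * norm h powr p)"
proof -
  define q :: real where "q = 4 powr (p - 1)"
  have q: "0 \<le> q" by (simp add: q_def)
  define M where "M = (\<lambda>n. density lborel (indicator (cball (0::'a) (real n)) :: 'a \<Rightarrow> ennreal))"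
  have [measurable]: "cball (0::'a) (real n) \<in> sets borel" for n by simp
  have setsM[measurable_cong]: "sets (M n) = sets borel" for n by (simp add: M_def)
  have intM: "(\<integral>\<^sup>+x. f x \<partial>M n) = (\<integral>\<^sup>+x. f x * indicator (cball 0 (real n)) x \<partial>lborel)"
    if "f \<in> borel_measurable borel" for f n
    using that unfolding M_def by (subst nn_integral_density) (auto simp: mult.commute)
  have intM_le: "(\<integral>\<^sup>+x. f x \<partial>M n) \<le> (\<integral>\<^sup>+x. f x \<partial>lborel)" if "f \<in> borel_measurable borel" for f n
    unfolding intM[OF that] by (intro nn_integral_mono) (auto simp: indicator_def)
  define a where "a = (\<lambda>E j. \<integral>\<^sup>+x. ennreal (\<bar>w j x - v x\<bar> powr p) * indicator E x \<partial>lborel)"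
  have a0: "a (cball 0 s) \<longlonglongrightarrow> 0" for s unfolding a_def by (rule conv) simp
  have aM: "(\<integral>\<^sup>+x. ennreal (\<bar>v x - w j x\<bar> powr p) \<partial>M n) = a (cball 0 (real n)) j" for n j
    unfolding a_def by (subst intM) (auto simp: abs_minus_commute)
  have "(\<integral>\<^sup>+x. ennreal (\<bar>v x\<bar> powr p) \<partial>lborel) \<le> ennreal q * ennreal B"
  proof (rule nn_integral_le_from_balls)
    fix n
    have le: "(\<integral>\<^sup>+x. ennreal (\<bar>v x\<bar> powr p) \<partial>M n) \<le> ennreal q * (a (cball 0 (real n)) j + ennreal B + 0)" for j
    proof -
      have "(\<integral>\<^sup>+x. ennreal (\<bar>v x\<bar> powr p) \<partial>M n) = (\<integral>\<^sup>+x. ennreal (\<bar>(v x - w j x) + w j x + 0\<bar> powr p) \<partial>M n)"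
        by simp
      also have "\<dots> \<le> ennreal q * ((\<integral>\<^sup>+x. ennreal (\<bar>v x - w j x\<bar> powr p) \<partial>M n)
          + (\<integral>\<^sup>+x. ennreal (\<bar>w j x\<bar> powr p) \<partial>M n) + (\<integral>\<^sup>+x. ennreal (\<bar>0\<bar> powr p) \<partial>M n))"
        unfolding q_def by (rule nn_integral_abs_add3_powr_le[OF p]) measurable
      also have "\<dots> \<le> ennreal q * (a (cball 0 (real n)) j + ennreal B + 0)"
        unfolding aM by (intro mult_left_mono add_mono order_trans[OF intM_le B]) auto
      finally show ?thesis .
    qed
    have "(\<lambda>j. ennreal q * (a (cball 0 (real n)) j + ennreal B + 0)) \<longlonglongrightarrow> ennreal q * (0 + ennreal B + 0)"
      by (intro tendsto_mult_ennreal tendsto_add a0 tendsto_const) auto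
    then have "(\<integral>\<^sup>+x. ennreal (\<bar>v x\<bar> powr p) \<partial>M n) \<le> ennreal q * (0 + ennreal B + 0)"
      by (rule LIMSEQ_le_const) (use le in blast)
    then show "(\<integral>\<^sup>+x. ennreal (\<bar>v x\<bar> powr p) * indicator (cball 0 (real n)) x \<partial>lborel) \<le> ennreal q * ennreal B"
      by (subst (asm) intM) auto
  qed measurable
  also have "\<dots> < \<infinity>" by (simp add: ennreal_mult_less_top)
  finally show "(\<integral>\<^sup>+x. ennreal (\<bar>v x\<bar> powr p) \<partial>lborel) < \<infinity>" .
  show "shift_energy p v h \<le> ennreal (4 powr (p - 1) * C * norm h powr p)"
    unfolding shift_energy_def
  proof (rule nn_integral_le_from_balls)
    fix n
    let ?s = "real n + norm h"
    \<comment> \<open>The shift carries the ball of radius \<open>n\<close> into the ball of radius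
      n + |h|, on which convergence is also known.\<close>
    have shift: "(\<integral>\<^sup>+x. ennreal (\<bar>v (x + h) - w j (x + h)\<bar> powr p) \<partial>M n) \<le> a (cball 0 ?s) j" for j
    proof -
      let ?f = "\<lambda>x. ennreal (\<bar>w j x - v x\<bar> powr p) * indicator (cball 0 ?s) x"
      have [measurable]: "cball (0::'a) ?s \<in> sets borel" by simp
      have "(\<integral>\<^sup>+x. ennreal (\<bar>v (x + h) - w j (x + h)\<bar> powr p) \<partial>M n)
          = (\<integral>\<^sup>+x. ennreal (\<bar>v (x + h) - w j (x + h)\<bar> powr p) * indicator (cball 0 (real n)) x \<partial>lborel)"
        by (rule intM) measurable
      also have "\<dots> \<le> (\<integral>\<^sup>+x. ?f (x + h) \<partial>lborel)"
      proof (intro nn_integral_mono)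
        fix x
        show "ennreal (\<bar>v (x + h) - w j (x + h)\<bar> powr p) * indicator (cball 0 (real n)) x \<le> ?f (x + h)"
          using norm_triangle_ineq[of x h] by (auto simp: indicator_def abs_minus_commute)
      qed
      also have "\<dots> = (\<integral>\<^sup>+x. ?f x \<partial>lborel)"
        by (rule nn_integral_lborel_translate) measurable
      finally show ?thesis by (simp add: a_def)
    qed
    have le: "(\<integral>\<^sup>+x. ennreal (\<bar>v (x + h) - v x\<bar> powr p) \<partial>M n)
        \<le> ennreal q * (a (cball 0 ?s) j + ennreal (C * (norm h + 1 / b j) powr p) + a (cball 0 (real n)) j)" for j
    proof -
      have "(\<integral>\<^sup>+x. ennreal (\<bar>v (x + h) - v x\<bar> powr p) \<partial>M n)
          = (\<integral>\<^sup>+x. ennreal (\<bar>(v (x + h) - w j (x + h)) + (w j (x + h) - w j x) + (w j x - v x)\<bar> powr p) \<partial>M n)"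
        by simp
      also have "\<dots> \<le> ennreal q * ((\<integral>\<^sup>+x. ennreal (\<bar>v (x + h) - w j (x + h)\<bar> powr p) \<partial>M n)
          + (\<integral>\<^sup>+x. ennreal (\<bar>w j (x + h) - w j x\<bar> powr p) \<partial>M n) + (\<integral>\<^sup>+x. ennreal (\<bar>w j x - v x\<bar> powr p) \<partial>M n))"
        unfolding q_def by (rule nn_integral_abs_add3_powr_le[OF p]) measurable
      also have "\<dots> \<le> ennreal q * (a (cball 0 ?s) j + ennreal (C * (norm h + 1 / b j) powr p) + a (cball 0 (real n)) j)"
      proof (intro mult_left_mono add_mono shift)
        show "(\<integral>\<^sup>+x. ennreal (\<bar>w j (x + h) - w j x\<bar> powr p) \<partial>M n) \<le> ennreal (C * (norm h + 1 / b j) powr p)"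
          using C(2)[of j h] unfolding shift_energy_def by (intro order_trans[OF intM_le]) auto
        show "(\<integral>\<^sup>+x. ennreal (\<bar>w j x - v x\<bar> powr p) \<partial>M n) \<le> a (cball 0 (real n)) j"
          by (subst abs_minus_commute) (simp add: aM)
      qed simp
      finally show ?thesis .
    qed
    have "(\<lambda>j. 1 / b j) \<longlonglongrightarrow> 0" using b(1) by (intro tendsto_divide_0[OF tendsto_const] filterlim_at_top_imp_at_infinity)
    then have "(\<lambda>j. ennreal (C * (norm h + 1 / b j) powr p)) \<longlonglongrightarrow> ennreal (C * (norm h + 0) powr p)"
      using p b(2) by (intro tendsto_ennrealI tendsto_mult tendsto_const tendsto_powr' tendsto_add)
        (auto intro!: always_eventually add_nonneg_nonneg simp: less_imp_le)
    then have "(\<lambda>j. ennreal q * (a (cball 0 ?s) j + ennreal (C * (norm h + 1 / b j) powr p) + a (cball 0 (real n)) j))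
        \<longlonglongrightarrow> ennreal q * (0 + ennreal (C * (norm h + 0) powr p) + 0)"
      by (intro tendsto_mult_ennreal tendsto_add a0 tendsto_const) auto
    then have "(\<integral>\<^sup>+x. ennreal (\<bar>v (x + h) - v x\<bar> powr p) \<partial>M n) \<le> ennreal q * (0 + ennreal (C * (norm h + 0) powr p) + 0)"
      by (rule LIMSEQ_le_const) (use le in blast)
    also have "\<dots> = ennreal (4 powr (p - 1) * C * norm h powr p)"
      using C(1) by (simp add: q_def ennreal_mult[symmetric] mult.assoc)
    finally show "(\<integral>\<^sup>+x. ennreal (\<bar>v (x + h) - v x\<bar> powr p) * indicator (cball 0 (real n)) x \<partial>lborel)
        \<le> ennreal (4 powr (p - 1) * C * norm h powr p)"
      by (subst (asm) intM) auto
  qed measurable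
qed

lemma integral_lebesgue_eq_lborel:
  fixes v v' \<psi> :: "'a::euclidean_space \<Rightarrow> real"
  assumes "v \<in> borel_measurable lebesgue" "v' \<in> borel_measurable borel" "AE x in lborel. v x = v' x"
    and [measurable]: "\<psi> \<in> borel_measurable borel"
  shows "(\<integral>x. v x * \<psi> x \<partial>lebesgue) = (\<integral>x. v' x * \<psi> x \<partial>lborel)"
proof -
  have [measurable]: "v \<in> borel_measurable lebesgue" "v' \<in> borel_measurable lborel" using assms by auto
  have [measurable]: "\<psi> \<in> borel_measurable lebesgue" "v' \<in> borel_measurable lebesgue"
    using assms by (auto intro: measurable_completion)
  have "(\<integral>x. v x * \<psi> x \<partial>lebesgue) = (\<integral>x. v' x * \<psi> x \<partial>lebesgue)"
    using AE_completion[OF assms(3)] by (intro integral_cong_AE) auto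
  also have "\<dots> = (\<integral>x. v' x * \<psi> x \<partial>lborel)" by (rule integral_completion) measurable
  finally show ?thesis .
qed

lemma test_fun_partial_pairing_integrable:
  fixes v \<phi> :: "'a::euclidean_space \<Rightarrow> real"
  assumes p: "1 \<le> p" and [measurable]: "v \<in> borel_measurable borel"
    and fin: "(\<integral>\<^sup>+x. ennreal (\<bar>v x\<bar> powr p) \<partial>lborel) < \<infinity>"
    and \<phi>: "test_fun \<phi>" and i: "i \<in> Basis"
  shows "integrable lborel (\<lambda>x. v x * partial i \<phi> x)" "partial i \<phi> \<in> borel_measurable borel"
    "\<phi> \<in> borel_measurable borel"
proof -
  obtain R B where RB: "\<And>x. \<bar>partial i \<phi> x\<bar> \<le> B" "\<And>x. R < norm x \<Longrightarrow> partial i \<phi> x = 0"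
    using test_fun_bounds[OF \<phi> i] by metis
  have s: "smooth \<phi>" using \<phi> by (simp add: test_fun_def)
  show m: "partial i \<phi> \<in> borel_measurable borel" "\<phi> \<in> borel_measurable borel"
    using s smooth_partial[OF s i] smooth_continuous_on borel_measurable_continuous_onI by blast+
  show "integrable lborel (\<lambda>x. v x * partial i \<phi> x)"
    by (rule pairing_integrable[OF p _ m(1) RB fin]) measurable
qed

text \<open>Works with the Borel representative \<open>v'\<close> and transfers the result to
  \<open>v\<close>, since \<open>Lp_mem\<close> and the pairings see only almost everywhere
  classes.\<close>

lemma shift_energy_bound_imp_Xp:
  fixes v v' :: "'a::euclidean_space \<Rightarrow> real"
  assumes p: "1 \<le> p" and v: "v \<in> borel_measurable lebesgue" and v'[measurable]: "v' \<in> borel_measurable borel"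
    and eq: "AE x in lborel. v x = v' x"
    and fin: "(\<integral>\<^sup>+x. ennreal (\<bar>v' x\<bar> powr p) \<partial>lborel) < \<infinity>"
    and C: "0 \<le> C" "\<And>h. shift_energy p v' h \<le> ennreal (C * norm h powr p)"
  shows "Xp p v"
proof -
  have "(\<integral>\<^sup>+x. ennreal (\<bar>v x\<bar> powr p) \<partial>lebesgue) = (\<integral>\<^sup>+x. ennreal (\<bar>v' x\<bar> powr p) \<partial>lborel)"
    unfolding nn_integral_completion using eq by (intro nn_integral_cong_AE) auto
  then have mem: "Lp_mem p v" using v fin by (simp add: Lp_mem_def)
  show ?thesis
  proof (cases "1 < p")
    case True
    have "\<exists>g. Lp_mem p g \<and> (\<forall>\<phi>. test_fun \<phi> \<longrightarrow>
        (\<integral>x. v x * partial i \<phi> x \<partial>lebesgue) = - (\<integral>x. g x * \<phi> x \<partial>lebesgue))" if i: "i \<in> Basis" for i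
    proof -
      obtain g where g[measurable]: "g \<in> borel_measurable borel"
        and gfin: "(\<integral>\<^sup>+x. ennreal (\<bar>g x\<bar> powr p) \<partial>lborel) < \<infinity>"
        and wd: "\<And>\<phi>. test_fun \<phi> \<Longrightarrow> (\<integral>x. v' x * partial i \<phi> x \<partial>lborel) = - (\<integral>x. g x * \<phi> x \<partial>lborel)"
        using shift_energy_bound_imp_weak_derivative[OF True v' fin C i] by metis
      have gl: "g \<in> borel_measurable lebesgue" by (rule measurable_completion) simp
      show ?thesis
      proof (intro exI[of _ g] conjI allI impI)
        show "Lp_mem p g" using gl gfin by (simp add: Lp_mem_def nn_integral_completion)
        fix \<phi> :: "'a \<Rightarrow> real" assume \<phi>: "test_fun \<phi>"
        show "(\<integral>x. v x * partial i \<phi> x \<partial>lebesgue) = - (\<integral>x. g x * \<phi> x \<partial>lebesgue)"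
          using integral_lebesgue_eq_lborel[OF v v' eq test_fun_partial_pairing_integrable(2)[OF p v' fin \<phi> i]]
            integral_lebesgue_eq_lborel[OF gl g _ test_fun_partial_pairing_integrable(3)[OF p v' fin \<phi> i]]
            wd[OF \<phi>] by simp
      qed
    qed
    then show ?thesis using True mem by (simp add: Xp_def W1p_def)
  next
    case False
    then have p1: "p = 1" using p by simp
    have "(\<integral>x. v x * divergence \<Phi> x \<partial>lebesgue) \<le> DIM('a) * C"
      if \<Phi>: "\<And>i. i \<in> Basis \<Longrightarrow> test_fun (\<lambda>y. \<Phi> y \<bullet> i)" "\<And>x. norm (\<Phi> x) \<le> 1" for \<Phi> :: "'a \<Rightarrow> 'a"
    proof -
      note tf = test_fun_partial_pairing_integrable[OF p v' fin \<Phi>(1)]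
      have [measurable]: "divergence \<Phi> \<in> borel_measurable borel"
        unfolding divergence_def[abs_def] by (intro borel_measurable_sum tf(2))
      have "(\<integral>x. v x * divergence \<Phi> x \<partial>lebesgue) = (\<integral>x. v' x * divergence \<Phi> x \<partial>lborel)"
        by (rule integral_lebesgue_eq_lborel[OF v v' eq]) measurable
      also have "\<dots> = (\<integral>x. (\<Sum>i\<in>Basis. v' x * partial i (\<lambda>y. \<Phi> y \<bullet> i) x) \<partial>lborel)"
        by (simp add: divergence_def sum_distrib_left)
      also have "\<dots> = (\<Sum>i\<in>Basis. \<integral>x. v' x * partial i (\<lambda>y. \<Phi> y \<bullet> i) x \<partial>lborel)"
        by (intro Bochner_Integration.integral_sum tf(1))
      \<comment> \<open>Each component of the field is a test function bounded by 1; summing over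
        the basis gives the variation bound \<open>DIM('a) * C\<close>.\<close>
      also have "\<dots> \<le> (\<Sum>i\<in>(Basis::'a set). C)"
      proof (intro sum_mono)
        fix i :: 'a assume i: "i \<in> Basis"
        have "\<bar>\<integral>x. v' x * partial i (\<lambda>y. \<Phi> y \<bullet> i) x \<partial>lborel\<bar> \<le> C"
        proof (rule shift_energy_bound_imp_partial_pairing_le[OF v' _ C(1) _ i \<Phi>(1)[OF i]])
          show "(\<integral>\<^sup>+x. ennreal \<bar>v' x\<bar> \<partial>lborel) < \<infinity>" using fin p1 by simp
          show "shift_energy 1 v' h \<le> ennreal (C * norm h)" for h using C(2)[of h] p1 by simp
          show "\<bar>\<Phi> x \<bullet> i\<bar> \<le> 1" for x using Basis_le_norm[OF i, of "\<Phi> x"] \<Phi>(2)[of x] by linarith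
        qed
        then show "(\<integral>x. v' x * partial i (\<lambda>y. \<Phi> y \<bullet> i) x \<partial>lborel) \<le> C" by linarith
      qed
      finally show ?thesis by simp
    qed
    then have "\<exists>C. \<forall>\<Phi>::'a \<Rightarrow> 'a. (\<forall>i\<in>Basis. test_fun (\<lambda>y. \<Phi> y \<bullet> i)) \<and> (\<forall>x. norm (\<Phi> x) \<le> 1) \<longrightarrow>
        (\<integral>x. v x * divergence \<Phi> x \<partial>lebesgue) \<le> C"
      by (intro exI[of _ "DIM('a) * C"]) blast
    then show ?thesis using mem p1 by (simp add: Xp_def BV_def)
  qed
qed

section \<open>Borel representatives in the nonlocal energy\<close>

text \<open>An invertible affine map pulls null sets back to null sets. This is what allows
  \<open>K\<close> to be replaced by a Borel representative inside the inner integral, for each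
  fixed \<open>x\<close>.\<close>

lemma AE_lborel_affine:
  fixes x :: "'a::euclidean_space"
  assumes "AE z in lborel. P z" and b: "b \<noteq> 0"
  shows "AE y in lborel. P (b *\<^sub>R (x - y))"
proof -
  let ?T = "\<lambda>y. b *\<^sub>R x + (- b) *\<^sub>R y"
  have b': "- b \<noteq> 0" using b by simp
  have "AE z in density (distr lborel borel ?T) (\<lambda>_. ennreal (\<bar>- b\<bar> ^ DIM('a))). P z"
    unfolding lborel_affine[OF b', symmetric] by (rule assms(1))
  then have "AE z in distr lborel borel ?T. P z"
    using b by (subst (asm) AE_density) auto
  then have "AE y in lborel. P (?T y)" by (rule AE_distrD[rotated]) measurable
  then show ?thesis by (simp add: scaleR_diff_right)
qed

lemma nonlocal_energy_lebesgue:
  fixes u U :: "'a::euclidean_space \<Rightarrow> real" and K K' :: "'a \<Rightarrow> ennreal"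
  assumes [measurable]: "U \<in> borel_measurable borel" "K' \<in> borel_measurable borel"
    and u: "AE x in lborel. u x = U x" and K: "AE x in lborel. K x = K' x" and b: "0 < b"
  shows "(\<integral>\<^sup>+x. \<integral>\<^sup>+y. ennreal (\<bar>u x - u y\<bar> powr p) * (ennreal (b ^ DIM('a)) * K (b *\<^sub>R (x - y))) \<partial>lebesgue \<partial>lebesgue)
    = (\<integral>\<^sup>+z. K' z * shift_energy p U (z /\<^sub>R b) \<partial>lborel)"
proof -
  define G where "G = (\<lambda>w. ennreal (b ^ DIM('a)) * K' (b *\<^sub>R w))"
  have [measurable]: "G \<in> borel_measurable borel" unfolding G_def by measurable
  have "(\<integral>\<^sup>+x. \<integral>\<^sup>+y. ennreal (\<bar>u x - u y\<bar> powr p) * (ennreal (b ^ DIM('a)) * K (b *\<^sub>R (x - y))) \<partial>lebesgue \<partial>lebesgue)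
      = (\<integral>\<^sup>+x. \<integral>\<^sup>+y. ennreal (\<bar>U x - U y\<bar> powr p) * G (x - y) \<partial>lborel \<partial>lborel)"
    unfolding nn_integral_completion
  proof (rule nn_integral_cong_AE, use u in eventually_elim)
    fix x assume x: "u x = U x"
    show "(\<integral>\<^sup>+y. ennreal (\<bar>u x - u y\<bar> powr p) * (ennreal (b ^ DIM('a)) * K (b *\<^sub>R (x - y))) \<partial>lborel)
        = (\<integral>\<^sup>+y. ennreal (\<bar>U x - U y\<bar> powr p) * G (x - y) \<partial>lborel)"
    proof (rule nn_integral_cong_AE)
      have "AE y in lborel. K (b *\<^sub>R (x - y)) = K' (b *\<^sub>R (x - y))"
        using AE_lborel_affine[OF K] b by simp
      then show "AE y in lborel. ennreal (\<bar>u x - u y\<bar> powr p) * (ennreal (b ^ DIM('a)) * K (b *\<^sub>R (x - y)))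
          = ennreal (\<bar>U x - U y\<bar> powr p) * G (x - y)"
        using u by eventually_elim (simp add: x G_def)
    qed
  qed
  also have "\<dots> = (\<integral>\<^sup>+w. G w * shift_energy p U w \<partial>lborel)"
    by (rule nonlocal_energy_eq_shift_energy) measurable
  \<comment> \<open>The factor b^N of the rescaled kernel is the Jacobian of z = b w.\<close>
  also have "\<dots> = (\<integral>\<^sup>+w. ennreal (\<bar>b\<bar> ^ DIM('a)) * (K' (b *\<^sub>R w) * shift_energy p U ((b *\<^sub>R w) /\<^sub>R b)) \<partial>lborel)"
    using b by (simp add: G_def mult.assoc)
  also have "\<dots> = (\<integral>\<^sup>+z. K' z * shift_energy p U (z /\<^sub>R b) \<partial>lborel)"
    using b by (intro nn_integral_lborel_scale) auto
  finally show ?thesis .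
qed

section \<open>Precompactness and regularity of limits\<close>

lemma ennreal_finite_obtain:
  assumes "x < \<infinity>"
  obtains r where "0 \<le> r" "x = ennreal r"
  using assms by (cases x) auto

text \<open>Precompactness of the set of all \<open>u k\<close> tests arbitrary index maps, which
  may repeat values; either some value recurs infinitely often or the indices tend to
  infinity.\<close>

lemma bounded_subseq_or_filterlim:
  fixes \<sigma> :: "nat \<Rightarrow> nat"
  obtains (const) r m where "strict_mono (r :: nat \<Rightarrow> nat)" "\<And>j. \<sigma> (r j) = m"
    | (infinite) "filterlim \<sigma> at_top sequentially"
proof (cases "\<exists>m. infinite {j. \<sigma> j = m}")
  case True
  then obtain m where m: "infinite {j. \<sigma> j = m}" by blast
  have "\<sigma> (enumerate {j. \<sigma> j = m} j) = m" for j using enumerate_in_set[OF m, of j] by simp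
  then show ?thesis using const[OF strict_mono_enumerate[OF m]] by blast
next
  case False
  have "\<forall>\<^sub>F j in sequentially. n \<le> \<sigma> j" for n
  proof -
    have "{j. \<not> n \<le> \<sigma> j} = (\<Union>m<n. {j. \<sigma> j = m})" by auto
    then have "finite {j. \<not> n \<le> \<sigma> j}" using False by simp
    then show ?thesis by (simp add: eventually_cofinite[symmetric] cofinite_eq_sequentially)
  qed
  then show ?thesis using infinite by (simp add: filterlim_at_top)
qed

text \<open>A recurring index gives a constant subsequence, whose limit is that member. Otherwise 1
  / b tends to 0 along the indices, which supplies the equicontinuity of the tail.\<close>

lemma shift_energy_growth_imp_locally_precompact:
  fixes u U :: "nat \<Rightarrow> 'a::euclidean_space \<Rightarrow> real"
  assumes p: "1 \<le> p" and u: "\<And>k. Lp_mem p (u k)" and U[measurable]: "\<And>k. U k \<in> borel_measurable borel"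
    and eq: "\<And>k. AE x in lborel. u k x = U k x"
    and B: "\<And>k. (\<integral>\<^sup>+x. ennreal (\<bar>U k x\<bar> powr p) \<partial>lborel) \<le> ennreal B" "0 \<le> B"
    and b: "filterlim b at_top sequentially" "\<And>k. 0 < b k"
    and C: "0 \<le> C" "\<And>k h. shift_energy p (U k) h \<le> ennreal (C * (norm h + 1 / b k) powr p)"
  shows "locally_precompact_Lp p u"
  unfolding locally_precompact_Lp_def
proof (intro allI impI)
  fix E :: "'a set" and \<sigma> :: "nat \<Rightarrow> nat" assume E: "compact E"
  have [measurable]: "E \<in> sets borel" using E by (simp add: borel_compact)
  show "\<exists>r g. strict_mono r \<and> Lp_mem_on p E g \<and> (\<lambda>j. Lp_dist_on p E (u (\<sigma> (r j))) g) \<longlonglongrightarrow> 0"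
  proof (cases rule: bounded_subseq_or_filterlim[of \<sigma>])
    case (const r m)
    have "Lp_mem_on p E (u m)"
    proof -
      have "(\<integral>\<^sup>+x\<in>E. ennreal (\<bar>u m x\<bar> powr p) \<partial>lebesgue) \<le> (\<integral>\<^sup>+x. ennreal (\<bar>u m x\<bar> powr p) \<partial>lebesgue)"
        by (intro nn_integral_mono) (auto simp: indicator_def)
      then show ?thesis
        using u[of m] by (auto simp: Lp_mem_def Lp_mem_on_def measurable_restrict_space1 le_less_trans)
    qed
    moreover have "Lp_dist_on p E (u (\<sigma> (r j))) (u m) = 0" for j
      using const(2) by (simp add: Lp_dist_on_def)
    ultimately show ?thesis using const(1) by (intro exI[of _ r] exI[of _ "u m"]) simp
  next
    case infinite
    have equi: "\<exists>d>0. \<exists>N. \<forall>j\<ge>N. \<forall>h. norm h \<le> d \<longrightarrow> shift_energy p (U (\<sigma> j)) h \<le> ennreal e" if e: "0 < e" for e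
    proof -
      \<comment> \<open>Then C s^p <= e, and \<open>s\<close> is shared equally between the shift
        and 1 / b.\<close>
      define s where "s = (e / (C + 1)) powr (1 / p)"
      have s: "0 < s" using e C(1) by (simp add: s_def)
      have sp: "C * s powr p \<le> e"
      proof -
        have "s powr p = e / (C + 1)" using e C(1) p by (simp add: s_def powr_powr)
        then have "(C + 1) * s powr p = e" using C(1) by simp
        moreover have "C * s powr p \<le> (C + 1) * s powr p" by (intro mult_right_mono) auto
        ultimately show ?thesis by simp
      qed
      have "filterlim (\<lambda>j. b (\<sigma> j)) at_top sequentially" by (rule filterlim_compose[OF b(1) infinite])
      then have "\<forall>\<^sub>F j in sequentially. 2 / s \<le> b (\<sigma> j)" by (simp add: filterlim_at_top)
      then obtain N where N: "\<And>j. N \<le> j \<Longrightarrow> 2 / s \<le> b (\<sigma> j)" unfolding eventually_sequentially by blast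
      show ?thesis
      proof (intro exI[of _ "s / 2"] exI[of _ N] conjI allI impI)
        show "0 < s / 2" using s by simp
        fix j h assume j: "N \<le> j" and h: "norm (h::'a) \<le> s / 2"
        have "1 / b (\<sigma> j) \<le> s / 2" using N[OF j] s b(2)[of "\<sigma> j"] by (simp add: field_simps)
        then have "norm h + 1 / b (\<sigma> j) \<le> s / 2 + s / 2" using h by (rule add_mono[rotated])
        then have "norm h + 1 / b (\<sigma> j) \<le> s" by simp
        then have "(norm h + 1 / b (\<sigma> j)) powr p \<le> s powr p"
          using p b(2)[of "\<sigma> j"] by (intro powr_mono2) auto
        then have "C * (norm h + 1 / b (\<sigma> j)) powr p \<le> e"
          using mult_left_mono[OF _ C(1)] sp order_trans by blast
        then show "shift_energy p (U (\<sigma> j)) h \<le> ennreal e"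
          using C(2)[of "\<sigma> j" h] by (meson ennreal_leI order_trans)
      qed
    qed
    obtain r g where r: "strict_mono (r :: nat \<Rightarrow> nat)" and g[measurable]: "g \<in> borel_measurable borel"
      and conv: "(\<lambda>j. \<integral>\<^sup>+x. ennreal (\<bar>U (\<sigma> (r j)) x - g x\<bar> powr p) * indicator E x \<partial>lborel) \<longlonglongrightarrow> 0"
      using Frechet_Kolmogorov[where w = "\<lambda>j. U (\<sigma> j)", OF p U B equi E] by blast
    have dist: "Lp_dist_on p E (u k) g = (\<integral>\<^sup>+x. ennreal (\<bar>U k x - g x\<bar> powr p) * indicator E x \<partial>lborel)" for k
      unfolding Lp_dist_on_def nn_integral_completion using eq[of k] by (intro nn_integral_cong_AE) auto
    \<comment> \<open>The criterion yields only a measurable limit; integrability follows by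
      comparison with one member at distance less than 1.\<close>
    have "(\<integral>\<^sup>+x\<in>E. ennreal (\<bar>g x\<bar> powr p) \<partial>lebesgue) < \<infinity>"
    proof -
      have "\<forall>\<^sub>F j in sequentially. (\<integral>\<^sup>+x. ennreal (\<bar>U (\<sigma> (r j)) x - g x\<bar> powr p) * indicator E x \<partial>lborel) < 1"
        using conv by (intro order_tendstoD(2)) auto
      then obtain j where j: "(\<integral>\<^sup>+x. ennreal (\<bar>U (\<sigma> (r j)) x - g x\<bar> powr p) * indicator E x \<partial>lborel) < 1"
        unfolding eventually_sequentially by blast
      let ?q = "2 powr (p - 1)" and ?w = "U (\<sigma> (r j))"
      have "(\<integral>\<^sup>+x\<in>E. ennreal (\<bar>g x\<bar> powr p) \<partial>lebesgue)
          \<le> (\<integral>\<^sup>+x. ennreal ?q * (ennreal (\<bar>?w x - g x\<bar> powr p) * indicator E x + ennreal (\<bar>?w x\<bar> powr p)) \<partial>lborel)"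
        unfolding nn_integral_completion
      proof (intro nn_integral_mono)
        fix x
        have "\<bar>g x\<bar> powr p \<le> ?q * (\<bar>?w x - g x\<bar> powr p + \<bar>?w x\<bar> powr p)"
          using abs_diff_powr_le[OF p, of "?w x" "?w x - g x"] by (simp add: add.commute)
        then have "ennreal (\<bar>g x\<bar> powr p) \<le> ennreal ?q * (ennreal (\<bar>?w x - g x\<bar> powr p) + ennreal (\<bar>?w x\<bar> powr p))"
          by (simp add: ennreal_plus[symmetric] ennreal_mult[symmetric] ennreal_leI del: ennreal_plus)
        then show "ennreal (\<bar>g x\<bar> powr p) * indicator E x
            \<le> ennreal ?q * (ennreal (\<bar>?w x - g x\<bar> powr p) * indicator E x + ennreal (\<bar>?w x\<bar> powr p))"
          by (cases "x \<in> E") auto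
      qed
      also have "\<dots> = ennreal ?q * ((\<integral>\<^sup>+x. ennreal (\<bar>?w x - g x\<bar> powr p) * indicator E x \<partial>lborel)
          + (\<integral>\<^sup>+x. ennreal (\<bar>?w x\<bar> powr p) \<partial>lborel))"
        by (simp add: nn_integral_cmult nn_integral_add)
      also have "\<dots> \<le> ennreal ?q * (1 + ennreal B)"
        using j B(1) by (intro mult_left_mono add_mono) auto
      also have "\<dots> < \<infinity>" by (simp add: ennreal_mult_less_top)
      finally show ?thesis .
    qed
    moreover have "g \<in> borel_measurable lebesgue" by (rule measurable_completion) simp
    ultimately have "Lp_mem_on p E g" by (simp add: Lp_mem_on_def measurable_restrict_space1)
    then show ?thesis using r conv dist by (intro exI[of _ r] exI[of _ g]) simp
  qed
qed

theorem theorem1p3: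
  fixes K :: "'a::euclidean_space \<Rightarrow> ennreal" and \<beta> :: "real \<Rightarrow> real" and p :: real
    and t :: "nat \<Rightarrow> real" and u :: "nat \<Rightarrow> 'a \<Rightarrow> real"
  assumes p: "1 \<le> p"
    and K_meas: "K \<in> borel_measurable lebesgue"
    and K_nonzero: "\<not> (AE x in lebesgue. K x = 0)"
    and K_loc: "\<forall>E. compact E \<longrightarrow> (\<integral>\<^sup>+x\<in>E. ennreal (norm x powr p) * K x \<partial>lebesgue) < \<infinity>"
    and beta_meas: "\<beta> \<in> borel_measurable borel"
    and beta_pos: "\<forall>s\<in>{0<..<1}. \<beta> s > 0"
    and phi_pos: "\<forall>s\<in>{0<..<1}. phiK K \<beta> p s > 0"
    and K_L1: "(\<integral>\<^sup>+x. ennreal (norm x powr p) * K x \<partial>lebesgue) < \<infinity>"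
    and beta_lim: "filterlim \<beta> at_top (at_right 0)"
    and t_in: "\<forall>k. t k \<in> {0<..<1}"
    and t_lim: "t \<longlonglongrightarrow> 0"
    and u_Lp: "\<forall>k. Lp_mem p (u k)"
    and bound: "(SUP k. ennreal (Lp_norm p (u k)) + Fnl K \<beta> p (t k) (u k)) < \<infinity>"
  shows "locally_precompact_Lp p u \<and>
    (\<forall>r v. strict_mono r \<and> Lp_loc p v \<and>
        (\<forall>E. compact E \<longrightarrow> (\<lambda>j. Lp_dist_on p E (u (r j)) v) \<longlonglongrightarrow> 0) \<longrightarrow> Xp p v)"
proof -
  obtain K' where K'[measurable]: "K' \<in> borel_measurable borel" and KK': "AE x in lborel. K x = K' x"
    using completion_ex_borel_measurable[OF K_meas] by auto
  have K'_nz: "\<not> (AE x in lborel. K' x = 0)"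
  proof
    assume "AE x in lborel. K' x = 0"
    then have "AE x in lborel. K x = 0" using KK' by eventually_elim simp
    then show False using K_nonzero AE_completion by blast
  qed
  have "\<exists>g\<in>borel_measurable lborel. AE x in lborel. u k x = g x" for k
    using u_Lp by (intro completion_ex_borel_measurable_real) (simp add: Lp_mem_def)
  then have "\<exists>g. g \<in> borel_measurable borel \<and> (AE x in lborel. u k x = g x)" for k
    by (simp add: Bex_def)
  then obtain U where U[measurable]: "\<And>k. U k \<in> borel_measurable borel"
    and uU: "\<And>k. AE x in lborel. u k x = U k x" by metis
  define b where "b = (\<lambda>k. \<beta> (t k))"
  have b0: "0 < b k" for k using beta_pos t_in by (simp add: b_def)
  have "filterlim t (at_right 0) sequentially"
  proof -
    have "0 < t k" for k using t_in by simp
    then show ?thesis using t_lim by (simp add: tendsto_imp_filterlim_at_right)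
  qed
  then have b_lim: "filterlim b at_top sequentially"
    unfolding b_def by (rule filterlim_compose[OF beta_lim])
  obtain S where S: "0 \<le> S" "(SUP k. ennreal (Lp_norm p (u k)) + Fnl K \<beta> p (t k) (u k)) = ennreal S"
    by (rule ennreal_finite_obtain[OF bound])
  have sum_le: "ennreal (Lp_norm p (u k)) + Fnl K \<beta> p (t k) (u k) \<le> ennreal S" for k
    unfolding S(2)[symmetric] by (rule SUP_upper) simp
  have norm_le: "ennreal (Lp_norm p (u k)) \<le> ennreal S" and F_le: "Fnl K \<beta> p (t k) (u k) \<le> ennreal S" for k
    by (rule order_trans[OF _ sum_le[of k]]; simp)+
  have UB: "(\<integral>\<^sup>+x. ennreal (\<bar>U k x\<bar> powr p) \<partial>lborel) \<le> ennreal (S powr p)" for k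
  proof -
    have eq: "(\<integral>\<^sup>+x. ennreal (\<bar>U k x\<bar> powr p) \<partial>lborel) = (\<integral>\<^sup>+x. ennreal (\<bar>u k x\<bar> powr p) \<partial>lebesgue)"
      unfolding nn_integral_completion using uU[of k] by (intro nn_integral_cong_AE) auto
    \<comment> \<open>\<open>enn2real\<close> sends \<infinity> to 0, so \<open>Lp_norm\<close>
      controls the integral only once \<open>Lp_mem\<close> has made it finite.\<close>
    obtain I where I: "0 \<le> I" "(\<integral>\<^sup>+x. ennreal (\<bar>u k x\<bar> powr p) \<partial>lebesgue) = ennreal I"
      using u_Lp ennreal_finite_obtain unfolding Lp_mem_def by blast
    have "I powr (1 / p) \<le> S" using norm_le[of k] S(1) I by (simp add: Lp_norm_def)
    then have "(I powr (1 / p)) powr p \<le> S powr p" using p by (intro powr_mono2) auto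
    then have "I \<le> S powr p" using p I(1) by (simp add: powr_powr)
    then show ?thesis unfolding eq I(2) by (rule ennreal_leI)
  qed
  define m where "m = enn2real (\<integral>\<^sup>+x. ennreal (norm x powr p) * K x \<partial>lebesgue)"
  have m: "0 \<le> m" by (simp add: m_def)
  have phi_le: "phiK K \<beta> p (t k) \<le> m / b k powr p" for k
  proof -
    \<comment> \<open>Global integrability of |x|^p K enters here: it makes \<open>enn2real\<close>
      monotone on these integrals and bounds the truncated moments uniformly in
      \<open>k\<close>.\<close>
    have "mKp K p (b k) \<le> m"
      unfolding mKp_def m_def using K_L1
      by (intro enn2real_mono nn_integral_mono) (auto simp: indicator_def)
    then show ?thesis unfolding phiK_def b_def by (intro divide_right_mono) auto
  qed
  have energy: "(\<integral>\<^sup>+z. K' z * shift_energy p (U k) (z /\<^sub>R b k) \<partial>lborel) \<le> ennreal (S * m / b k powr p)" for k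
  proof -
    let ?J = "\<integral>\<^sup>+z. K' z * shift_energy p (U k) (z /\<^sub>R b k) \<partial>lborel"
    let ?\<phi> = "phiK K \<beta> p (t k)"
    have \<phi>: "0 < ?\<phi>" using phi_pos t_in by blast
    have "ennreal (1 / ?\<phi>) * ?J \<le> ennreal S"
      using F_le[of k] nonlocal_energy_lebesgue[OF U K' uU KK' b0[of k], of k p]
      by (simp add: Fnl_def Kt_def b_def)
    \<comment> \<open>Positivity of phi allows the normalisation to be cleared; its upper bound then
      gives the order b^(-p).\<close>
    then have "ennreal ?\<phi> * (ennreal (1 / ?\<phi>) * ?J) \<le> ennreal ?\<phi> * ennreal S"
      by (rule mult_left_mono) simp
    also have "ennreal ?\<phi> * (ennreal (1 / ?\<phi>) * ?J) = ?J"
      unfolding mult.assoc[symmetric] using \<phi> by (simp add: ennreal_mult[symmetric])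
    also have "ennreal ?\<phi> * ennreal S = ennreal (?\<phi> * S)"
      using \<phi> S(1) by (simp add: ennreal_mult)
    also have "\<dots> \<le> ennreal (S * m / b k powr p)"
      using mult_left_mono[OF phi_le[of k] S(1)] by (intro ennreal_leI) (simp add: mult.commute)
    finally show ?thesis .
  qed
  have Sm: "0 \<le> S * m" using S(1) m by simp
  obtain C where C: "0 \<le> C"
    "\<And>u b h. u \<in> borel_measurable borel \<Longrightarrow> 0 < b \<Longrightarrow>
      (\<integral>\<^sup>+z. K' z * shift_energy p u (z /\<^sub>R b) \<partial>lborel) \<le> ennreal (S * m / b powr p) \<Longrightarrow>
      shift_energy p u h \<le> ennreal (C * (norm h + 1 / b) powr p)"
    by (rule shift_energy_growth[OF K' K'_nz p Sm], rule that)
  have growth: "shift_energy p (U k) h \<le> ennreal (C * (norm h + 1 / b k) powr p)" for k h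
    by (rule C(2)[OF U b0 energy])
  show ?thesis
  proof (intro conjI allI impI)
    show "locally_precompact_Lp p u"
      using u_Lp by (intro shift_energy_growth_imp_locally_precompact[OF p _ U uU UB _ b_lim b0 C(1) growth]) auto
  next
    fix r v
    assume *: "strict_mono r \<and> Lp_loc p v \<and> (\<forall>E. compact E \<longrightarrow> (\<lambda>j. Lp_dist_on p E (u (r j)) v) \<longlonglongrightarrow> 0)"
    then have v: "v \<in> borel_measurable lebesgue" by (simp add: Lp_loc_def)
    then obtain v' where v'[measurable]: "v' \<in> borel_measurable borel" and vv': "AE x in lborel. v x = v' x"
      using completion_ex_borel_measurable_real[of v lborel] by auto
    have br: "filterlim (\<lambda>j. b (r j)) at_top sequentially"
      using * by (intro filterlim_compose[OF b_lim filterlim_subseq]) simp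
    have conv: "(\<lambda>j. \<integral>\<^sup>+x. ennreal (\<bar>U (r j) x - v' x\<bar> powr p) * indicator E x \<partial>lborel) \<longlonglongrightarrow> 0"
      if "compact E" for E
    proof -
      have "Lp_dist_on p E (u (r j)) v = (\<integral>\<^sup>+x. ennreal (\<bar>U (r j) x - v' x\<bar> powr p) * indicator E x \<partial>lborel)" for j
        unfolding Lp_dist_on_def nn_integral_completion
      proof (rule nn_integral_cong_AE)
        show "AE x in lborel. ennreal (\<bar>u (r j) x - v x\<bar> powr p) * indicator E x
            = ennreal (\<bar>U (r j) x - v' x\<bar> powr p) * indicator E x"
          using uU[of "r j"] vv' by eventually_elim simp
      qed
      moreover have "(\<lambda>j. Lp_dist_on p E (u (r j)) v) \<longlonglongrightarrow> 0" using * that by blast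
      ultimately show ?thesis by simp
    qed
    \<comment> \<open>The norm and growth bounds hold with the same constants for every index, so a
      subsequence inherits them, and its \<open>b\<close> still tends to infinity.\<close>
    note lim = Lp_loc_limit_bounds[where w = "\<lambda>j. U (r j)" and b = "\<lambda>j. b (r j)", OF p U v' UB br b0 C(1) growth conv]
    show "Xp p v"
      by (rule shift_energy_bound_imp_Xp[OF p v v' vv' lim(1) _ lim(2)]) (use C(1) in auto)
  qed
qed

end
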